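(* Let $S$ be a $C^1$ hypersurface in the Heisenberg group $\mathbb{H}$ (identified with $\mathbb{R}^3$) and let $N$ be the subgroup $N=\{(0,y,z) : y,z\in\mathbb{R}\}\subset\mathbb{H}$. Then $S$ is countably $N$-rectifiable.
   Context: Heisenberg group: $\mathbb{H}$ is the three-dimensional Heisenberg group, the simply connected Lie group whose Lie algebra is spanned by $X,Y,Z$ with only nontrivial bracket $[X,Y]=Z$. It is identified with $\mathbb{R}^3$ by letting $(a,b,c)$ denote the point $e^{aX+bY+cZ}$; in the coordinates $(x,y,z)$ the left-invariant vector fields are $X=\partial_x-\frac{y}{2}\partial_z$, $Y=\partial_y+\frac{x}{2}\partial_z$, $Z=\partial_z$. A $C^1$ hypersurface is a $C^1$ surface in $\mathbb{R}^3$ in the usual (Euclidean) sense. Let $\langle\cdot,\cdot\rangle$ be the Riemannian metric on $\mathbb{H}$ making $\{X,Y,Z\}$ orthonormal at each point. Carnot-Carathéodory metric: let $\mathscr{A}$ be the set of absolutely continuous paths in $\mathbb{H}$ whose derivative, wherever it exists, lies in the horizontal bundle $H\mathbb{H}=\mathrm{span}\{X,Y\}$. Then $d_{cc}(m,n)=\inf\{\int_0^1\langle\gamma',\gamma'\rangle^{1/2}\,dt : \gamma\in\mathscr{A},\ \gamma(0)=m,\ \gamma(1)=n\}$. $\mathbb{H}$ carries the metric $d_{cc}$, and the subgroup $N$ carries the restriction of $d_{cc}$; $N$ has Hausdorff dimension $3$ with respect to this metric. $\mathcal{H}^k$ denotes $k$-dimensional Hausdorff measure with respect to $d_{cc}$.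 Rectifiability: let $N$ be a subgroup, of Hausdorff dimension $k$, of a Carnot group (with the restricted Carnot-Carathéodory metric), and let $(M,d_M)$ be a Carnot group with its Carnot-Carathéodory metric. A subset $E\subset M$ is $N$-rectifiable if there exist a positive measure subset $U$ of $N$ and a Lipschitz map $f:U\to M$ with $\mathcal{H}^k_M(E\setminus f(U))=0$. $E$ is countably $N$-rectifiable if there exist countably many subsets $U_i\subset N$ and Lipschitz maps $f_i:U_i\to M$ with $\mathcal{H}^k_M(E\setminus\bigcup_i f_i(U_i))=0$. Here $M=\mathbb{H}$ and $k=3$. *)

theory Defs
  imports "HOL-Analysis.Analysis" "HOL-Algebra.Group"
begin

section \<open>The Heisenberg group in exponential coordinates\<close>

text \<open>The point \<open>vector [a, b, c]\<close> of \<open>real^3\<close> stands for \<open>exp (a X + b Y + c Z)\<close>; the product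
  is given by the Baker--Campbell--Hausdorff formula with \<open>[X, Y] = Z\<close>.\<close>

definition heisenberg :: "(real^3) monoid" where
  "heisenberg = \<lparr>carrier = UNIV,
     mult = (\<lambda>p q. vector [p$1 + q$1, p$2 + q$2, p$3 + q$3 + (p$1 * q$2 - p$2 * q$1) / 2]),
     one = 0\<rparr>"

definition X_field :: "real^3 \<Rightarrow> real^3" where
  "X_field p = vector [1, 0, - (p$2 / 2)]"

definition Y_field :: "real^3 \<Rightarrow> real^3" where
  "Y_field p = vector [0, 1, p$1 / 2]"

definition Z_field :: "real^3 \<Rightarrow> real^3" where
  "Z_field p = vector [0, 0, 1]"

definition vertical_subgroup :: "(real^3) set" where
  "vertical_subgroup = {p. p$1 = 0}"

lemma group_heisenberg: "group heisenberg"
proof (rule groupI)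
  fix p assume "p \<in> carrier heisenberg"
  show "\<exists>q\<in>carrier heisenberg. q \<otimes>\<^bsub>heisenberg\<^esub> p = \<one>\<^bsub>heisenberg\<^esub>"
    by (rule bexI[of _ "- p"]) (auto simp: heisenberg_def vec_eq_iff forall_3)
qed (auto simp: heisenberg_def vec_eq_iff forall_3 field_simps)

lemma inv_heisenberg: "inv\<^bsub>heisenberg\<^esub> p = - p"
proof -
  interpret group heisenberg by (rule group_heisenberg)
  show ?thesis
    by (rule inv_equality) (auto simp: heisenberg_def vec_eq_iff forall_3)
qed

lemma subgroup_vertical_subgroup: "subgroup vertical_subgroup heisenberg"
proof -
  have "inv\<^bsub>heisenberg\<^esub> p \<in> vertical_subgroup" if "p \<in> vertical_subgroup" for p
    using that by (simp add: inv_heisenberg vertical_subgroup_def)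
  then show ?thesis
    by (unfold_locales) (auto simp: heisenberg_def vertical_subgroup_def)
qed

text \<open>The fields are the left-invariant ones: the velocities at \<open>t = 0\<close> of \<open>p \<cdot> exp (t X)\<close>,
  \<open>p \<cdot> exp (t Y)\<close> and \<open>p \<cdot> exp (t Z)\<close>.\<close>

lemma has_vector_derivative_vector_3:
  assumes "(f has_real_derivative a) F" "(g has_real_derivative b) F" "(h has_real_derivative c) F"
  shows "((\<lambda>t. vector [f t, g t, h t] :: real^3) has_vector_derivative vector [a, b, c]) F"
proof -
  have eq: "vector [x, y, z] = x *\<^sub>R axis 1 1 + y *\<^sub>R axis 2 1 + z *\<^sub>R (axis 3 1 :: real^3)" for x y z
    by (simp add: vec_eq_iff forall_3 axis_def)
  have "((\<lambda>t. u t *\<^sub>R w) has_vector_derivative d *\<^sub>R w) F"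
    if "(u has_real_derivative d) F" for u :: "real \<Rightarrow> real" and d and w :: "real^3"
    using that unfolding has_vector_derivative_def has_field_derivative_def
    by (auto intro!: derivative_eq_intros)
  then show ?thesis
    unfolding eq using assms by (intro has_vector_derivative_add)
qed

lemma frame_left_invariant:
  shows "((\<lambda>t. p \<otimes>\<^bsub>heisenberg\<^esub> vector [t, 0, 0]) has_vector_derivative X_field p) (at 0)"
    and "((\<lambda>t. p \<otimes>\<^bsub>heisenberg\<^esub> vector [0, t, 0]) has_vector_derivative Y_field p) (at 0)"
    and "((\<lambda>t. p \<otimes>\<^bsub>heisenberg\<^esub> vector [0, 0, t]) has_vector_derivative Z_field p) (at 0)"
  unfolding heisenberg_def X_field_def Y_field_def Z_field_def
  by (auto intro!: has_vector_derivative_vector_3 derivative_eq_intros)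


section \<open>The Carnot--Caratheodory metric\<close>

text \<open>A tangent vector \<open>v\<close> at \<open>p\<close> has coordinates \<open>v$1\<close>, \<open>v$2\<close> and
  \<open>v$3 + p$2 * v$1 / 2 - p$1 * v$2 / 2\<close> in the frame \<open>X, Y, Z\<close>.\<close>

definition heis_inner :: "real^3 \<Rightarrow> real^3 \<Rightarrow> real^3 \<Rightarrow> real" where
  "heis_inner p u v = u$1 * v$1 + u$2 * v$2 +
     (u$3 + p$2 * u$1 / 2 - p$1 * u$2 / 2) * (v$3 + p$2 * v$1 / 2 - p$1 * v$2 / 2)"

lemma bilinear_heis_inner: "bilinear (heis_inner p)"
  by (auto simp: bilinear_def linear_iff heis_inner_def field_simps)

lemma heis_inner_orthonormal:
  "heis_inner p (X_field p) (X_field p) = 1"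
  "heis_inner p (Y_field p) (Y_field p) = 1"
  "heis_inner p (Z_field p) (Z_field p) = 1"
  "heis_inner p (X_field p) (Y_field p) = 0" "heis_inner p (Y_field p) (X_field p) = 0"
  "heis_inner p (X_field p) (Z_field p) = 0" "heis_inner p (Z_field p) (X_field p) = 0"
  "heis_inner p (Y_field p) (Z_field p) = 0" "heis_inner p (Z_field p) (Y_field p) = 0"
  by (simp_all add: heis_inner_def X_field_def Y_field_def Z_field_def)

definition horizontal_space :: "real^3 \<Rightarrow> (real^3) set" where
  "horizontal_space p = span {X_field p, Y_field p}"

text \<open>A division \<open>D\<close> of a subset of \<open>{a..b}\<close> is a finite family of non-overlapping compact
  intervals \<open>K = {Inf K..Sup K}\<close>.\<close>

definition absolutely_continuous_path :: "real \<Rightarrow> real \<Rightarrow> (real \<Rightarrow> 'a::real_normed_vector) \<Rightarrow> bool" where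
  "absolutely_continuous_path a b g \<longleftrightarrow>
     (\<forall>\<epsilon>>0. \<exists>\<delta>>0. \<forall>D T. D division_of T \<and> T \<subseteq> {a..b} \<and> (\<Sum>K\<in>D. Sup K - Inf K) < \<delta> \<longrightarrow>
        (\<Sum>K\<in>D. norm (g (Sup K) - g (Inf K))) < \<epsilon>)"

definition horizontal_path :: "(real \<Rightarrow> real^3) \<Rightarrow> bool" where
  "horizontal_path g \<longleftrightarrow> absolutely_continuous_path 0 1 g \<and>
     (\<forall>t\<in>{0..1}. \<forall>v. (g has_vector_derivative v) (at t within {0..1}) \<longrightarrow> v \<in> horizontal_space (g t))"

text \<open>The derivative of an absolutely continuous path exists almost everywhere and is absolutely
  integrable, so the integral is the genuine length; values at the remaining null set of parameters,
  where \<open>vector_derivative\<close> is unspecified, do not matter.\<close>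

definition heis_length :: "(real \<Rightarrow> real^3) \<Rightarrow> real" where
  "heis_length g = integral {0..1} (\<lambda>t.
     let v = vector_derivative g (at t within {0..1}) in sqrt (heis_inner (g t) v v))"

definition d_cc :: "real^3 \<Rightarrow> real^3 \<Rightarrow> real" where
  "d_cc m n = Inf {heis_length g | g. horizontal_path g \<and> g 0 = m \<and> g 1 = n}"


section \<open>Hausdorff measure and rectifiability\<close>

text \<open>The metric is an explicit argument, because \<open>real^3\<close> already carries the Euclidean one as
  its type class instance.  Diameters are extended-real valued: unbounded sets have diameter \<open>\<infinity>\<close>.\<close>

definition ediam :: "('a \<Rightarrow> 'a \<Rightarrow> real) \<Rightarrow> 'a set \<Rightarrow> ennreal" where
  "ediam d A = (SUP x\<in>A. SUP y\<in>A. ennreal (d x y))"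

text \<open>No normalising constant is included.  The case distinction makes the empty set
  contribute \<open>0\<close> also for \<open>k = 0\<close>, where \<open>0 ^ 0 = 1\<close>.\<close>

definition hausdorff_measure :: "('a \<Rightarrow> 'a \<Rightarrow> real) \<Rightarrow> nat \<Rightarrow> 'a set \<Rightarrow> ennreal" where
  "hausdorff_measure d k A =
     (SUP \<delta>\<in>{0::real<..}. INF C\<in>{C :: nat \<Rightarrow> 'a set. A \<subseteq> (\<Union>i. C i) \<and> (\<forall>i. ediam d (C i) \<le> ennreal \<delta>)}.
        \<Sum>i. if C i = {} then 0 else ediam d (C i) ^ k)"

definition lipschitz_between :: "('a \<Rightarrow> 'a \<Rightarrow> real) \<Rightarrow> ('b \<Rightarrow> 'b \<Rightarrow> real) \<Rightarrow> 'a set \<Rightarrow> ('a \<Rightarrow> 'b) \<Rightarrow> bool" where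
  "lipschitz_between d d' U f \<longleftrightarrow> (\<exists>L. \<forall>x\<in>U. \<forall>y\<in>U. d' (f x) (f y) \<le> L * d x y)"

text \<open>Here \<open>N\<close> carries the restriction of the metric \<open>d\<close>, the target is the whole type \<open>'b\<close> with
  metric \<open>d'\<close>, and \<open>k\<close> is to be the Hausdorff dimension of \<open>N\<close>.  Finite families are covered, since
  \<open>U i\<close> may be empty.\<close>

definition countably_rectifiable ::
    "'a set \<Rightarrow> ('a \<Rightarrow> 'a \<Rightarrow> real) \<Rightarrow> ('b \<Rightarrow> 'b \<Rightarrow> real) \<Rightarrow> nat \<Rightarrow> 'b set \<Rightarrow> bool" where
  "countably_rectifiable N d d' k E \<longleftrightarrow>
     (\<exists>(U :: nat \<Rightarrow> 'a set) (f :: nat \<Rightarrow> 'a \<Rightarrow> 'b).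
        (\<forall>i. U i \<subseteq> N \<and> lipschitz_between d d' (U i) (f i)) \<and>
        hausdorff_measure d' k (E - (\<Union>i. f i ` U i)) = 0)"


section \<open>Hypersurfaces of class C1\<close>

text \<open>Embedded hypersurfaces without boundary, not necessarily closed: locally a regular level set
  of a C1 function \<open>F\<close> with gradient \<open>G\<close>.\<close>

definition C1_hypersurface :: "'a::euclidean_space set \<Rightarrow> bool" where
  "C1_hypersurface S \<longleftrightarrow>
     (\<forall>p\<in>S. \<exists>(W :: 'a set) (F :: 'a \<Rightarrow> real) (G :: 'a \<Rightarrow> 'a).
        open W \<and> p \<in> W \<and>
        (\<forall>x\<in>W. (F has_derivative (\<lambda>h. G x \<bullet> h)) (at x)) \<and> continuous_on W G \<and>
        (\<forall>x\<in>W. G x \<noteq> 0) \<and> S \<inter> W = {x\<in>W. F x = 0})"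

end

theory Submission
  imports Defs
begin

text \<open>
  Write \<open>N\<close> for the plane \<open>x = 0\<close>.  The distance \<open>d_cc p q\<close> is comparable with
  \<open>\<bar>\<Delta>x\<bar> + \<bar>\<Delta>y\<bar> + sqrt \<bar>h\<bar>\<close>, where \<open>h\<close> is the third coordinate of the group element
  \<open>p\<^sup>-\<^sup>1q\<close> (\<open>d_cc_le_heis_gauge\<close>, \<open>heis_gauge_le_d_cc\<close>); on \<open>N\<close> this is \<open>\<bar>\<Delta>y\<bar> + sqrt \<bar>\<Delta>z\<bar>\<close>.  So everything
  about the surface can be phrased with this explicit gauge.  By Lindelof it suffices to treat small
  pieces of \<open>S\<close>, and these are of two kinds.

  \<^item> Where \<open>X\<close> or \<open>Y\<close> is transverse to \<open>S\<close>, say \<open>Y\<close>, use the coordinates \<open>x, y, w = z - xy/2\<close>, in which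
    the contact form is \<open>dw + y dx\<close> and \<open>Y\<close> is \<open>\<partial>/\<partial>y\<close>.  Then \<open>S\<close> is locally a graph
    \<open>y = f(x, w)\<close> with \<open>f\<close> Lipschitz, and the horizontal curves in \<open>S\<close> are the solutions of the
    scalar equation \<open>dw/dx = - f(x, w)\<close>.  Although \<open>S\<close> is only C1, this equation has a Lipschitz right
    hand side, so its flow is Lipschitz in the initial value \<open>s\<close>.  Sending a point of \<open>S\<close> to
    \<open>(0, x, s)\<close> in \<open>N\<close> has a Lipschitz inverse: along the curves, because they are horizontal, and
    across them, because the gauge of a Euclidean displacement \<open>\<Delta>s\<close> is at most of order
    \<open>sqrt \<bar>\<Delta>s\<bar>\<close> (\<open>intrinsic_graph_coordinates\<close>, \<open>countably_rectifiable_straightenable\<close>).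

  \<^item> The points at which \<open>S\<close> is tangent to the horizontal plane form a set of measure zero
    (\<open>hausdorff_measure_characteristic_points\<close>).  Near such points \<open>S\<close> deviates from the horizontal
    plane by \<open>o(\<rho>)\<close> over a distance \<open>\<rho>\<close>.  Over each of the order of \<open>\<rho>\<^sup>-\<^sup>2\<close> squares of side \<open>\<rho>\<close> the
    set is therefore covered by \<open>1 + o(\<rho>)/\<rho>\<^sup>2\<close> sets of diameter of order \<open>\<rho>\<close>, and the sum of the cubes
    of the diameters tends to \<open>0\<close>.

  The lower bound for \<open>d_cc\<close> has to hold for all absolutely continuous horizontal paths.  It rests on
  Lebesgue's theorem that such a path is differentiable almost everywhere and is the integral of its
  derivative (\<open>absolutely_continuous_path_differentiable_ae\<close>,
  \<open>fundamental_theorem_of_calculus_absolutely_continuous\<close>): only then does horizontality of the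
  derivative say anything about the path, and only then does the integral that defines
  \<open>heis_length\<close> control the displacement.
\<close>

section \<open>Increments over divisions and Vitali covers\<close>

definition increment :: "(real \<Rightarrow> 'a::real_normed_vector) \<Rightarrow> real set \<Rightarrow> 'a" where
  "increment h K = h (Sup K) - h (Inf K)"

lemma increment_interval [simp]: "p \<le> q \<Longrightarrow> increment h {p..q} = h q - h p"
  by (simp add: increment_def)

lemma division_real_cases:
  fixes D :: "real set set"
  assumes "D division_of T" "K \<in> D"
  obtains p q where "p \<le> q" "K = {p..q}" "{p..q} \<subseteq> T"
  using division_ofD(2-4)[OF assms] by (metis atLeastatMost_empty_iff2 box_real(2))

lemma sum_increment_division:
  fixes h :: "real \<Rightarrow> 'a::real_normed_vector"
  assumes "a \<le> b" "D division_of {a..b}"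
  shows "(\<Sum>K\<in>D. increment h K) = h b - h a"
proof -
  let ?p = "(\<lambda>K. (Inf K, K)) ` D"
  have K: "\<exists>p q. p \<le> q \<and> K = {p..q} \<and> {p..q} \<subseteq> {a..b}" if "K \<in> D" for K
    using division_real_cases[OF assms(2) that] by metis
  have tag: "?p tagged_division_of {a..b}"
  proof (rule tagged_division_ofI)
    show "finite ?p" using assms(2) by (simp add: division_of_finite)
    show "x \<in> K" "K \<subseteq> {a..b}" "\<exists>u v. K = cbox u v" if "(x, K) \<in> ?p" for x K
      using that K[of K] by auto
    show "interior K1 \<inter> interior K2 = {}"
      if "(x1, K1) \<in> ?p" "(x2, K2) \<in> ?p" "(x1, K1) \<noteq> (x2, K2)" for x1 K1 x2 K2
      using that division_ofD(5)[OF assms(2)] by auto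
    show "\<Union>{K. \<exists>x. (x, K) \<in> ?p} = {a..b}"
    proof -
      have "{K. \<exists>x. (x, K) \<in> ?p} = D" by auto
      then show ?thesis using division_ofD(6)[OF assms(2)] by simp
    qed
  qed
  have "(\<Sum>(x,K)\<in>?p. increment h K) = (\<Sum>K\<in>D. increment h K)"
    by (subst sum.reindex) (auto simp: inj_on_def)
  then show ?thesis
    using additive_tagged_division_1[OF assms(1) tag, of h] by (simp add: increment_def)
qed

lemma sum_length_division:
  fixes D :: "real set set"
  assumes "D division_of T"
  shows "(\<Sum>K\<in>D. Sup K - Inf K) = measure lebesgue T"
proof -
  have "measure lebesgue T = (\<Sum>K\<in>D. measure lebesgue K)"
    using content_division[OF assms] by simp
  also have "\<dots> = (\<Sum>K\<in>D. Sup K - Inf K)"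
    by (intro sum.cong refl) (elim division_real_cases[OF assms], auto)
  finally show ?thesis by simp
qed

text \<open>The Vitali covering theorem gives countably many disjoint intervals that cover almost all of \<open>S\<close>.
They all lie in \<open>{a..b}\<close>, so finitely many of them miss only a set of measure below \<open>\<eta>\<close>.  A finite
family is what is needed here: it is a division, and absolute continuity speaks about divisions.\<close>

lemma vitali_finite:
  fixes S :: "real set" and P :: "real \<Rightarrow> real \<Rightarrow> bool"
  assumes S: "S \<in> lmeasurable" and "\<eta> > 0"
    and sub: "\<And>p q. \<lbrakk>p < q; P p q\<rbrakk> \<Longrightarrow> {p..q} \<subseteq> {a..b}"
    and cov: "\<And>x d. \<lbrakk>x \<in> S; d > 0\<rbrakk> \<Longrightarrow> \<exists>p q. p < q \<and> P p q \<and> x \<in> {p..q} \<and> q - p < d"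
  obtains D where "D division_of \<Union>D" "pairwise disjnt D" "\<And>I. I \<in> D \<Longrightarrow> \<exists>p q. p < q \<and> P p q \<and> I = {p..q}"
    "measure lebesgue (S - \<Union>D) < \<eta>" "\<Union>D \<in> lmeasurable"
proof -
  define F where "F = {(p, q). p < q \<and> P p q}"
  let ?I = "\<lambda>i::real \<times> real. {fst i..snd i}"
  let ?a = "\<lambda>i::real \<times> real. (fst i + snd i) / 2" and ?r = "\<lambda>i::real \<times> real. (snd i - fst i) / 2"
  have cball: "cball (?a i) (?r i) = ?I i" for i
    by (auto simp: cball_eq_atLeastAtMost field_simps)
  obtain C where C: "countable C" "C \<subseteq> F" "pairwise (\<lambda>i j. disjnt (?I i) (?I j)) C"
      "negligible (S - (\<Union>i\<in>C. ?I i))"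
  proof (rule Vitali_covering_theorem_cballs[of F ?r S ?a, unfolded cball])
    show "\<exists>i. i \<in> F \<and> x \<in> ?I i \<and> ?r i < d" if xd: "x \<in> S" "d > 0" for x d
    proof -
      obtain p q where "p < q" "P p q" "x \<in> {p..q}" "q - p < d" using cov[OF xd] by blast
      then show ?thesis by (intro exI[of _ "(p, q)"]) (auto simp: F_def)
    qed
    show "0 < ?r i" if "i \<in> F" for i using that by (auto simp: F_def)
  qed (rule that)
  have inF: "?I i \<subseteq> {a..b}" if "i \<in> C" for i
    using that C(2) sub by (auto simp: F_def split_beta)
  obtain D where D: "D \<subseteq> ?I ` C" "finite D"
      "measure lebesgue (\<Union>(?I ` C)) - \<eta> < measure lebesgue (\<Union>D)"
  proof (rule measure_countable_Union_approachable[of "?I ` C" \<eta> "measure lebesgue {a..b}"])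
    show "measure lebesgue (\<Union>D') \<le> measure lebesgue {a..b}" if "D' \<subseteq> ?I ` C" "finite D'" for D'
    proof (rule measure_mono_fmeasurable)
      show "\<Union>D' \<subseteq> {a..b}" using that(1) inF by blast
      show "\<Union>D' \<in> sets lebesgue" using that by (intro sets.finite_Union) auto
    qed simp
    show "countable (?I ` C)" using C(1) by simp
    show "d \<in> lmeasurable" if "d \<in> ?I ` C" for d using that by auto
  qed (use \<open>\<eta> > 0\<close> that in auto)
  have form: "\<exists>p q. p < q \<and> P p q \<and> I = {p..q}" if ID: "I \<in> D" for I
  proof -
    obtain i where "i \<in> C" "I = ?I i" using ID D(1) by blast
    then show ?thesis using C(2) by (intro exI[of _ "fst i"] exI[of _ "snd i"]) (auto simp: F_def)
  qed
  have pw: "pairwise disjnt D"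
  proof (rule pairwiseI)
    fix I J assume "I \<in> D" "J \<in> D" "I \<noteq> J"
    then obtain i j where ij: "i \<in> C" "j \<in> C" "I = ?I i" "J = ?I j" using D(1) by blast
    then have "i \<noteq> j" using \<open>I \<noteq> J\<close> by auto
    then show "disjnt I J" using pairwiseD[OF C(3) ij(1,2)] ij(3,4) by simp
  qed
  have div: "D division_of \<Union>D"
  proof (rule division_ofI)
    show "interior I \<inter> interior J = {}" if "I \<in> D" "J \<in> D" "I \<noteq> J" for I J
      using pairwiseD[OF pw that] interior_subset[of I] interior_subset[of J] unfolding disjnt_def by blast
    show "finite D" by (rule D(2))
    show "I \<subseteq> \<Union>D" if "I \<in> D" for I using that by blast
    show "I \<noteq> {}" "\<exists>u v. I = cbox u v" if "I \<in> D" for I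
      using form[OF that] by (auto intro: less_imp_le)
  qed simp
  have mU: "\<Union>(?I ` C) \<in> lmeasurable"
  proof (rule fmeasurableI2[of "{a..b}"])
    show "\<Union>(?I ` C) \<subseteq> {a..b}" using inF by blast
    show "\<Union>(?I ` C) \<in> sets lebesgue" using C(1) by (intro sets.countable_UN') auto
  qed simp
  have mD: "\<Union>D \<in> lmeasurable"
    using D by (intro fmeasurable.finite_Union) auto
  have sub': "\<Union>D \<subseteq> \<Union>(?I ` C)" using D(1) by blast
  have "measure lebesgue (S - \<Union>D) \<le> measure lebesgue ((S - \<Union>(?I ` C)) \<union> (\<Union>(?I ` C) - \<Union>D))"
    using S mU mD by (intro measure_mono_fmeasurable) (auto intro!: fmeasurable.Diff fmeasurable.Un)
  also have "\<dots> \<le> measure lebesgue (S - \<Union>(?I ` C)) + measure lebesgue (\<Union>(?I ` C) - \<Union>D)"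
    using S mU mD by (intro measure_Un_le) (auto intro: fmeasurableD)
  also have "\<dots> = measure lebesgue (\<Union>(?I ` C)) - measure lebesgue (\<Union>D)"
    using C(4) measurable_measure_Diff[OF mU _ sub'] mD by (simp add: negligible_iff_measure fmeasurableD)
  finally have "measure lebesgue (S - \<Union>D) < \<eta>" using D(3) by simp
  with div pw form mD show ?thesis using that by blast
qed

text \<open>The point has to be interior to the intervals: this makes the set a countable intersection of
  open sets for every \<open>P\<close>, so that sets of points defined by slopes of a function are Borel.\<close>

definition shrinking_points :: "(real \<Rightarrow> real \<Rightarrow> bool) \<Rightarrow> real set" where
  "shrinking_points P = {x. \<forall>d>0. \<exists>p q. p < x \<and> x < q \<and> q - p < d \<and> P p q}"

lemma shrinking_points_borel: "shrinking_points P \<in> sets borel"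
proof -
  define W where "W n = (\<Union>(p, q)\<in>{(p, q). q - p < 1 / real (Suc n) \<and> P p q}. {p<..<q})" for n
  have W: "x \<in> W n \<longleftrightarrow> (\<exists>p q. p < x \<and> x < q \<and> q - p < 1 / real (Suc n) \<and> P p q)" for x n
    unfolding W_def by auto
  have "shrinking_points P = (\<Inter>n. W n)"
  proof (intro equalityI subsetI)
    fix x assume x: "x \<in> shrinking_points P"
    have "x \<in> W n" for n
    proof -
      have "1 / real (Suc n) > 0" by simp
      then show ?thesis using x unfolding W shrinking_points_def by blast
    qed
    then show "x \<in> (\<Inter>n. W n)" by blast
  next
    fix x assume x: "x \<in> (\<Inter>n. W n)"
    have "\<exists>p q. p < x \<and> x < q \<and> q - p < d \<and> P p q" if "d > 0" for d
    proof -
      obtain n where n: "1 / real (Suc n) < d" using nat_approx_posE[OF \<open>d > 0\<close>] by metis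
      have "x \<in> W n" using x by blast
      then obtain p q where "p < x" "x < q" "q - p < 1 / real (Suc n)" "P p q" unfolding W by blast
      then show ?thesis using n by (intro exI[of _ p] exI[of _ q]) auto
    qed
    then show "x \<in> shrinking_points P" unfolding shrinking_points_def by blast
  qed
  moreover have "open (W n)" for n
    unfolding W_def by (intro open_UN) auto
  ultimately show ?thesis by auto
qed

lemma shrinking_points_lmeasurable:
  assumes "\<And>p q. P p q \<Longrightarrow> {p..q} \<subseteq> {a..b}"
  shows "shrinking_points P \<in> lmeasurable"
proof (rule fmeasurableI2[of "{a..b}"])
  show "shrinking_points P \<subseteq> {a..b}"
  proof
    fix x assume "x \<in> shrinking_points P"
    then have "\<exists>p q. p < x \<and> x < q \<and> q - p < 1 \<and> P p q"
      unfolding shrinking_points_def using zero_less_one by blast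
    then obtain p q where "p < x" "x < q" "P p q" by blast
    then show "x \<in> {a..b}" using assms[of p q] by auto
  qed
  show "shrinking_points P \<in> sets lebesgue"
    using shrinking_points_borel by simp
qed simp

lemma absolutely_continuous_path_increments:
  assumes "absolutely_continuous_path a b g" "\<epsilon> > 0"
  obtains \<delta> where "\<delta> > 0" "\<And>D T. \<lbrakk>D division_of T; T \<subseteq> {a..b}; measure lebesgue T < \<delta>\<rbrakk> \<Longrightarrow>
    (\<Sum>K\<in>D. norm (increment g K)) < \<epsilon>"
proof -
  obtain \<delta> where "\<delta> > 0" and \<delta>: "\<forall>D T. D division_of T \<and> T \<subseteq> {a..b} \<and> (\<Sum>K\<in>D. Sup K - Inf K) < \<delta> \<longrightarrow>
        (\<Sum>K\<in>D. norm (g (Sup K) - g (Inf K))) < \<epsilon>"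
    using assms unfolding absolutely_continuous_path_def by meson
  show ?thesis
  proof (rule that[OF \<open>\<delta> > 0\<close>])
    fix D T assume "D division_of T" "T \<subseteq> {a..b}" "measure lebesgue T < \<delta>"
    then show "(\<Sum>K\<in>D. norm (increment g K)) < \<epsilon>"
      using \<delta>[rule_format, of D T] by (simp add: increment_def sum_length_division)
  qed
qed

lemma absolutely_continuous_path_imp_continuous:
  assumes "absolutely_continuous_path a b g"
  shows "continuous_on {a..b} g"
proof -
  have "\<exists>d>0. \<forall>y\<in>{a..b}. dist y x < d \<longrightarrow> dist (g y) (g x) < e" if x: "x \<in> {a..b}" and "e > 0" for x e
  proof -
    obtain \<delta> where "\<delta> > 0" and \<delta>: "\<And>D T. \<lbrakk>D division_of T; T \<subseteq> {a..b}; measure lebesgue T < \<delta>\<rbrakk> \<Longrightarrow>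
        (\<Sum>K\<in>D. norm (increment g K)) < e"
      using absolutely_continuous_path_increments[OF assms \<open>e > 0\<close>] by blast
    have "dist (g y) (g x) < e" if y: "y \<in> {a..b}" "dist y x < \<delta>" for y
    proof -
      have "{{min x y..max x y}} division_of {min x y..max x y}"
        using division_of_self[of "min x y" "max x y"] by auto
      moreover have "{min x y..max x y} \<subseteq> {a..b}" using x y by auto
      moreover have "measure lebesgue {min x y..max x y} < \<delta>"
        using y by (auto simp: dist_real_def min_def max_def)
      ultimately have "norm (increment g {min x y..max x y}) < e"
        using \<delta>[of "{{min x y..max x y}}"] by simp
      then show ?thesis by (auto simp: dist_norm norm_minus_commute min_def max_def split: if_splits)
    qed
    with \<open>\<delta> > 0\<close> show ?thesis by blast
  qed
  then show ?thesis unfolding continuous_on_iff by blast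
qed

section \<open>Almost everywhere differentiability of absolutely continuous functions\<close>

text \<open>Suppose the set \<open>E\<close> in question has measure \<open>s > 0\<close>.  Cover it, up to a small error in both directions,
by intervals \<open>I\<close> over which \<open>h\<close> descends with slope below \<open>- c\<close>, and cover it again by intervals \<open>J\<close>
inside the \<open>I\<close> over which \<open>h\<close> ascends with slope above \<open>c\<close>.  What the \<open>J\<close> leave of the \<open>I\<close> has small
total length, yet \<open>h\<close> has to descend there by more than \<open>c\<close> times the total length of the \<open>I\<close>, which is
nearly \<open>c s\<close>.  This contradicts absolute continuity.\<close>

lemma oscillating_slopes_negligible:
  fixes h :: "real \<Rightarrow> real"
  assumes ac: "absolutely_continuous_path a b h" and "c > 0"
  shows "negligible (shrinking_points (\<lambda>p q. {p..q} \<subseteq> {a..b} \<and> h q - h p < - c * (q - p)) \<inter>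
                     shrinking_points (\<lambda>p q. {p..q} \<subseteq> {a..b} \<and> h q - h p > c * (q - p)))"
    (is "negligible (shrinking_points ?N \<inter> shrinking_points ?P)")
proof (rule ccontr)
  define E where "E = shrinking_points ?N \<inter> shrinking_points ?P"
  have E: "E \<in> lmeasurable"
    unfolding E_def by (intro fmeasurable.Int shrinking_points_lmeasurable[of _ a b]) auto
  define s where "s = measure lebesgue E"
  assume "\<not> negligible (shrinking_points ?N \<inter> shrinking_points ?P)"
  then have "s > 0"
    using E unfolding E_def[symmetric] s_def by (simp add: negligible_iff_measure0 zero_less_measure_iff)
  have pos: "c * s / 2 > 0" using \<open>c > 0\<close> \<open>s > 0\<close> by simp
  obtain \<delta> where "\<delta> > 0" and \<delta>: "\<And>D T. \<lbrakk>D division_of T; T \<subseteq> {a..b}; measure lebesgue T < \<delta>\<rbrakk> \<Longrightarrow>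
      (\<Sum>K\<in>D. norm (increment h K)) < c * s / 2"
    using absolutely_continuous_path_increments[OF ac pos] by blast
  \<comment> \<open>The remainder will have length below \<open>3 \<eta>\<close>, and the \<open>I\<close> total length at least \<open>s - \<eta>\<close>.\<close>
  define \<eta> where "\<eta> = min (\<delta> / 4) (s / 4)"
  have "\<eta> > 0" "\<eta> \<le> \<delta> / 4" "\<eta> \<le> s / 4" using \<open>\<delta> > 0\<close> \<open>s > 0\<close> by (auto simp: \<eta>_def)
  obtain G where G: "open G" "E \<subseteq> G" "G \<in> lmeasurable" "measure lebesgue G < s + \<eta>"
  proof -
    obtain G where G: "open G" "E \<subseteq> G" "(G - E) \<in> lmeasurable" "emeasure lebesgue (G - E) < ennreal \<eta>"
      using sets_lebesgue_outer_open[OF fmeasurableD[OF E] \<open>\<eta> > 0\<close>] by blast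
    have GE: "G = E \<union> (G - E)" using G(2) by blast
    have "G \<in> lmeasurable" using fmeasurable.Un[OF E G(3)] GE by simp
    moreover have "measure lebesgue G < s + \<eta>"
    proof -
      have "measure lebesgue (G - E) < \<eta>"
        using G(3,4) \<open>\<eta> > 0\<close> by (simp add: emeasure_eq_measure2 ennreal_less_iff)
      moreover have "measure lebesgue G = s + measure lebesgue (G - E)"
        using measurable_measure_Diff[OF \<open>G \<in> lmeasurable\<close> fmeasurableD[OF E] G(2)] by (simp add: s_def)
      ultimately show ?thesis by simp
    qed
    ultimately show thesis using that G by blast
  qed
  \<comment> \<open>Disjoint intervals of steep descent that fill \<open>E\<close> and little else.\<close>
  obtain D1 where D1: "D1 division_of \<Union>D1" "pairwise disjnt D1"
      "\<And>I. I \<in> D1 \<Longrightarrow> \<exists>p q. p < q \<and> ({p..q} \<subseteq> G \<and> ?N p q) \<and> I = {p..q}"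
      "measure lebesgue (E - \<Union>D1) < \<eta>" "\<Union>D1 \<in> lmeasurable"
  proof (rule vitali_finite[OF E \<open>\<eta> > 0\<close>, of "\<lambda>p q. {p..q} \<subseteq> G \<and> ?N p q" a b])
    show "\<exists>p q. p < q \<and> ({p..q} \<subseteq> G \<and> ?N p q) \<and> x \<in> {p..q} \<and> q - p < d" if "x \<in> E" "d > 0" for x d
    proof -
      obtain r where r: "r > 0" "ball x r \<subseteq> G" using G(1,2) \<open>x \<in> E\<close> open_contains_ball by blast
      have "min d r > 0" using \<open>d > 0\<close> r by simp
      then obtain p q where pq: "p < x" "x < q" "q - p < min d r" "?N p q"
        using \<open>x \<in> E\<close> unfolding E_def shrinking_points_def by blast
      then have "{p..q} \<subseteq> ball x r" by (auto simp: dist_real_def)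
      with pq r(2) show ?thesis by (intro exI[of _ p] exI[of _ q]) auto
    qed
  qed (use that in auto)
  have fin1: "finite D1" using D1(1) by blast
  define S2 where "S2 = E \<inter> \<Union>(interior ` D1)"
  have S2: "S2 \<in> lmeasurable"
    unfolding S2_def by (intro fmeasurable_Int_fmeasurable E) (use fin1 in auto)
  have mS2: "measure lebesgue S2 > s - \<eta>"
  proof -
    define B where "B = Inf ` D1 \<union> Sup ` D1"
    have B: "negligible B" unfolding B_def using fin1 by (intro negligible_finite) auto
    have "E \<subseteq> S2 \<union> ((E - \<Union>D1) \<union> B)"
    proof
      fix x assume x: "x \<in> E"
      show "x \<in> S2 \<union> ((E - \<Union>D1) \<union> B)"
      proof (cases "x \<in> \<Union>D1")
        case True
        then obtain I where I: "I \<in> D1" "x \<in> I" by blast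
        then obtain p q where "p < q" "I = {p..q}" using D1(3) by blast
        then have "x \<in> interior I \<or> x = Inf I \<or> x = Sup I" using I(2) by auto
        then show ?thesis using I(1) x by (auto simp: S2_def B_def)
      qed (use x in auto)
    qed
    then have "s \<le> measure lebesgue (S2 \<union> ((E - \<Union>D1) \<union> B))"
      unfolding s_def using E S2 D1(5) B
      by (intro measure_mono_fmeasurable fmeasurable.Un) (auto simp: negligible_iff_measure intro: fmeasurable.Diff)
    also have "\<dots> \<le> measure lebesgue S2 + (measure lebesgue (E - \<Union>D1) + measure lebesgue B)"
      using E S2 D1(5) B
      by (intro order_trans[OF measure_Un_le] add_left_mono measure_Un_le)
         (auto simp: negligible_iff_measure intro!: fmeasurableD fmeasurable.Diff fmeasurable.Un)
    finally show ?thesis using D1(4) B by (simp add: negligible_iff_measure)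
  qed
  \<comment> \<open>Inside them, intervals of steep ascent that again fill \<open>E\<close>.\<close>
  obtain D2 where D2: "D2 division_of \<Union>D2" "pairwise disjnt D2"
      "\<And>J. J \<in> D2 \<Longrightarrow> \<exists>p q. p < q \<and> ((\<exists>I\<in>D1. {p..q} \<subseteq> I) \<and> ?P p q) \<and> J = {p..q}"
      "measure lebesgue (S2 - \<Union>D2) < \<eta>" "\<Union>D2 \<in> lmeasurable"
  proof (rule vitali_finite[OF S2 \<open>\<eta> > 0\<close>, of "\<lambda>p q. (\<exists>I\<in>D1. {p..q} \<subseteq> I) \<and> ?P p q" a b])
    show "\<exists>p q. p < q \<and> ((\<exists>I\<in>D1. {p..q} \<subseteq> I) \<and> ?P p q) \<and> x \<in> {p..q} \<and> q - p < d" if x: "x \<in> S2" "d > 0" for x d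
    proof -
      obtain I where I: "I \<in> D1" "x \<in> interior I" using x(1) unfolding S2_def by blast
      obtain r where r: "r > 0" "ball x r \<subseteq> I" using I(2) mem_interior by blast
      have "min d r > 0" using \<open>d > 0\<close> r by simp
      then obtain p q where pq: "p < x" "x < q" "q - p < min d r" "?P p q"
        using x(1) unfolding S2_def E_def shrinking_points_def by blast
      then have "{p..q} \<subseteq> ball x r" by (auto simp: dist_real_def)
      then have "{p..q} \<subseteq> I" using r(2) by blast
      with pq I(1) show ?thesis by (intro exI[of _ p] exI[of _ q]) auto
    qed
  qed (use that in auto)
  have fin2: "finite D2" using D2(1) by blast
  have sub1: "\<Union>D1 \<subseteq> G" "\<Union>D1 \<subseteq> {a..b}" using D1(3) by blast+
  define D2' where "D2' I = {J\<in>D2. J \<subseteq> I}" for I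
  have "\<exists>q. D2' I \<subseteq> q \<and> q division_of I" if "I \<in> D1" for I
  proof -
    obtain u v where uv: "I = cbox u v" using D1(1) \<open>I \<in> D1\<close> by (meson division_ofD(4))
    have "D2' I division_of \<Union>(D2' I)"
      by (rule division_of_subset[OF D2(1)]) (auto simp: D2'_def)
    moreover have "\<Union>(D2' I) \<subseteq> cbox u v" unfolding uv[symmetric] by (auto simp: D2'_def)
    ultimately show ?thesis using partial_division_extend_interval uv by metis
  qed
  then obtain Q where Q: "\<And>I. I \<in> D1 \<Longrightarrow> D2' I \<subseteq> Q I \<and> Q I division_of I" by metis
  \<comment> \<open>\<open>R I\<close> subdivides what the ascending intervals leave of \<open>I\<close>.\<close>
  define R where "R I = Q I - D2' I" for I
  have finQ: "finite (Q I)" if "I \<in> D1" for I using Q[OF that] by blast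
  have subI: "K \<subseteq> I \<and> K \<noteq> {}" if "I \<in> D1" "K \<in> Q I" for I K
    using Q[OF that(1)] that(2) by blast
  have once: "I = I'" if "I \<in> D1" "I' \<in> D1" "K \<in> Q I" "K \<in> Q I'" for I I' K
    using subI[OF that(1,3)] subI[OF that(2,4)] D1(2) that(1,2) unfolding pairwise_def disjnt_def by blast
  have disjR: "\<forall>I\<in>D1. \<forall>I'\<in>D1. I \<noteq> I' \<longrightarrow> R I \<inter> R I' = {}"
    using once unfolding R_def by blast
  have disjD: "\<forall>I\<in>D1. \<forall>I'\<in>D1. I \<noteq> I' \<longrightarrow> D2' I \<inter> D2' I' = {}"
    using once Q by blast
  have finR: "\<forall>I\<in>D1. finite (R I)" using finQ by (simp add: R_def)
  have finD: "\<forall>I\<in>D1. finite (D2' I)" using fin2 by (simp add: D2'_def)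
  have UD: "(\<Union>I\<in>D1. D2' I) = D2" using D2(3) unfolding D2'_def by blast
  have divR: "(\<Union>I\<in>D1. R I) division_of \<Union>(\<Union>I\<in>D1. R I)"
  proof (rule division_ofI)
    show "finite (\<Union>I\<in>D1. R I)" using fin1 finR by blast
    fix K assume KR: "K \<in> (\<Union>I\<in>D1. R I)"
    then obtain I where I: "I \<in> D1" "K \<in> Q I" unfolding R_def by blast
    then show "K \<noteq> {}" "\<exists>u v. K = cbox u v" using Q[OF I(1)] by (meson division_ofD(3,4))+
    show "K \<subseteq> \<Union>(\<Union>I\<in>D1. R I)" using KR by blast
    fix L assume L: "L \<in> (\<Union>I\<in>D1. R I)" "K \<noteq> L"
    then obtain I' where I': "I' \<in> D1" "L \<in> Q I'" unfolding R_def by blast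
    show "interior K \<inter> interior L = {}"
    proof (cases "I = I'")
      case True
      then show ?thesis using I I' L(2) Q[OF I(1)] by (meson division_ofD(5))
    next
      case False
      then have "I \<inter> I' = {}" using D1(2) I(1) I'(1) unfolding pairwise_def disjnt_def by blast
      then show ?thesis using subI[OF I] subI[OF I'] interior_subset by blast
    qed
  qed simp
  let ?len = "\<lambda>K::real set. Sup K - Inf K"
  have lenQ: "(\<Sum>K\<in>R I. ?len K) = ?len I - (\<Sum>K\<in>D2' I. ?len K)" if "I \<in> D1" for I
  proof -
    have "(\<Sum>K\<in>Q I. ?len K) = measure lebesgue I" using Q[OF that] by (simp add: sum_length_division)
    moreover have "measure lebesgue I = ?len I" using D1(3)[OF that] by auto
    moreover have "(\<Sum>K\<in>R I. ?len K) = (\<Sum>K\<in>Q I. ?len K) - (\<Sum>K\<in>D2' I. ?len K)"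
      unfolding R_def using Q[OF that] finQ[OF that] by (intro sum_diff) auto
    ultimately show ?thesis by simp
  qed
  have incQ: "(\<Sum>K\<in>R I. norm (increment h K)) \<ge> c * ?len I" if ID: "I \<in> D1" for I
  proof -
    obtain p q where pq: "p < q" "?N p q" "I = {p..q}" using D1(3)[OF ID] by blast
    have "(\<Sum>K\<in>Q I. increment h K) = h q - h p"
      using Q[OF ID] pq by (intro sum_increment_division) auto
    moreover have "(\<Sum>K\<in>R I. increment h K) = (\<Sum>K\<in>Q I. increment h K) - (\<Sum>K\<in>D2' I. increment h K)"
      unfolding R_def using Q[OF ID] finQ[OF ID] by (intro sum_diff) auto
    moreover have "(\<Sum>K\<in>D2' I. increment h K) \<ge> 0"
    proof (rule sum_nonneg)
      fix J assume "J \<in> D2' I"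
      then obtain u v where uv: "u < v" "J = {u..v}" "?P u v" using D2(3) unfolding D2'_def by blast
      then have "c * (v - u) > 0" using \<open>c > 0\<close> by simp
      then show "increment h J \<ge> 0" using uv by simp
    qed
    ultimately have "(\<Sum>K\<in>R I. increment h K) \<le> - (c * ?len I)" using pq by simp
    moreover have "\<bar>\<Sum>K\<in>R I. increment h K\<bar> \<le> (\<Sum>K\<in>R I. norm (increment h K))"
      using norm_sum[of "increment h" "R I"] by simp
    ultimately show ?thesis by linarith
  qed
  have T1: "(\<Sum>I\<in>D1. ?len I) = measure lebesgue (\<Union>D1)" by (rule sum_length_division[OF D1(1)])
  have T2: "(\<Sum>I\<in>D1. \<Sum>J\<in>D2' I. ?len J) = measure lebesgue (\<Union>D2)"
    using sum.UNION_disjoint[OF fin1 finD disjD, of ?len] sum_length_division[OF D2(1)] UD by simp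
  have m1: "measure lebesgue (\<Union>D1) \<le> measure lebesgue G"
    by (rule measure_mono_fmeasurable[OF sub1(1) fmeasurableD[OF D1(5)] G(3)])
  have "measure lebesgue S2 \<le> measure lebesgue (\<Union>D2 \<union> (S2 - \<Union>D2))"
    using S2 D2(5) by (intro measure_mono_fmeasurable) (auto intro!: fmeasurable.Un fmeasurable.Diff)
  also have "\<dots> \<le> measure lebesgue (\<Union>D2) + measure lebesgue (S2 - \<Union>D2)"
    using S2 D2(5) by (intro measure_Un_le) (auto intro!: fmeasurableD)
  finally have m2: "measure lebesgue (\<Union>D2) > s - 2 * \<eta>" using mS2 D2(4) by simp
  have "measure lebesgue (\<Union>(\<Union>I\<in>D1. R I)) = (\<Sum>I\<in>D1. \<Sum>K\<in>R I. ?len K)"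
    using sum.UNION_disjoint[OF fin1 finR disjR, of ?len] sum_length_division[OF divR] by simp
  also have "\<dots> = (\<Sum>I\<in>D1. ?len I - (\<Sum>K\<in>D2' I. ?len K))"
    by (intro sum.cong refl lenQ)
  also have "\<dots> = (\<Sum>I\<in>D1. ?len I) - (\<Sum>I\<in>D1. \<Sum>K\<in>D2' I. ?len K)"
    by (rule sum_subtractf)
  also have "\<dots> = measure lebesgue (\<Union>D1) - measure lebesgue (\<Union>D2)"
    by (simp only: T1 T2)
  finally have "measure lebesgue (\<Union>(\<Union>I\<in>D1. R I)) < \<delta>"
    using m1 m2 G(4) \<open>\<eta> \<le> \<delta> / 4\<close> \<open>\<eta> > 0\<close> by linarith
  moreover have "\<Union>(\<Union>I\<in>D1. R I) \<subseteq> {a..b}" using subI sub1(2) unfolding R_def by blast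
  ultimately have "(\<Sum>K\<in>(\<Union>I\<in>D1. R I). norm (increment h K)) < c * s / 2" by (intro \<delta>[OF divR])
  moreover have "(\<Sum>K\<in>(\<Union>I\<in>D1. R I). norm (increment h K)) = (\<Sum>I\<in>D1. \<Sum>K\<in>R I. norm (increment h K))"
    by (rule sum.UNION_disjoint[OF fin1 finR disjR])
  moreover have "(\<Sum>I\<in>D1. \<Sum>K\<in>R I. norm (increment h K)) \<ge> (\<Sum>I\<in>D1. c * ?len I)"
    by (intro sum_mono incQ)
  moreover have "(\<Sum>I\<in>D1. c * ?len I) = c * measure lebesgue (\<Union>D1)"
    by (simp only: T1 sum_distrib_left[symmetric])
  moreover have "measure lebesgue (\<Union>D1) \<ge> 3 * s / 4"
  proof -
    have "S2 \<subseteq> \<Union>D1" unfolding S2_def using interior_subset by blast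
    then have "measure lebesgue S2 \<le> measure lebesgue (\<Union>D1)"
      using S2 D1(5) by (intro measure_mono_fmeasurable) auto
    then show ?thesis using mS2 \<open>\<eta> \<le> s / 4\<close> by simp
  qed
  ultimately have "c * (3 * s / 4) < c * s / 2"
    using \<open>c > 0\<close> by (smt (verit) mult_left_mono)
  then show False using \<open>c > 0\<close> \<open>s > 0\<close> by (simp add: field_simps)
qed

text \<open>One criterion for all the closure properties that occur: \<open>M = 0\<close> gives components and negatives of
\<open>g\<close>, \<open>C = 0\<close> gives Lipschitz paths, and \<open>C = 1\<close> allows adding a linear function.\<close>

lemma absolutely_continuous_path_dominated:
  assumes g: "absolutely_continuous_path a b g" and "C \<ge> 0" "M \<ge> 0"
    and dom: "\<And>p q. \<lbrakk>a \<le> p; p \<le> q; q \<le> b\<rbrakk> \<Longrightarrow> norm (f q - f p) \<le> C * norm (g q - g p) + M * (q - p)"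
  shows "absolutely_continuous_path a b f"
  unfolding absolutely_continuous_path_def
proof (intro allI impI)
  fix e :: real assume "e > 0"
  have e': "e / (2 * (C + 1)) > 0" using \<open>e > 0\<close> \<open>C \<ge> 0\<close> by simp
  obtain \<delta> where "\<delta> > 0" and \<delta>: "\<And>D T. \<lbrakk>D division_of T; T \<subseteq> {a..b}; measure lebesgue T < \<delta>\<rbrakk> \<Longrightarrow>
      (\<Sum>K\<in>D. norm (increment g K)) < e / (2 * (C + 1))"
    using absolutely_continuous_path_increments[OF g e'] by blast
  define \<delta>' where "\<delta>' = min \<delta> (e / (2 * (M + 1)))"
  have "\<delta>' > 0" using \<open>\<delta> > 0\<close> \<open>e > 0\<close> \<open>M \<ge> 0\<close> by (simp add: \<delta>'_def)
  moreover have "(\<Sum>K\<in>D. norm (f (Sup K) - f (Inf K))) < e"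
    if D: "D division_of T" "T \<subseteq> {a..b}" "(\<Sum>K\<in>D. Sup K - Inf K) < \<delta>'" for D T
  proof -
    let ?G = "\<Sum>K\<in>D. norm (increment g K)" and ?L = "\<Sum>K\<in>D. Sup K - Inf K"
    have "(\<Sum>K\<in>D. norm (f (Sup K) - f (Inf K))) \<le> (\<Sum>K\<in>D. C * norm (increment g K) + M * (Sup K - Inf K))"
    proof (rule sum_mono)
      fix K assume "K \<in> D"
      then obtain p q where pq: "p \<le> q" "K = {p..q}" "{p..q} \<subseteq> T" using division_real_cases[OF D(1)] by metis
      then have "{p..q} \<subseteq> {a..b}" using D(2) by blast
      then have "a \<le> p" "q \<le> b" using pq(1) by auto
      then show "norm (f (Sup K) - f (Inf K)) \<le> C * norm (increment g K) + M * (Sup K - Inf K)"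
        using dom[of p q] pq by simp
    qed
    also have "\<dots> = C * ?G + M * ?L" by (simp only: sum.distrib sum_distrib_left)
    also have "C * ?G \<le> C * (e / (2 * (C + 1)))"
      using \<delta>[OF D(1,2)] D(3) \<open>C \<ge> 0\<close> sum_length_division[OF D(1)]
      by (intro mult_left_mono) (auto simp: \<delta>'_def)
    also have "C * (e / (2 * (C + 1))) \<le> e / 2" using \<open>e > 0\<close> \<open>C \<ge> 0\<close> by (simp add: field_simps)
    finally have *: "(\<Sum>K\<in>D. norm (f (Sup K) - f (Inf K))) \<le> e / 2 + M * ?L" by simp
    have "?L < e / (2 * (M + 1))" using D(3) by (simp only: \<delta>'_def min_less_iff_conj)
    moreover have "?L \<ge> 0" using sum_length_division[OF D(1)] by simp
    ultimately have "(M + 1) * ?L < e / 2" "M * ?L \<le> (M + 1) * ?L" using \<open>M \<ge> 0\<close> 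
      by (simp_all only: pos_less_divide_eq mult.commute mult_right_mono) (simp_all add: field_simps)
    with * show ?thesis by linarith
  qed
  ultimately show "\<exists>\<delta>>0. \<forall>D T. D division_of T \<and> T \<subseteq> {a..b} \<and> (\<Sum>K\<in>D. Sup K - Inf K) < \<delta> \<longrightarrow>
      (\<Sum>K\<in>D. norm (f (Sup K) - f (Inf K))) < e" by blast
qed

lemma Lipschitz_imp_absolutely_continuous_path:
  assumes "L-lipschitz_on {a..b} f"
  shows "absolutely_continuous_path a b f"
proof (rule absolutely_continuous_path_dominated[where g = "\<lambda>_. 0::real" and C = 0 and M = L])
  show "absolutely_continuous_path a b (\<lambda>_. 0::real)"
    unfolding absolutely_continuous_path_def by (auto intro: exI[of _ 1])
  show "norm (f q - f p) \<le> 0 * norm (0 - 0 :: real) + L * (q - p)" if "a \<le> p" "p \<le> q" "q \<le> b" for p q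
    using lipschitz_onD[OF assms, of q p] that by (simp add: dist_norm)
qed (use lipschitz_on_nonneg[OF assms] in auto)

text \<open>Over short intervals the increments of \<open>h\<close> add up to less than \<open>1\<close>, so disjoint intervals of slope above
\<open>n\<close> have total length below \<open>1 / n\<close>.\<close>

lemma infinite_slopes_negligible:
  fixes h :: "real \<Rightarrow> real"
  assumes ac: "absolutely_continuous_path a b h"
  shows "negligible (\<Inter>n::nat. shrinking_points (\<lambda>p q. {p..q} \<subseteq> {a..b} \<and> h q - h p > n * (q - p)))"
    (is "negligible (\<Inter>n. shrinking_points (?P n))")
proof -
  define E where "E = (\<Inter>n. shrinking_points (?P n))"
  have E: "E \<in> sets lebesgue"
    unfolding E_def using shrinking_points_borel by (intro sets.countable_INT'') auto
  obtain \<delta> where "\<delta> > 0" and \<delta>: "\<And>D T. \<lbrakk>D division_of T; T \<subseteq> {a..b}; measure lebesgue T < \<delta>\<rbrakk> \<Longrightarrow>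
      (\<Sum>K\<in>D. norm (increment h K)) < 1"
    using absolutely_continuous_path_increments[OF ac zero_less_one] by blast
  have small: "negligible (E \<inter> {u<..<v})" if uv: "v - u < \<delta>" for u v
  proof -
    have Em: "E \<inter> {u<..<v} \<in> lmeasurable"
      using fmeasurable_Int_fmeasurable[of "{u<..<v}" lebesgue E] E by (simp add: Int_commute)
    have "measure lebesgue (E \<inter> {u<..<v}) \<le> 2 / real (Suc n)" for n
    proof -
      have pos: "1 / real (Suc n) > 0" by simp
      obtain D where D: "D division_of \<Union>D" "pairwise disjnt D"
          "\<And>I. I \<in> D \<Longrightarrow> \<exists>p q. p < q \<and> ({p..q} \<subseteq> {u<..<v} \<and> ?P (Suc n) p q) \<and> I = {p..q}"
          "measure lebesgue (E \<inter> {u<..<v} - \<Union>D) < 1 / real (Suc n)" "\<Union>D \<in> lmeasurable"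
      proof (rule vitali_finite[OF Em pos, of "\<lambda>p q. {p..q} \<subseteq> {u<..<v} \<and> ?P (Suc n) p q" a b])
        show "\<exists>p q. p < q \<and> ({p..q} \<subseteq> {u<..<v} \<and> ?P (Suc n) p q) \<and> x \<in> {p..q} \<and> q - p < d"
          if x: "x \<in> E \<inter> {u<..<v}" "d > 0" for x d
        proof -
          have "min d (min (x - u) (v - x)) > 0" using x by auto
          moreover have "x \<in> shrinking_points (?P (Suc n))" using x(1) unfolding E_def by blast
          ultimately obtain p q where "p < x" "x < q" "q - p < min d (min (x - u) (v - x))" "?P (Suc n) p q"
            unfolding shrinking_points_def by blast
          then show ?thesis by (intro exI[of _ p] exI[of _ q]) auto
        qed
      qed (use that in auto)
      have sub: "\<Union>D \<subseteq> {u<..<v}" "\<Union>D \<subseteq> {a..b}" using D(3) by blast+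
      have "measure lebesgue (\<Union>D) \<le> measure lebesgue {u<..<v}"
        using sub(1) D(5) by (intro measure_mono_fmeasurable) auto
      also have "\<dots> < \<delta>" using uv \<open>\<delta> > 0\<close> by (cases "u \<le> v") auto
      finally have "(\<Sum>K\<in>D. norm (increment h K)) < 1" using \<delta>[OF D(1) sub(2)] by blast
      moreover have "(\<Sum>K\<in>D. norm (increment h K)) \<ge> (\<Sum>K\<in>D. real (Suc n) * (Sup K - Inf K))"
      proof (rule sum_mono)
        fix K assume K: "K \<in> D"
        obtain p q where pq: "p < q" "?P (Suc n) p q" "K = {p..q}" using D(3)[OF K] by blast
        have "real (Suc n) * (q - p) \<le> \<bar>h q - h p\<bar>" using pq(2) abs_ge_self[of "h q - h p"] by linarith
        then show "real (Suc n) * (Sup K - Inf K) \<le> norm (increment h K)" using pq by simp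
      qed
      ultimately have "real (Suc n) * measure lebesgue (\<Union>D) < 1"
        using sum_length_division[OF D(1)] by (simp only: sum_distrib_left[symmetric])
      then have "measure lebesgue (\<Union>D) < 1 / real (Suc n)"
        by (simp add: field_simps)
      moreover have "measure lebesgue (E \<inter> {u<..<v}) \<le> measure lebesgue (\<Union>D \<union> (E \<inter> {u<..<v} - \<Union>D))"
        using Em D(5) by (intro measure_mono_fmeasurable) (auto intro!: fmeasurable.Un fmeasurable.Diff)
      moreover have "\<dots> \<le> measure lebesgue (\<Union>D) + measure lebesgue (E \<inter> {u<..<v} - \<Union>D)"
        using Em D(5) by (intro measure_Un_le) (auto intro!: fmeasurableD fmeasurable.Diff)
      moreover have "2 / real (Suc n) = 1 / real (Suc n) + 1 / real (Suc n)" by simp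
      ultimately show ?thesis using D(4) by linarith
    qed
    moreover have "(\<lambda>n. 2 / real (Suc n)) \<longlonglongrightarrow> 0"
      using LIMSEQ_Suc[OF lim_const_over_n[of "2::real"]] by simp
    ultimately have "measure lebesgue (E \<inter> {u<..<v}) \<le> 0"
      using LIMSEQ_le_const by blast
    then show ?thesis using Em by (simp add: negligible_iff_measure0 measure_le_0_iff)
  qed
  have "negligible E"
    unfolding locally_negligible_alt[of E]
  proof
    fix x assume "x \<in> E"
    then show "\<exists>U. openin (top_of_set E) U \<and> x \<in> U \<and> negligible U"
      using small[of "x + \<delta> / 3" "x - \<delta> / 3"] \<open>\<delta> > 0\<close>
      by (intro exI[of _ "E \<inter> {x - \<delta> / 3<..<x + \<delta> / 3}"]) auto
  qed
  then show ?thesis by (simp add: E_def)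
qed

text \<open>Subtracting a linear function turns the oscillation result into a statement about any two slopes
\<open>s < t\<close>; rational \<open>s\<close> and \<open>t\<close> suffice, which leaves a countable union of null sets.  Outside it and
outside the points of infinite slope the slopes over shrinking intervals around \<open>x\<close> converge.\<close>

lemma absolutely_continuous_real_differentiable_ae:
  fixes h :: "real \<Rightarrow> real"
  assumes ac: "absolutely_continuous_path a b h"
  obtains N where "negligible N" "\<And>x. x \<in> {a..b} - N \<Longrightarrow> \<exists>l. (h has_real_derivative l) (at x within {a..b})"
proof -
  define above where "above r = shrinking_points (\<lambda>p q. {p..q} \<subseteq> {a..b} \<and> h q - h p > r * (q - p))" for r
  define below where "below r = shrinking_points (\<lambda>p q. {p..q} \<subseteq> {a..b} \<and> h q - h p < r * (q - p))" for r
  have osc: "negligible (below s \<inter> above t)" if "s < t" for s t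
  proof -
    define m c where "m = (s + t) / 2" and "c = (t - s) / 2"
    have s: "s = m - c" and t: "t = m + c" and "c > 0" using that by (auto simp: m_def c_def field_simps)
    have ac': "absolutely_continuous_path a b (\<lambda>x. h x - m * x)"
    proof (rule absolutely_continuous_path_dominated[OF ac zero_le_one, of "\<bar>m\<bar>"])
      fix p q :: real assume "p \<le> q"
      have "(h q - m * q) - (h p - m * p) = (h q - h p) - m * (q - p)" by (simp add: algebra_simps)
      then have "norm ((h q - m * q) - (h p - m * p)) \<le> norm (h q - h p) + norm (m * (q - p))"
        using norm_triangle_ineq4[of "h q - h p" "m * (q - p)"] by simp
      then show "norm ((h q - m * q) - (h p - m * p)) \<le> 1 * norm (h q - h p) + \<bar>m\<bar> * (q - p)"
        using \<open>p \<le> q\<close> by (simp add: abs_mult)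
    qed simp
    have "(h q - m * q) - (h p - m * p) < - c * (q - p) \<longleftrightarrow> h q - h p < s * (q - p)"
         "(h q - m * q) - (h p - m * p) > c * (q - p) \<longleftrightarrow> h q - h p > t * (q - p)" for p q
      by (simp_all add: s t algebra_simps)
    with oscillating_slopes_negligible[OF ac' \<open>c > 0\<close>] show ?thesis by (simp add: above_def below_def)
  qed
  have "absolutely_continuous_path a b (\<lambda>x. - h x)"
    by (rule absolutely_continuous_path_dominated[OF ac zero_le_one order_refl]) (simp add: norm_minus_commute)
  moreover have below_eq: "below (- real n) = shrinking_points (\<lambda>p q. {p..q} \<subseteq> {a..b} \<and> - h q - - h p > n * (q - p))" for n :: nat
    unfolding below_def by (intro arg_cong[where f = shrinking_points] ext) auto
  ultimately have inf: "negligible (\<Inter>n::nat. above n)" "negligible (\<Inter>n::nat. below (- real n))"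
    using infinite_slopes_negligible[OF ac] infinite_slopes_negligible[of a b "\<lambda>x. - h x"]
    by (simp_all add: above_def below_eq)
  define N where "N = {a, b} \<union> (\<Inter>n::nat. above n) \<union> (\<Inter>n::nat. below (- real n)) \<union>
    (\<Union>(s, t)\<in>{(s, t). s \<in> \<rat> \<and> t \<in> \<rat> \<and> s < t}. below s \<inter> above t)"
  have "negligible (\<Union>(s, t)\<in>{(s, t). s \<in> \<rat> \<and> t \<in> \<rat> \<and> s < t}. below s \<inter> above t)"
  proof (rule negligible_countable_Union)
    have "countable {(s, t). s \<in> \<rat> \<and> t \<in> \<rat> \<and> (s::real) < t}"
      by (rule countable_subset[of _ "\<rat> \<times> \<rat>"]) (auto simp: countable_rat)
    then show "countable ((\<lambda>(s, t). below s \<inter> above t) ` {(s, t). s \<in> \<rat> \<and> t \<in> \<rat> \<and> s < t})"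
      by (rule countable_image)
  qed (use osc in auto)
  then have "negligible N" unfolding N_def using inf by (intro negligible_Un) auto
  have diff: "\<exists>l. (h has_real_derivative l) (at x within {a..b})" if x: "x \<in> {a..b} - N" for x
  proof -
    have ab: "a < x" "x < b" using x by (auto simp: N_def)
    have cont: "continuous_on {a..b} h" by (rule absolutely_continuous_path_imp_continuous[OF ac])
    have above_antimono: "x \<in> above r" if "r \<le> s" "x \<in> above s" for r s
    proof -
      have "h q - h p > r * (q - p)" if "h q - h p > s * (q - p)" "p < q" for p q
        using that \<open>r \<le> s\<close> mult_right_mono[of r s "q - p"] by linarith
      then show ?thesis using \<open>x \<in> above s\<close> unfolding above_def shrinking_points_def by (smt (verit) mem_Collect_eq)
    qed
    have gap: "x \<notin> below s \<or> x \<notin> above t" if "s < t" for s t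
    proof -
      obtain s' where s': "s < s'" "s' < t" "s' \<in> \<rat>" using Rats_dense_in_real[OF \<open>s < t\<close>] by blast
      obtain t' where t': "s' < t'" "t' < t" "t' \<in> \<rat>" using Rats_dense_in_real[OF s'(2)] by blast
      have "x \<notin> below s' \<inter> above t'" using x s' t' unfolding N_def by blast
      moreover have "x \<in> above t'" if "x \<in> above t" using above_antimono[of t' t] that t' by simp
      moreover have "x \<in> below s'" if "x \<in> below s"
      proof -
        have "h q - h p < s' * (q - p)" if "h q - h p < s * (q - p)" "p < q" for p q
          using that s' mult_right_mono[of s s' "q - p"] by linarith
        then show ?thesis using that unfolding below_def shrinking_points_def by (smt (verit) mem_Collect_eq)
      qed
      ultimately show ?thesis by blast
    qed
    have not_above: "\<exists>d>0. \<forall>p q. p < x \<and> x < q \<and> q - p < d \<and> {p..q} \<subseteq> {a..b} \<longrightarrow> h q - h p \<le> r * (q - p)"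
      if "x \<notin> above r" for r
      using that unfolding above_def shrinking_points_def mem_Collect_eq by (meson not_less)
    have not_below: "\<exists>d>0. \<forall>p q. p < x \<and> x < q \<and> q - p < d \<and> {p..q} \<subseteq> {a..b} \<longrightarrow> h q - h p \<ge> r * (q - p)"
      if "x \<notin> below r" for r
      using that unfolding below_def shrinking_points_def mem_Collect_eq by (meson not_less)
    obtain n where n: "x \<notin> above (real n)" using x unfolding N_def by blast
    obtain m where m: "x \<notin> below (- real m)" using x unfolding N_def by blast
    \<comment> \<open>The derivative is the cut between the slopes that are exceeded at all scales and the others.\<close>
    define l where "l = Inf {r. x \<notin> above r}"
    have bdd: "bdd_below {r. x \<notin> above r}"
    proof (rule bdd_belowI[of _ "- real m"])
      fix r assume "r \<in> {r. x \<notin> above r}"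
      then obtain d where d: "d > 0" "\<And>p q. \<lbrakk>p < x; x < q; q - p < d; {p..q} \<subseteq> {a..b}\<rbrakk> \<Longrightarrow> h q - h p \<le> r * (q - p)"
        using not_above[of r] by blast
      obtain e where e: "e > 0" "\<And>p q. \<lbrakk>p < x; x < q; q - p < e; {p..q} \<subseteq> {a..b}\<rbrakk> \<Longrightarrow> h q - h p \<ge> - real m * (q - p)"
        using not_below[OF m] by blast
      \<comment> \<open>A common interval \<open>{x - k..x + k}\<close> of length \<open>2 k\<close> below \<open>d\<close> and \<open>e\<close> on which both bounds apply.\<close>
      define k where "k = min (min d e) (min (x - a) (b - x)) / 3"
      have "3 * k > 0" "3 * k \<le> d" "3 * k \<le> e" "3 * k \<le> x - a" "3 * k \<le> b - x"
        using d(1) e(1) ab by (auto simp: k_def)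
      then have k: "k > 0" "k < d / 2" "k < e / 2" "k \<le> x - a" "k \<le> b - x" by auto
      have "- real m * (2 * k) \<le> r * (2 * k)"
        using d(2)[of "x - k" "x + k"] e(2)[of "x - k" "x + k"] k by (auto simp: algebra_simps)
      then show "- real m \<le> r" using k(1) by (simp only: mult_le_cancel_right)
    qed
    have "(h has_real_derivative l) (at x)"
      unfolding has_field_derivative_iff LIM_def
    proof (intro allI impI)
      fix e :: real assume "e > 0"
      have "\<exists>r\<in>{r. x \<notin> above r}. r < l + e / 2"
        unfolding l_def by (rule cInf_less_iff[THEN iffD1]) (use n bdd \<open>e > 0\<close> in auto)
      then have "x \<notin> above (l + e / 2)" using above_antimono less_imp_le by blast
      then obtain d1 where d1: "d1 > 0" "\<And>p q. \<lbrakk>p < x; x < q; q - p < d1; {p..q} \<subseteq> {a..b}\<rbrakk> \<Longrightarrow> h q - h p \<le> (l + e / 2) * (q - p)"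
        using not_above by blast
      have "x \<in> above (l - e / 4)"
      proof (rule ccontr)
        assume "x \<notin> above (l - e / 4)"
        then have "l \<le> l - e / 4" unfolding l_def by (intro cInf_lower bdd) auto
        then show False using \<open>e > 0\<close> by simp
      qed
      then have "x \<notin> below (l - e / 2)" using gap[of "l - e / 2" "l - e / 4"] \<open>e > 0\<close> by auto
      then obtain d2 where d2: "d2 > 0" "\<And>p q. \<lbrakk>p < x; x < q; q - p < d2; {p..q} \<subseteq> {a..b}\<rbrakk> \<Longrightarrow> h q - h p \<ge> (l - e / 2) * (q - p)"
        using not_below by blast
      define d where "d = min (min d1 d2) (min (x - a) (b - x))"
      have d: "d > 0" "d \<le> d1" "d \<le> d2" "d \<le> x - a" "d \<le> b - x" using d1(1) d2(1) ab by (auto simp: d_def)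
      have two: "\<bar>(h q - h p) - l * (q - p)\<bar> \<le> e / 2 * (q - p)" if "p < x" "x < q" "q - p < d" for p q
      proof -
        have "{p..q} \<subseteq> {a..b}" using that d by auto
        then have "h q - h p \<le> (l + e / 2) * (q - p)" "h q - h p \<ge> (l - e / 2) * (q - p)"
          using d1(2)[of p q] d2(2)[of p q] that d by auto
        then have "(h q - h p) - l * (q - p) \<le> e / 2 * (q - p) \<and> - ((h q - h p) - l * (q - p)) \<le> e / 2 * (q - p)"
          unfolding distrib_right left_diff_distrib by linarith
        then show ?thesis by (intro abs_leI) auto
      qed
      \<comment> \<open>Continuity moves the bound from intervals around \<open>x\<close> to intervals ending at \<open>x\<close>.\<close>
      have isC: "isCont h z" if "a < z" "z < b" for z
        using continuous_on_interior[OF cont, of z] that by simp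
      have one: "\<bar>(h y - h x) - l * (y - x)\<bar> \<le> e / 2 * \<bar>y - x\<bar>" if y: "y \<noteq> x" "\<bar>y - x\<bar> < d" for y
      proof (cases "y > x")
        case True
        have "((\<lambda>p. e / 2 * (y - p) - \<bar>(h y - h p) - l * (y - p)\<bar>) \<longlongrightarrow> e / 2 * (y - x) - \<bar>(h y - h x) - l * (y - x)\<bar>) (at_left x)"
          using isC[OF ab] by (intro tendsto_intros) (auto simp: isCont_def intro: tendsto_mono[OF at_le])
        moreover have "\<forall>\<^sub>F p in at_left x. 0 \<le> e / 2 * (y - p) - \<bar>(h y - h p) - l * (y - p)\<bar>"
          unfolding eventually_at_left_field
          using True y by (intro exI[of _ "y - d"]) (auto intro!: two simp del: times_divide_eq_left)
        ultimately have "0 \<le> e / 2 * (y - x) - \<bar>(h y - h x) - l * (y - x)\<bar>"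
          by (intro tendsto_lowerbound) auto
        then show ?thesis using True by simp
      next
        case False
        have "((\<lambda>q. e / 2 * (q - y) - \<bar>(h q - h y) - l * (q - y)\<bar>) \<longlongrightarrow> e / 2 * (x - y) - \<bar>(h x - h y) - l * (x - y)\<bar>) (at_right x)"
          using isC[OF ab] by (intro tendsto_intros) (auto simp: isCont_def intro: tendsto_mono[OF at_le])
        moreover have "\<forall>\<^sub>F q in at_right x. 0 \<le> e / 2 * (q - y) - \<bar>(h q - h y) - l * (q - y)\<bar>"
          unfolding eventually_at_right_field
          using False y by (intro exI[of _ "y + d"]) (auto intro!: two simp del: times_divide_eq_left)
        ultimately have "0 \<le> e / 2 * (x - y) - \<bar>(h x - h y) - l * (x - y)\<bar>"
          by (intro tendsto_lowerbound) auto
        moreover have "\<bar>(h x - h y) - l * (x - y)\<bar> = \<bar>(h y - h x) - l * (y - x)\<bar>"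
          by (simp add: abs_if algebra_simps)
        ultimately show ?thesis using False by simp
      qed
      have "norm ((h y - h x) / (y - x) - l) < e" if "y \<noteq> x" "norm (y - x) < d" for y
      proof -
        have "norm ((h y - h x) / (y - x) - l) = \<bar>(h y - h x) - l * (y - x)\<bar> / \<bar>y - x\<bar>"
          using that(1) by (simp add: abs_divide[symmetric] diff_divide_distrib)
        also have "\<dots> \<le> e / 2" using one[OF that(1)] that by (simp add: pos_divide_le_eq)
        finally show ?thesis using \<open>e > 0\<close> by simp
      qed
      then show "\<exists>s>0. \<forall>y. y \<noteq> x \<and> dist y x < s \<longrightarrow> dist ((h y - h x) / (y - x)) l < e"
        using d(1) unfolding dist_norm by blast
    qed
    then show ?thesis using has_field_derivative_at_within by blast
  qed
  show ?thesis by (rule that[OF \<open>negligible N\<close> diff])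
qed

section \<open>Absolutely continuous paths as integrals of their derivatives\<close>

lemma absolutely_continuous_path_component:
  fixes g :: "real \<Rightarrow> 'a::euclidean_space"
  assumes "absolutely_continuous_path a b g" "i \<in> Basis"
  shows "absolutely_continuous_path a b (\<lambda>t. g t \<bullet> i)"
proof (rule absolutely_continuous_path_dominated[OF assms(1) zero_le_one order_refl])
  show "norm (g q \<bullet> i - g p \<bullet> i) \<le> 1 * norm (g q - g p) + 0 * (q - p)" for p q
    using Basis_le_norm[OF assms(2), of "g q - g p"] by (simp add: inner_diff_left)
qed

theorem absolutely_continuous_path_differentiable_ae:
  fixes g :: "real \<Rightarrow> 'a::euclidean_space"
  assumes ac: "absolutely_continuous_path a b g"
  obtains N where "negligible N"
    "\<And>t. t \<in> {a..b} - N \<Longrightarrow>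
      (g has_vector_derivative vector_derivative g (at t within {a..b})) (at t within {a..b})"
proof -
  have "\<exists>N. negligible N \<and> (\<forall>t\<in>{a..b} - N. \<exists>l. ((\<lambda>t. g t \<bullet> i) has_real_derivative l) (at t within {a..b}))"
    if i: "i \<in> Basis" for i
    using absolutely_continuous_real_differentiable_ae[OF absolutely_continuous_path_component[OF ac i]]
    by metis
  then obtain N where N: "\<And>i. i \<in> Basis \<Longrightarrow> negligible (N i)"
    "\<And>i t. i \<in> Basis \<Longrightarrow> t \<in> {a..b} - N i \<Longrightarrow> \<exists>l. ((\<lambda>t. g t \<bullet> i) has_real_derivative l) (at t within {a..b})"
    by metis
  show ?thesis
  proof (rule that[of "\<Union>i\<in>Basis. N i"])
    show "negligible (\<Union>i\<in>Basis. N i)" using N(1) by (intro negligible_Union) auto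
    fix t assume t: "t \<in> {a..b} - (\<Union>i\<in>Basis. N i)"
    have "(\<lambda>t. g t \<bullet> i) differentiable (at t within {a..b})" if "i \<in> Basis" for i
      using N(2)[OF that, of t] t that real_differentiable_def by blast
    then have "g differentiable (at t within {a..b})"
      using differentiable_componentwise_within by blast
    then show "(g has_vector_derivative vector_derivative g (at t within {a..b})) (at t within {a..b})"
      using vector_derivative_works by blast
  qed
qed

text \<open>The gauge is chosen from differentiability at the points outside \<open>N\<close>.  At the points of \<open>N\<close>, where the
integrand may be taken to be \<open>0\<close>, it confines the intervals to an open set of small measure around
\<open>N\<close>, so that their increments are small by absolute continuity.\<close>

lemma fundamental_theorem_of_calculus_absolutely_continuous:
  fixes g :: "real \<Rightarrow> 'a::euclidean_space"
  assumes ac: "absolutely_continuous_path a b g" and "a \<le> b" and N: "negligible N"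
    and der: "\<And>t. t \<in> {a..b} - N \<Longrightarrow> (g has_vector_derivative g' t) (at t within {a..b})"
  shows "(g' has_integral g b - g a) {a..b}"
proof (cases "a = b")
  case True
  then show ?thesis using has_integral_refl(1)[of g' b] by simp
next
  case False
  then have "a < b" using \<open>a \<le> b\<close> by simp
  define f where "f t = (if t \<in> N then 0 else g' t)" for t
  have "(f has_integral g b - g a) {a..b}"
    unfolding has_integral_factor_content_real
  proof (intro allI impI)
    fix e :: real assume "e > 0"
    have pos: "e * (b - a) / 2 > 0" using \<open>e > 0\<close> \<open>a < b\<close> by simp
    obtain \<delta> where "\<delta> > 0" and \<delta>: "\<And>D T. \<lbrakk>D division_of T; T \<subseteq> {a..b}; measure lebesgue T < \<delta>\<rbrakk> \<Longrightarrow>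
        (\<Sum>K\<in>D. norm (increment g K)) < e * (b - a) / 2"
      using absolutely_continuous_path_increments[OF ac pos] by blast
    have "N \<in> sets lebesgue" using N by (simp add: negligible_imp_sets)
    then obtain U where U: "open U" "N \<subseteq> U" "U - N \<in> lmeasurable" "emeasure lebesgue (U - N) < ennreal \<delta>"
      using sets_lebesgue_outer_open[OF _ \<open>\<delta> > 0\<close>] by metis
    have Um: "U \<in> lmeasurable" "measure lebesgue U < \<delta>"
    proof -
      have "U = (U - N) \<union> N" using U(2) by blast
      moreover have "N \<in> lmeasurable" "measure lebesgue N = 0" using N negligible_iff_measure by auto
      ultimately show "U \<in> lmeasurable" using U(3) fmeasurable.Un by metis
      then have "measure lebesgue U \<le> measure lebesgue (U - N) + measure lebesgue N"
        using measure_Un_le[of "U - N" lebesgue N] U(3) \<open>U = (U - N) \<union> N\<close> \<open>N \<in> lmeasurable\<close>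
        by (metis fmeasurableD)
      then show "measure lebesgue U < \<delta>"
        using U(3,4) \<open>\<delta> > 0\<close> \<open>measure lebesgue N = 0\<close> by (simp add: emeasure_eq_measure2 ennreal_less_iff)
    qed
    have "\<exists>d>0. (t \<in> N \<longrightarrow> ball t d \<subseteq> U) \<and>
        (t \<in> {a..b} - N \<longrightarrow> (\<forall>s\<in>{a..b}. norm (s - t) < d \<longrightarrow> norm (g s - g t - (s - t) *\<^sub>R f t) \<le> e / 2 * norm (s - t)))" for t
    proof (cases "t \<in> N")
      case True
      then obtain d where "d > 0" "ball t d \<subseteq> U" using U(1,2) open_contains_ball by blast
      then show ?thesis using True by blast
    next
      case False
      show ?thesis
      proof (cases "t \<in> {a..b}")
        case True
        have "e / 2 > 0" using \<open>e > 0\<close> by simp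
        moreover have "(g has_derivative (\<lambda>x. x *\<^sub>R f t)) (at t within {a..b})"
          using der[of t] True False by (simp add: f_def has_vector_derivative_def)
        ultimately show ?thesis using False unfolding has_derivative_within_alt by blast
      qed (use False zero_less_one in blast)
    qed
    then obtain d where d: "\<And>t. d t > 0" "\<And>t. t \<in> N \<Longrightarrow> ball t (d t) \<subseteq> U"
      "\<And>s t. \<lbrakk>t \<in> {a..b} - N; s \<in> {a..b}; norm (s - t) < d t\<rbrakk> \<Longrightarrow> norm (g s - g t - (s - t) *\<^sub>R f t) \<le> e / 2 * norm (s - t)"
      by metis
    show "\<exists>\<gamma>. gauge \<gamma> \<and> (\<forall>p. p tagged_division_of {a..b} \<and> \<gamma> fine p \<longrightarrow>
        norm ((\<Sum>(x, K)\<in>p. measure lborel K *\<^sub>R f x) - (g b - g a)) \<le> e * measure lborel {a..b})"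
    proof (intro exI conjI allI impI; (elim conjE)?)
      show "gauge (\<lambda>t. ball t (d t))" using d(1) gauge_ball_dependent by blast
      fix p assume p: "p tagged_division_of {a..b}" and fine: "(\<lambda>t. ball t (d t)) fine p"
      have finp: "finite p" using p by blast
      have box: "\<exists>u v. u \<le> v \<and> K = {u..v} \<and> x \<in> {u..v} \<and> {u..v} \<subseteq> {a..b} \<and> {u..v} \<subseteq> ball x (d x)" if xK: "(x, K) \<in> p" for x K
      proof -
        obtain u v where "K = cbox u v" using p xK by blast
        moreover have "x \<in> K" "K \<subseteq> {a..b}" using tagged_division_ofD(2,3)[OF p xK] by auto
        moreover have "K \<subseteq> ball x (d x)" using fineD[OF fine xK] .
        ultimately show ?thesis by (intro exI[of _ u] exI[of _ v]) simp
      qed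
      define p1 where "p1 = {xK\<in>p. fst xK \<in> N}"
      define p2 where "p2 = {xK\<in>p. fst xK \<notin> N}"
      have p12: "p = p1 \<union> p2" "p1 \<inter> p2 = {}" "finite p1" "finite p2" using finp by (auto simp: p1_def p2_def)
      let ?err = "\<lambda>(x, K). measure lborel K *\<^sub>R f x - increment g K"
      have "norm (\<Sum>xK\<in>p1. ?err xK) < e * (b - a) / 2"
      proof -
        have part: "p1 tagged_partial_division_of {a..b}"
          using p by (auto simp: p1_def tagged_division_of_def intro: tagged_partial_division_subset)
        note div = partial_division_of_tagged_division[OF part]
        have sub: "\<Union>(snd ` p1) \<subseteq> {a..b} \<inter> U"
        proof
          fix y assume "y \<in> \<Union>(snd ` p1)"
          then obtain x K where xK: "(x, K) \<in> p" "x \<in> N" "y \<in> K" by (auto simp: p1_def)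
          then show "y \<in> {a..b} \<inter> U" using box[OF xK(1)] d(2)[OF xK(2)] by blast
        qed
        have Dm: "\<Union>(snd ` p1) \<in> lmeasurable"
          using div by (intro fmeasurable.finite_Union) (auto dest: division_ofD(4) simp: division_of_finite)
        have "measure lebesgue (\<Union>(snd ` p1)) \<le> measure lebesgue U"
          using sub Um(1) Dm by (intro measure_mono_fmeasurable) auto
        then have "measure lebesgue (\<Union>(snd ` p1)) < \<delta>" using Um(2) by simp
        then have small: "(\<Sum>K\<in>snd ` p1. norm (increment g K)) < e * (b - a) / 2"
          using \<delta>[OF div] sub by blast
        have err: "?err xK = - increment g (snd xK)" if "xK \<in> p1" for xK
          using that by (auto simp: p1_def f_def split_beta)
        have ne: "snd xK \<noteq> {}" if "xK \<in> p1" for xK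
          using box[of "fst xK" "snd xK"] that by (auto simp: p1_def)
        have "(\<Sum>xK\<in>p1. norm (increment g (snd xK))) = (\<Sum>(x, K)\<in>p1. norm (increment g K))"
          by (simp add: split_beta)
        \<comment> \<open>\<open>Sup\<close> and \<open>Inf\<close> of the empty interval are unspecified, so it has to be excluded.\<close>
        also have "\<dots> = (\<Sum>(x, K)\<in>p1. if K = {} then 0 else norm (increment g K))"
          using ne by (intro sum.cong refl) (auto simp: split_beta)
        also have "\<dots> = (\<Sum>K\<in>snd ` p1. if K = {} then 0 else norm (increment g K))"
        proof (rule sum.over_tagged_division_lemma[OF tagged_partial_division_of_Union_self[OF part]])
          fix u v :: real assume "box u v = {}"
          then show "(if cbox u v = {} then 0 else norm (increment g (cbox u v))) = 0"
            by (cases "u = v") (auto simp: increment_def)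
        qed
        also have "\<dots> = (\<Sum>K\<in>snd ` p1. norm (increment g K))"
          using ne by (intro sum.cong refl) auto
        finally have "(\<Sum>xK\<in>p1. norm (?err xK)) < e * (b - a) / 2"
          using small err by (simp cong: sum.cong)
        then show ?thesis using norm_sum[of ?err p1] by linarith
      qed
      moreover have "norm (\<Sum>xK\<in>p2. ?err xK) \<le> e / 2 * (b - a)"
      proof -
        have "norm (?err xK) \<le> e / 2 * increment (\<lambda>t. t) (snd xK)" if "xK \<in> p2" for xK
        proof -
          obtain x K where "xK = (x, K)" using prod.exhaust by blast
          then have xK: "xK = (x, K)" "(x, K) \<in> p" "x \<notin> N" using that by (auto simp: p2_def)
          obtain u v where uv: "u \<le> v" "K = {u..v}" "x \<in> {u..v}" "{u..v} \<subseteq> {a..b}" "{u..v} \<subseteq> ball x (d x)"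
            using box[OF xK(2)] by blast
          have x: "x \<in> {a..b} - N" using uv xK(3) by blast
          have "u \<in> {u..v}" "v \<in> {u..v}" using uv(1) by auto
          then have "u \<in> ball x (d x)" "v \<in> ball x (d x)" "u \<in> {a..b}" "v \<in> {a..b}" using uv(4,5) by (auto simp only: subset_iff)
          then have "norm (g u - g x - (u - x) *\<^sub>R f x) \<le> e / 2 * norm (u - x)"
                    "norm (g v - g x - (v - x) *\<^sub>R f x) \<le> e / 2 * norm (v - x)"
            using d(3)[OF x, of u] d(3)[OF x, of v] by (auto simp: dist_norm norm_minus_commute)
          moreover have eq: "(v - u) *\<^sub>R f x - (g v - g u) = (g u - g x - (u - x) *\<^sub>R f x) - (g v - g x - (v - x) *\<^sub>R f x)"
            by (simp add: algebra_simps)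
          moreover have "e / 2 * norm (u - x) + e / 2 * norm (v - x) = e / 2 * (v - u)"
            using uv(3) by (simp add: field_simps)
          ultimately have "norm ((v - u) *\<^sub>R f x - (g v - g u)) \<le> e / 2 * (v - u)"
            unfolding eq using norm_triangle_ineq4[of "g u - g x - (u - x) *\<^sub>R f x" "g v - g x - (v - x) *\<^sub>R f x"] by linarith
          then show ?thesis using uv(1,2) xK(1) by simp
        qed
        then have "norm (\<Sum>xK\<in>p2. ?err xK) \<le> (\<Sum>xK\<in>p2. e / 2 * increment (\<lambda>t. t) (snd xK))"
          by (rule sum_norm_le)
        also have "\<dots> \<le> (\<Sum>xK\<in>p. e / 2 * increment (\<lambda>t. t) (snd xK))"
        proof (rule sum_mono2[OF finp])
          fix xK assume "xK \<in> p - p2"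
          then show "0 \<le> e / 2 * increment (\<lambda>t. t) (snd xK)"
            using box[of "fst xK" "snd xK"] \<open>e > 0\<close> by auto
        qed (auto simp: p2_def)
        also have "\<dots> = e / 2 * (\<Sum>xK\<in>p. increment (\<lambda>t. t) (snd xK))" by (simp only: sum_distrib_left)
        also have "(\<Sum>xK\<in>p. increment (\<lambda>t. t) (snd xK)) = b - a"
          using additive_tagged_division_1[OF \<open>a \<le> b\<close> p, of "\<lambda>t. t"] by (simp add: increment_def split_beta)
        finally show ?thesis .
      qed
      moreover have err: "(\<Sum>(x, K)\<in>p. measure lborel K *\<^sub>R f x) - (g b - g a) = (\<Sum>xK\<in>p. ?err xK)"
        using additive_tagged_division_1[OF \<open>a \<le> b\<close> p, of g]
        by (simp add: increment_def split_beta sum_subtractf)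
      moreover have err12: "(\<Sum>xK\<in>p. ?err xK) = (\<Sum>xK\<in>p1. ?err xK) + (\<Sum>xK\<in>p2. ?err xK)"
        using p12 by (metis (no_types, lifting) sum.union_disjoint)
      moreover have "norm ((\<Sum>xK\<in>p1. ?err xK) + (\<Sum>xK\<in>p2. ?err xK)) \<le> norm (\<Sum>xK\<in>p1. ?err xK) + norm (\<Sum>xK\<in>p2. ?err xK)"
        by (rule norm_triangle_ineq)
      ultimately have "norm ((\<Sum>(x, K)\<in>p. measure lborel K *\<^sub>R f x) - (g b - g a)) \<le> e * (b - a) / 2 + e / 2 * (b - a)"
        unfolding err err12 by linarith
      then show "norm ((\<Sum>(x, K)\<in>p. measure lborel K *\<^sub>R f x) - (g b - g a)) \<le> e * measure lborel {a..b}"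
        using \<open>a \<le> b\<close> by simp
    qed
  qed
  then show ?thesis
    by (rule has_integral_spike[OF N, rotated]) (simp add: f_def)
qed

lemma absolutely_continuous_path_subinterval:
  assumes "absolutely_continuous_path a b g" "a \<le> c" "d \<le> b"
  shows "absolutely_continuous_path c d g"
proof -
  have "{c..d} \<subseteq> {a..b}" using assms(2,3) by auto
  then show ?thesis using assms(1) unfolding absolutely_continuous_path_def by (meson subset_trans)
qed

text \<open>On an interval shorter than the \<open>\<delta>\<close> that absolute continuity provides for \<open>\<epsilon> = 1\<close>, the integrals of
\<open>g'\<close> over the members of a division are increments of \<open>g\<close>, with sum of norms below \<open>1\<close>; bounded
variation of the indefinite integral is absolute integrability.  Finitely many such intervals cover
\<open>{a..b}\<close>.\<close>

lemma absolutely_continuous_path_derivative_absolutely_integrable: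
  fixes g :: "real \<Rightarrow> 'a::euclidean_space"
  assumes ac: "absolutely_continuous_path a b g" and "a \<le> b" and N: "negligible N"
    and der: "\<And>t. t \<in> {a..b} - N \<Longrightarrow> (g has_vector_derivative g' t) (at t within {a..b})"
  shows "g' absolutely_integrable_on {a..b}"
proof -
  obtain \<delta> where "\<delta> > 0" and \<delta>: "\<And>D T. \<lbrakk>D division_of T; T \<subseteq> {a..b}; measure lebesgue T < \<delta>\<rbrakk> \<Longrightarrow>
      (\<Sum>K\<in>D. norm (increment g K)) < 1"
    using absolutely_continuous_path_increments[OF ac zero_less_one] by blast
  have ftc: "(g' has_integral g d - g c) {c..d}" if "a \<le> c" "c \<le> d" "d \<le> b" for c d
  proof (rule fundamental_theorem_of_calculus_absolutely_continuous[OF _ \<open>c \<le> d\<close> N])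
    show "absolutely_continuous_path c d g"
      using absolutely_continuous_path_subinterval[OF ac] that by blast
    fix t assume t: "t \<in> {c..d} - N"
    then have "t \<in> {a..b} - N" "{c..d} \<subseteq> {a..b}" using that by auto
    then show "(g has_vector_derivative g' t) (at t within {c..d})"
      using der has_vector_derivative_within_subset by blast
  qed
  have short: "g' absolutely_integrable_on {c..d}" if cd: "a \<le> c" "c \<le> d" "d \<le> b" "d - c < \<delta>" for c d
    unfolding box_real(2)[symmetric]
  proof (rule bounded_variation_absolutely_integrable_interval[where B = 1])
    show "g' integrable_on cbox c d" using ftc[OF cd(1-3)] by auto
    fix D assume D: "D division_of cbox c d"
    have "(\<Sum>K\<in>D. norm (integral K g')) = (\<Sum>K\<in>D. norm (increment g K))"
    proof (rule sum.cong[OF refl])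
      fix K assume "K \<in> D"
      then obtain p q where pq: "p \<le> q" "K = {p..q}" "{p..q} \<subseteq> {c..d}"
        using division_real_cases[OF D] by (metis box_real(2))
      then have "(g' has_integral g q - g p) {p..q}" using cd by (intro ftc) auto
      then show "norm (integral K g') = norm (increment g K)" using pq by (simp add: integral_unique)
    qed
    also have "\<dots> < 1" using cd by (intro \<delta>[OF D]) auto
    finally show "(\<Sum>K\<in>D. norm (integral K g')) \<le> 1" by simp
  qed
  have "g' absolutely_integrable_on {a..min b (a + real n * (\<delta> / 2))}" for n
  proof (induction n)
    case 0
    then show ?case using short[of a a] \<open>a \<le> b\<close> \<open>\<delta> > 0\<close> by (simp add: min_def)
  next
    case (Suc n)
    let ?c = "min b (a + real n * (\<delta> / 2))" and ?d = "min b (a + real (Suc n) * (\<delta> / 2))"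
    have step: "real (Suc n) * (\<delta> / 2) = real n * (\<delta> / 2) + \<delta> / 2" by (simp add: field_simps)
    have ac: "a \<le> ?c" "?c \<le> ?d" using \<open>a \<le> b\<close> \<open>\<delta> > 0\<close> unfolding step by auto
    have "?d - ?c < \<delta>" using \<open>\<delta> > 0\<close> unfolding step by auto
    then have *: "g' absolutely_integrable_on {?c..?d}" using ac by (intro short) auto
    have "{a..?d} = {a..?c} \<union> {?c..?d}" using ac by (simp only: ivl_disj_un_two_touch(4))
    then show ?case using absolutely_integrable_Un[OF Suc.IH *] by (simp only:)
  qed
  moreover obtain n where "(b - a) / (\<delta> / 2) < real n" using reals_Archimedean2 by blast
  then have "min b (a + real n * (\<delta> / 2)) = b" using \<open>\<delta> > 0\<close> by (simp add: field_simps)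
  ultimately show ?thesis by metis
qed

section \<open>Comparison of the Carnot--Caratheodory distance with a gauge\<close>

text \<open>The third coordinate of \<open>p\<^sup>-\<^sup>1q\<close>, and so the amount by which \<open>q\<close> lies above the horizontal plane
through \<open>p\<close>.\<close>

definition heis_height :: "real^3 \<Rightarrow> real^3 \<Rightarrow> real" where
  "heis_height p q = q$3 - p$3 - (p$1 * q$2 - p$2 * q$1) / 2"

text \<open>A homogeneous gauge of \<open>p\<^sup>-\<^sup>1q\<close>: dilations scale the horizontal coordinates by \<open>r\<close> and the vertical
one by \<open>r\<^sup>2\<close>.\<close>

definition heis_gauge :: "real^3 \<Rightarrow> real^3 \<Rightarrow> real" where
  "heis_gauge p q = \<bar>q$1 - p$1\<bar> + \<bar>q$2 - p$2\<bar> + sqrt \<bar>heis_height p q\<bar>"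

lemma horizontal_space_iff:
  "v \<in> horizontal_space p \<longleftrightarrow> v$3 = (p$1 * v$2 - p$2 * v$1) / 2"
proof
  assume "v \<in> horizontal_space p"
  then obtain a b where "v = a *\<^sub>R X_field p + b *\<^sub>R Y_field p"
    unfolding horizontal_space_def span_insert span_empty by (auto simp: algebra_simps eq_diff_eq)
  then show "v$3 = (p$1 * v$2 - p$2 * v$1) / 2"
    by (simp add: X_field_def Y_field_def field_simps)
next
  assume "v$3 = (p$1 * v$2 - p$2 * v$1) / 2"
  then have "v = v$1 *\<^sub>R X_field p + v$2 *\<^sub>R Y_field p"
    by (simp add: vec_eq_iff forall_3 X_field_def Y_field_def field_simps)
  also have "\<dots> \<in> horizontal_space p"
    unfolding horizontal_space_def by (intro span_add span_scale span_base) auto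
  finally show "v \<in> horizontal_space p" .
qed

lemma heis_inner_horizontal:
  assumes "v \<in> horizontal_space p"
  shows "heis_inner p v v = (v$1)\<^sup>2 + (v$2)\<^sup>2"
  using assms by (simp add: horizontal_space_iff heis_inner_def power2_eq_square field_simps)

lemma integral_nonneg_always:
  fixes f :: "'a::euclidean_space \<Rightarrow> real"
  assumes "\<And>x. x \<in> S \<Longrightarrow> 0 \<le> f x"
  shows "0 \<le> integral S f"
  using assms integral_nonneg[of f S] not_integrable_integral[of f S] by (cases "f integrable_on S") auto

lemma heis_inner_nonneg: "0 \<le> heis_inner p v v"
  by (simp add: heis_inner_def)

lemma heis_length_nonneg: "0 \<le> heis_length g"
  unfolding heis_length_def by (intro integral_nonneg_always) (simp add: Let_def heis_inner_nonneg)

lemma d_cc_le_heis_length: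
  assumes "horizontal_path g" "g 0 = p" "g 1 = q"
  shows "d_cc p q \<le> heis_length g"
  unfolding d_cc_def
proof (rule cInf_lower)
  show "bdd_below {heis_length g |g. horizontal_path g \<and> g 0 = p \<and> g 1 = q}"
    by (rule bdd_belowI[of _ 0]) (auto simp: heis_length_nonneg)
qed (use assms in blast)

lemma smooth_horizontal_path:
  fixes g g' :: "real \<Rightarrow> real^3"
  assumes der: "\<And>t. (g has_vector_derivative g' t) (at t)" and cont: "continuous_on {0..1} g'"
    and hor: "\<And>t. g' t \<in> horizontal_space (g t)"
    and bound: "\<And>t. t \<in> {0..1} \<Longrightarrow> \<bar>g' t $ 1\<bar> + \<bar>g' t $ 2\<bar> \<le> C"
  shows "horizontal_path g" "heis_length g \<le> C"
proof -
  have der01: "(g has_vector_derivative g' t) (at t within {0..1})" for t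
    using der has_vector_derivative_at_within by blast
  have vd: "v = g' t" if "(g has_vector_derivative v) (at t within {0..1})" "t \<in> {0..1}" for t v
    using vector_derivative_unique_within_closed_interval[of 0 1 t g v "g' t"] that der01[of t] by simp
  have "bounded (g' ` {0..1})"
    using cont by (intro compact_imp_bounded compact_continuous_image) auto
  then obtain B where B: "\<And>t. t \<in> {0..1} \<Longrightarrow> norm (g' t) \<le> B" "B > 0"
    unfolding bounded_pos by blast
  have "B-lipschitz_on {0..1} g"
  proof (rule bounded_derivative_imp_lipschitz)
    show "(g has_derivative (\<lambda>h. h *\<^sub>R g' t)) (at t within {0..1})" for t
      using der01 by (simp add: has_vector_derivative_def)
    show "onorm (\<lambda>h. h *\<^sub>R g' t) \<le> B" if "t \<in> {0..1}" for t
    proof (rule onorm_le)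
      show "norm (h *\<^sub>R g' t) \<le> B * norm h" for h
        using mult_right_mono[OF B(1)[OF that], of "norm h"] by (simp add: mult.commute)
    qed
  qed (use B(2) in auto)
  then have "absolutely_continuous_path 0 1 g"
    by (rule Lipschitz_imp_absolutely_continuous_path)
  then show "horizontal_path g"
    unfolding horizontal_path_def using vd hor by blast
  have speed: "sqrt (heis_inner (g t) (vector_derivative g (at t within {0..1})) (vector_derivative g (at t within {0..1}))) \<le> C"
    if t: "t \<in> {0..1}" for t
  proof -
    have "vector_derivative g (at t within {0..1}) = g' t"
      using vector_derivative_within_cbox[of 0 1 t g "g' t"] t der01[of t] by simp
    then have "sqrt (heis_inner (g t) (vector_derivative g (at t within {0..1})) (vector_derivative g (at t within {0..1})))
        = sqrt ((g' t $ 1)\<^sup>2 + (g' t $ 2)\<^sup>2)"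
      using heis_inner_horizontal[OF hor] by simp
    also have "\<dots> \<le> \<bar>g' t $ 1\<bar> + \<bar>g' t $ 2\<bar>" by (rule sqrt_sum_squares_le_sum_abs)
    finally show ?thesis using bound[OF t] by linarith
  qed
  let ?s = "\<lambda>t. let v = vector_derivative g (at t within {0..1}) in sqrt (heis_inner (g t) v v)"
  \<comment> \<open>A function that is not integrable has integral \<open>0\<close> by convention, so the bound holds either way.\<close>
  show "heis_length g \<le> C"
  proof (cases "?s integrable_on {0..1}")
    case True
    then have "integral {0..1} ?s \<le> integral {0..1} (\<lambda>_::real. C)"
      using speed by (intro integral_le) (auto simp: Let_def)
    then show ?thesis by (simp add: heis_length_def)
  next
    case False
    moreover have "0 \<le> C" using bound[of 0] by auto
    ultimately show ?thesis by (simp add: heis_length_def not_integrable_integral)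
  qed
qed

text \<open>A horizontal path is determined by its projection \<open>(A, B)\<close> to the \<open>x, y\<close> plane, and its height is the
area \<open>\<integral> (A B' - B A') / 2\<close> swept by the projection.  Take the straight segment to \<open>(u, v)\<close> plus a closed
loop \<open>(l \<alpha>, m \<beta>)\<close>.  The polynomials \<open>\<alpha>\<close> and \<open>\<beta>\<close> vanish at both ends and have mean \<open>0\<close> on \<open>[0, 1]\<close>, so
the mixed terms between segment and loop sweep no area; the loop sweeps \<open>- l m / 70\<close>.  Choosing
\<open>l\<close> and \<open>m\<close> of size \<open>sqrt (70 \<bar>\<tau>\<bar>)\<close> produces the height \<open>\<tau>\<close> at a cost of order \<open>sqrt \<bar>\<tau>\<bar>\<close>.\<close>

lemma horizontal_connection:
  fixes p q :: "real^3"
  obtains g where "horizontal_path g" "g 0 = p" "g 1 = q" "heis_length g \<le> 700 * heis_gauge p q"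
proof -
  define u v \<tau> where "u = q$1 - p$1" and "v = q$2 - p$2" and "\<tau> = heis_height p q"
  define k where "k = sqrt (70 * \<bar>\<tau>\<bar>)"
  define l m where "l = k" and "m = - sgn \<tau> * k"
  define \<alpha> \<alpha>' where "\<alpha> t = t - 3 * t^2 + 2 * t^3" and "\<alpha>' t = 1 - 6 * t + 6 * t^2" for t :: real
  define \<beta> \<beta>' where "\<beta> t = t - 6 * t^2 + 10 * t^3 - 5 * t^4" and "\<beta>' t = 1 - 12 * t + 30 * t^2 - 20 * t^3" for t :: real
  \<comment> \<open>Antiderivatives of \<open>t \<beta>' - \<beta>\<close>, \<open>\<alpha> - t \<alpha>'\<close> and \<open>\<alpha> \<beta>' - \<beta> \<alpha>'\<close>, the three kinds of terms in \<open>A B' - B A'\<close>.\<close>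
  define P1 P2 P3 where "P1 t = - 2 * t^3 + 5 * t^4 - 3 * t^5" and "P2 t = t^3 - t^4"
    and "P3 t = - (t^3) + 4 * t^4 - 33 / 5 * t^5 + 5 * t^6 - 10 / 7 * t^7" for t :: real
  define A A' where "A t = u * t + l * \<alpha> t" and "A' t = u + l * \<alpha>' t" for t
  define B B' where "B t = v * t + m * \<beta> t" and "B' t = v + m * \<beta>' t" for t
  define Z where "Z t = (u * m * P1 t + l * v * P2 t + l * m * P3 t) / 2" for t
  define g where "g t = (vector [p$1 + A t, p$2 + B t, p$3 + Z t + (p$1 * B t - p$2 * A t) / 2] :: real^3)" for t
  define g' where "g' t = (vector [A' t, B' t, (A t * B' t - B t * A' t) / 2 + (p$1 * B' t - p$2 * A' t) / 2] :: real^3)" for t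
  have dA: "(A has_real_derivative A' t) (at t)" for t
    unfolding A_def A'_def \<alpha>_def \<alpha>'_def by (auto intro!: derivative_eq_intros simp: algebra_simps)
  have dB: "(B has_real_derivative B' t) (at t)" for t
    unfolding B_def B'_def \<beta>_def \<beta>'_def by (auto intro!: derivative_eq_intros simp: algebra_simps)
  have d1: "(P1 has_real_derivative t * \<beta>' t - \<beta> t) (at t)" for t
    unfolding P1_def \<beta>_def \<beta>'_def
    by (auto intro!: derivative_eq_intros simp: eval_nat_numeral algebra_simps)
  have d2: "(P2 has_real_derivative \<alpha> t - t * \<alpha>' t) (at t)" for t
    unfolding P2_def \<alpha>_def \<alpha>'_def
    by (auto intro!: derivative_eq_intros simp: eval_nat_numeral algebra_simps)
  have d3: "(P3 has_real_derivative \<alpha> t * \<beta>' t - \<beta> t * \<alpha>' t) (at t)" for t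
    unfolding P3_def \<alpha>_def \<alpha>'_def \<beta>_def \<beta>'_def
    by (auto intro!: derivative_eq_intros simp: eval_nat_numeral algebra_simps)
  have dZ: "(Z has_real_derivative (A t * B' t - B t * A' t) / 2) (at t)" for t
  proof -
    have "(Z has_real_derivative (u * m * (t * \<beta>' t - \<beta> t) + l * v * (\<alpha> t - t * \<alpha>' t)
        + l * m * (\<alpha> t * \<beta>' t - \<beta> t * \<alpha>' t)) / 2) (at t)"
      unfolding Z_def by (intro DERIV_cdivide DERIV_add DERIV_cmult d1 d2 d3)
    moreover have "(u * m * (t * \<beta>' t - \<beta> t) + l * v * (\<alpha> t - t * \<alpha>' t)
        + l * m * (\<alpha> t * \<beta>' t - \<beta> t * \<alpha>' t)) / 2 = (A t * B' t - B t * A' t) / 2"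
      unfolding A_def A'_def B_def B'_def by (simp add: algebra_simps)
    ultimately show ?thesis by simp
  qed
  have der: "(g has_vector_derivative g' t) (at t)" for t
    unfolding g_def g'_def
    by (intro has_vector_derivative_vector_3) (auto intro!: derivative_eq_intros dA dB dZ)
  have hor: "g' t \<in> horizontal_space (g t)" for t
    by (simp add: horizontal_space_iff g_def g'_def field_simps)
  have cont: "continuous_on {0..1} g'"
  proof -
    have "g' = (\<lambda>t. A' t *\<^sub>R axis 1 1 + B' t *\<^sub>R axis 2 1 +
        ((A t * B' t - B t * A' t) / 2 + (p$1 * B' t - p$2 * A' t) / 2) *\<^sub>R axis 3 1)"
      by (simp add: fun_eq_iff g'_def vec_eq_iff forall_3 axis_def)
    then show ?thesis
      unfolding A_def A'_def B_def B'_def \<alpha>_def \<alpha>'_def \<beta>_def \<beta>'_def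
      by (simp only:) (auto intro!: continuous_intros)
  qed
  have bound: "\<bar>g' t $ 1\<bar> + \<bar>g' t $ 2\<bar> \<le> \<bar>u\<bar> + \<bar>v\<bar> + 76 * k" if t: "t \<in> {0..1}" for t
  proof -
    have pw: "0 \<le> t^n \<and> t^n \<le> 1" for n using t by (auto intro: power_le_one)
    have pws: "0 \<le> t \<and> t \<le> 1" "0 \<le> t^2 \<and> t^2 \<le> 1" "0 \<le> t^3 \<and> t^3 \<le> 1" using t pw by auto
    have "\<bar>\<alpha>' t\<bar> \<le> 13" unfolding \<alpha>'_def by (rule abs_leI) (use pws in linarith)+
    moreover have "\<bar>\<beta>' t\<bar> \<le> 63" unfolding \<beta>'_def by (rule abs_leI) (use pws in linarith)+
    moreover have k: "k \<ge> 0" "\<bar>l\<bar> \<le> k" "\<bar>m\<bar> \<le> k" by (auto simp: k_def l_def m_def abs_mult sgn_if)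
    ultimately have "\<bar>l * \<alpha>' t\<bar> \<le> k * 13" "\<bar>m * \<beta>' t\<bar> \<le> k * 63"
      unfolding abs_mult by (auto intro!: mult_mono)
    moreover have "\<bar>g' t $ 1\<bar> \<le> \<bar>u\<bar> + \<bar>l * \<alpha>' t\<bar>" "\<bar>g' t $ 2\<bar> \<le> \<bar>v\<bar> + \<bar>m * \<beta>' t\<bar>"
      by (auto simp: g'_def A'_def B'_def)
    ultimately show ?thesis by linarith
  qed
  note path = smooth_horizontal_path[OF der cont hor bound]
  have ends: "A 0 = 0" "B 0 = 0" "Z 0 = 0" "A 1 = u" "B 1 = v"
    by (auto simp: A_def B_def Z_def \<alpha>_def \<beta>_def P1_def P2_def P3_def)
  have "l * m = - 70 * \<tau>"
    unfolding l_def m_def k_def by (simp add: sgn_if)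
  then have "Z 1 = \<tau>" by (simp add: Z_def P1_def P2_def P3_def)
  then have "g 1 = q"
    by (simp add: g_def ends vec_eq_iff forall_3 u_def v_def \<tau>_def heis_height_def field_simps)
  moreover have "g 0 = p" using ends by (simp add: g_def vec_eq_iff forall_3)
  moreover have "\<bar>u\<bar> + \<bar>v\<bar> + 76 * k \<le> 700 * heis_gauge p q"
  proof -
    have "sqrt 70 \<le> 9" by (rule real_le_lsqrt) auto
    then have "sqrt 70 * sqrt \<bar>\<tau>\<bar> \<le> 9 * sqrt \<bar>\<tau>\<bar>" by (intro mult_right_mono) auto
    then have "k \<le> 9 * sqrt \<bar>\<tau>\<bar>" by (simp add: k_def real_sqrt_mult)
    moreover have "0 \<le> sqrt \<bar>\<tau>\<bar>" by simp
    ultimately have "76 * k \<le> 700 * sqrt \<bar>\<tau>\<bar>" by linarith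
    then have "\<bar>u\<bar> + \<bar>v\<bar> + 76 * k \<le> 700 * \<bar>u\<bar> + 700 * \<bar>v\<bar> + 700 * sqrt \<bar>\<tau>\<bar>" by (intro add_mono) auto
    then show ?thesis
      unfolding heis_gauge_def u_def[symmetric] v_def[symmetric] \<tau>_def[symmetric] by (simp only: distrib_left)
  qed
  ultimately show ?thesis using that path by fastforce
qed

lemma d_cc_le_heis_gauge: "d_cc p q \<le> 700 * heis_gauge p q"
  using horizontal_connection d_cc_le_heis_length by (metis order_trans)

text \<open>The horizontal coordinates of the path move at most as fast as its speed.  The height above the
starting point \<open>p\<close> has derivative \<open>((x - p$1) y' - (y - p$2) x') / 2\<close> at almost every time, because
the derivative is horizontal there; this is at most the length times the speed.\<close>

lemma horizontal_path_displacement: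
  assumes g: "horizontal_path g"
  shows "\<bar>g 1 $ 1 - g 0 $ 1\<bar> \<le> heis_length g" "\<bar>g 1 $ 2 - g 0 $ 2\<bar> \<le> heis_length g"
    "\<bar>heis_height (g 0) (g 1)\<bar> \<le> (heis_length g)\<^sup>2"
proof -
  define v where "v t = vector_derivative g (at t within {0..1})" for t
  define p where "p = g 0"
  have ac: "absolutely_continuous_path 0 1 g" using g by (simp add: horizontal_path_def)
  obtain N where N: "negligible N" "\<And>t. t \<in> {0..1} - N \<Longrightarrow> (g has_vector_derivative v t) (at t within {0..1})"
    using absolutely_continuous_path_differentiable_ae[OF ac] unfolding v_def by blast
  have hor: "v t \<in> horizontal_space (g t)" if "t \<in> {0..1} - N" for t
    using g N(2)[OF that] that unfolding horizontal_path_def by blast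
  have vint: "v absolutely_integrable_on {0..1}"
    by (rule absolutely_continuous_path_derivative_absolutely_integrable[OF ac zero_le_one N])
  \<comment> \<open>The speed, written as the norm of a linear image of \<open>v\<close>, which makes it integrable.\<close>
  define \<sigma> where "\<sigma> t = norm (v t $ 1, v t $ 2)" for t
  have "bounded_linear (\<lambda>w::real^3. (w $ 1, w $ 2))"
    by (intro bounded_linear_Pair bounded_linear_vec_nth)
  then have "((\<lambda>w::real^3. (w $ 1, w $ 2)) \<circ> v) absolutely_integrable_on {0..1}"
    by (rule absolutely_integrable_linear[OF vint])
  then have sint: "\<sigma> integrable_on {0..1}"
    unfolding \<sigma>_def o_def absolutely_integrable_on_def by blast
  have len: "heis_length g = integral {0..1} \<sigma>"
    unfolding heis_length_def
  proof (rule integral_spike[OF N(1)])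
    fix t assume "t \<in> {0..1} - N"
    then show "\<sigma> t = (let v = vector_derivative g (at t within {0..1}) in sqrt (heis_inner (g t) v v))"
      using heis_inner_horizontal[OF hor] by (simp add: \<sigma>_def v_def norm_Pair Let_def)
  qed
  have comp: "\<bar>v t $ 1\<bar> \<le> \<sigma> t" "\<bar>v t $ 2\<bar> \<le> \<sigma> t" "0 \<le> \<sigma> t" for t
    by (auto simp: \<sigma>_def norm_Pair real_norm_def intro!: real_le_rsqrt)
  have ftc: "(v has_integral g t - p) {0..t}" if "t \<in> {0..1}" for t
  proof -
    have ac': "absolutely_continuous_path 0 t g"
      using absolutely_continuous_path_subinterval[OF ac] that by simp
    have der': "(g has_vector_derivative v s) (at s within {0..t})" if "s \<in> {0..t} - N" for s
      using N(2)[of s] that \<open>t \<in> {0..1}\<close> has_vector_derivative_within_subset[of g "v s" s "{0..1}" "{0..t}"] by auto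
    show ?thesis
      unfolding p_def
      by (rule fundamental_theorem_of_calculus_absolutely_continuous[OF ac' _ N(1) der']) (use that in auto)
  qed
  have smono: "integral {0..t} \<sigma> \<le> heis_length g" "\<sigma> integrable_on {0..t}" if "t \<in> {0..1}" for t
  proof -
    show "\<sigma> integrable_on {0..t}" using sint by (rule integrable_on_subinterval) (use that in auto)
    then show "integral {0..t} \<sigma> \<le> heis_length g"
      unfolding len using sint comp(3) that by (intro integral_subset_le) auto
  qed
  have disp: "\<bar>g t $ i - p $ i\<bar> \<le> heis_length g" if t: "t \<in> {0..1}" and i: "i = 1 \<or> i = 2" for t i
  proof -
    have int: "((\<lambda>s. v s $ i) has_integral (g t - p) $ i) {0..t}"
      using has_integral_linear[OF ftc[OF t] bounded_linear_vec_nth[of i]] by (simp add: o_def)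
    have "norm (integral {0..t} (\<lambda>s. v s $ i)) \<le> integral {0..t} \<sigma>"
      using int smono(2)[OF t] comp i by (intro integral_norm_bound_integral) auto
    then show ?thesis using integral_unique[OF int] smono(1)[OF t] by simp
  qed
  show "\<bar>g 1 $ 1 - g 0 $ 1\<bar> \<le> heis_length g" "\<bar>g 1 $ 2 - g 0 $ 2\<bar> \<le> heis_length g"
    using disp[of 1] by (auto simp: p_def)
  define \<Lambda> where "\<Lambda> w = w $ 3 - (p $ 1 * w $ 2 - p $ 2 * w $ 1) / 2" for w :: "real^3"
  have "bounded_linear \<Lambda>"
    unfolding \<Lambda>_def linear_conv_bounded_linear[symmetric]
    by (auto intro!: linearI simp: field_simps)
  then have int: "((\<lambda>t. \<Lambda> (v t)) has_integral \<Lambda> (g 1 - p)) {0..1}"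
    using has_integral_linear[OF ftc[of 1], of \<Lambda>] by (simp add: o_def)
  have "\<bar>\<Lambda> (v t)\<bar> \<le> heis_length g * \<sigma> t" if t: "t \<in> {0..1} - N" for t
  proof -
    have "2 * \<Lambda> (v t) = ((g t $ 1 - p $ 1) * v t $ 2 - (g t $ 2 - p $ 2) * v t $ 1)"
      using hor[OF t] by (simp add: \<Lambda>_def horizontal_space_iff field_simps)
    moreover have "\<bar>(g t $ 1 - p $ 1) * v t $ 2\<bar> \<le> heis_length g * \<sigma> t" "\<bar>(g t $ 2 - p $ 2) * v t $ 1\<bar> \<le> heis_length g * \<sigma> t"
      unfolding abs_mult using disp[of t] t comp heis_length_nonneg by (auto intro!: mult_mono)
    moreover have "\<bar>2 * \<Lambda> (v t)\<bar> = 2 * \<bar>\<Lambda> (v t)\<bar>" by simp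
    ultimately show ?thesis
      using abs_triangle_ineq4[of "(g t $ 1 - p $ 1) * v t $ 2" "(g t $ 2 - p $ 2) * v t $ 1"] by linarith
  qed
  then have ae: "norm (if t \<in> N then 0 else \<Lambda> (v t)) \<le> heis_length g * \<sigma> t" if "t \<in> {0..1}" for t
    using that heis_length_nonneg comp(3) by auto
  have int': "((\<lambda>t. if t \<in> N then 0 else \<Lambda> (v t)) has_integral \<Lambda> (g 1 - p)) {0..1}"
    by (rule has_integral_spike[OF N(1) _ int]) auto
  have "norm (integral {0..1} (\<lambda>t. if t \<in> N then 0 else \<Lambda> (v t))) \<le> integral {0..1} (\<lambda>t. heis_length g * \<sigma> t)"
    using int' integrable_cmul[OF sint, of "heis_length g"] ae by (intro integral_norm_bound_integral) auto
  then have "\<bar>\<Lambda> (g 1 - p)\<bar> \<le> heis_length g * heis_length g"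
    using integral_unique[OF int'] len by simp
  moreover have "\<Lambda> (g 1 - p) = heis_height (g 0) (g 1)"
    by (simp add: \<Lambda>_def heis_height_def p_def field_simps)
  ultimately show "\<bar>heis_height (g 0) (g 1)\<bar> \<le> (heis_length g)\<^sup>2"
    by (simp add: power2_eq_square)
qed

lemma heis_gauge_le_d_cc: "heis_gauge p q \<le> 3 * d_cc p q"
proof -
  have "heis_gauge p q / 3 \<le> d_cc p q"
    unfolding d_cc_def
  proof (rule cInf_greatest)
    show "{heis_length g |g. horizontal_path g \<and> g 0 = p \<and> g 1 = q} \<noteq> {}"
      using horizontal_connection[of p q] by blast
    fix l assume "l \<in> {heis_length g |g. horizontal_path g \<and> g 0 = p \<and> g 1 = q}"
    then obtain g where g: "horizontal_path g" "g 0 = p" "g 1 = q" "l = heis_length g" by blast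
    have "sqrt \<bar>heis_height p q\<bar> \<le> l"
      using horizontal_path_displacement(3)[OF g(1)] heis_length_nonneg[of g] g by (intro real_le_lsqrt) auto
    then show "heis_gauge p q / 3 \<le> l"
      using horizontal_path_displacement(1,2)[OF g(1)] g by (simp add: heis_gauge_def)
  qed
  then show ?thesis by simp
qed

section \<open>Sets of Hausdorff measure zero and countable rectifiability\<close>

lemma hausdorff_measure_eq_0_iff:
  "hausdorff_measure d k A = 0 \<longleftrightarrow>
    (\<forall>\<delta>>0. \<forall>\<epsilon>>0. \<exists>C :: nat \<Rightarrow> 'a set. A \<subseteq> (\<Union>i. C i) \<and> (\<forall>i. ediam d (C i) \<le> ennreal \<delta>) \<and>
      (\<Sum>i. if C i = {} then 0 else ediam d (C i) ^ k) < ennreal \<epsilon>)"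
proof -
  let ?cov = "\<lambda>\<delta>. {C :: nat \<Rightarrow> 'a set. A \<subseteq> (\<Union>i. C i) \<and> (\<forall>i. ediam d (C i) \<le> ennreal \<delta>)}"
  let ?s = "\<lambda>C :: nat \<Rightarrow> 'a set. \<Sum>i. if C i = {} then 0 else ediam d (C i) ^ k"
  have SUP: "(SUP x\<in>S. f x) = 0 \<longleftrightarrow> (\<forall>x\<in>S. f x = 0)" for S :: "real set" and f :: "real \<Rightarrow> ennreal"
    unfolding bot_ennreal[symmetric] by (rule SUP_bot_conv)
  have "hausdorff_measure d k A = 0 \<longleftrightarrow> (\<forall>\<delta>>0. (INF C\<in>?cov \<delta>. ?s C) = 0)"
    unfolding hausdorff_measure_def SUP by (simp only: Ball_def greaterThan_iff)
  also have "\<dots> \<longleftrightarrow> (\<forall>\<delta>>0. \<forall>\<epsilon>>0. (INF C\<in>?cov \<delta>. ?s C) < ennreal \<epsilon>)"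
  proof -
    have "x = 0 \<longleftrightarrow> (\<forall>\<epsilon>>0. x < ennreal \<epsilon>)" for x :: ennreal
    proof
      assume *: "\<forall>\<epsilon>>0. x < ennreal \<epsilon>"
      have "x \<le> ennreal e" if "e > 0" for e using *[rule_format, OF that] by (rule less_imp_le)
      then have "x \<le> 0"
        by (metis add_0 ennreal_le_epsilon)
      then show "x = 0" by simp
    qed simp
    then show ?thesis by simp
  qed
  also have "\<dots> \<longleftrightarrow> (\<forall>\<delta>>0. \<forall>\<epsilon>>0. \<exists>C\<in>?cov \<delta>. ?s C < ennreal \<epsilon>)"
    by (simp only: INF_less_iff)
  finally show ?thesis by (simp only: mem_Collect_eq Bex_def conj_assoc)
qed

lemma hausdorff_measure_eq_0_mono:
  assumes "hausdorff_measure d k B = 0" "A \<subseteq> B"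
  shows "hausdorff_measure d k A = 0"
  using assms unfolding hausdorff_measure_eq_0_iff by (meson subset_trans)

lemma hausdorff_measure_eq_0_UN:
  assumes "\<And>n::nat. hausdorff_measure d k (A n) = 0"
  shows "hausdorff_measure d k (\<Union>n. A n) = 0"
  unfolding hausdorff_measure_eq_0_iff
proof (intro allI impI)
  fix \<delta> \<epsilon> :: real assume "\<delta> > 0" "\<epsilon> > 0"
  let ?w = "\<lambda>X. if X = {} then 0 else ediam d X ^ k"
  have "\<forall>n. \<exists>C. A n \<subseteq> (\<Union>i. C i) \<and> (\<forall>i. ediam d (C i) \<le> ennreal \<delta>) \<and>
      (\<Sum>i. ?w (C i)) < ennreal (\<epsilon> / 2 * (1 / 2) ^ Suc n)"
  proof
    fix n
    have "\<epsilon> / 2 * (1 / 2) ^ Suc n > 0" using \<open>\<epsilon> > 0\<close> by simp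
    then show "\<exists>C. A n \<subseteq> (\<Union>i. C i) \<and> (\<forall>i. ediam d (C i) \<le> ennreal \<delta>) \<and>
        (\<Sum>i. ?w (C i)) < ennreal (\<epsilon> / 2 * (1 / 2) ^ Suc n)"
      using assms[of n, unfolded hausdorff_measure_eq_0_iff, rule_format, OF \<open>\<delta> > 0\<close>] by blast
  qed
  from choice[OF this] obtain C where C: "\<And>n. A n \<subseteq> (\<Union>i. C n i)" "\<And>n i. ediam d (C n i) \<le> ennreal \<delta>"
      "\<And>n. (\<Sum>i. ?w (C n i)) < ennreal (\<epsilon> / 2 * (1 / 2) ^ Suc n)"
    by blast
  define D where "D j = C (fst (prod_decode j)) (snd (prod_decode j))" for j
  define F where "F = (\<lambda>(n, i). ?w (C n i))"
  have "(\<Sum>j. ?w (D j)) = (\<Sum>j. F (prod_decode j))"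
    by (simp only: D_def F_def split_beta)
  also have "\<dots> = (\<Sum>n. \<Sum>i. F (n, i))"
    by (rule suminf_ennreal_2dimen) (rule refl)
  also have "\<dots> = (\<Sum>n. \<Sum>i. ?w (C n i))"
    by (simp only: F_def split_conv)
  also have "\<dots> \<le> (\<Sum>n. ennreal (\<epsilon> / 2 * (1 / 2) ^ Suc n))"
    using C(3) by (intro suminf_le less_imp_le) auto
  also have "\<dots> = ennreal (\<epsilon> / 2 * 1)"
    using \<open>\<epsilon> > 0\<close> by (intro suminf_ennreal_eq sums_mult power_half_series) auto
  also have "\<dots> < ennreal \<epsilon>" using \<open>\<epsilon> > 0\<close> by (simp add: ennreal_less_iff)
  finally have small: "(\<Sum>j. ?w (D j)) < ennreal \<epsilon>" .
  have cover: "(\<Union>n. A n) \<subseteq> (\<Union>j. D j)"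
  proof
    fix x assume "x \<in> (\<Union>n. A n)"
    then obtain n i where "x \<in> C n i" using C(1) by blast
    then have "x \<in> D (prod_encode (n, i))" by (simp add: D_def)
    then show "x \<in> (\<Union>j. D j)" by blast
  qed
  have "\<forall>j. ediam d (D j) \<le> ennreal \<delta>" using C(2) by (simp add: D_def)
  with small cover show "\<exists>C. (\<Union>n. A n) \<subseteq> (\<Union>i. C i) \<and> (\<forall>i. ediam d (C i) \<le> ennreal \<delta>) \<and> (\<Sum>i. ?w (C i)) < ennreal \<epsilon>"
    by blast
qed

lemma ediam_le:
  assumes "\<And>x y. \<lbrakk>x \<in> A; y \<in> A\<rbrakk> \<Longrightarrow> d x y \<le> r"
  shows "ediam d A \<le> ennreal r"
  unfolding ediam_def by (intro SUP_least ennreal_leI assms)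

lemma hausdorff_measure_eq_0_finite_covers:
  assumes "\<And>\<delta> \<epsilon>. \<lbrakk>\<delta> > 0; \<epsilon> > 0\<rbrakk> \<Longrightarrow> \<exists>(I :: 'i set) C r. finite I \<and> A \<subseteq> (\<Union>i\<in>I. C i) \<and> 0 \<le> r \<and> r \<le> \<delta> \<and>
    (\<forall>i\<in>I. \<forall>x\<in>C i. \<forall>y\<in>C i. d x y \<le> r) \<and> real (card I) * r ^ k < \<epsilon>"
  shows "hausdorff_measure d k A = 0"
  unfolding hausdorff_measure_eq_0_iff
proof (intro allI impI)
  fix \<delta> \<epsilon> :: real assume "\<delta> > 0" "\<epsilon> > 0"
  let ?w = "\<lambda>X. if X = {} then 0 else ediam d X ^ k"
  obtain I :: "'i set" and C r where C: "finite I" "A \<subseteq> (\<Union>i\<in>I. C i)" "0 \<le> r" "r \<le> \<delta>"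
      "\<And>i x y. \<lbrakk>i \<in> I; x \<in> C i; y \<in> C i\<rbrakk> \<Longrightarrow> d x y \<le> r" "real (card I) * r ^ k < \<epsilon>"
    using assms[OF \<open>\<delta> > 0\<close> \<open>\<epsilon> > 0\<close>] by blast
  obtain h where h: "bij_betw h {0..<card I} I" using ex_bij_betw_nat_finite[OF C(1)] by blast
  define D where "D n = (if n < card I then C (h n) else {})" for n
  have hI: "h n \<in> I" if "n < card I" for n using h that by (auto simp: bij_betw_def)
  have diam: "ediam d (D n) \<le> ennreal r" for n
    using C(5)[OF hI] C(3) by (intro ediam_le) (auto simp: D_def split: if_splits)
  have "(\<Sum>n. ?w (D n)) = (\<Sum>n<card I. ?w (D n))"
    by (rule suminf_finite) (auto simp: D_def)
  also have "\<dots> \<le> (\<Sum>n<card I. ennreal (r ^ k))"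
  proof (rule sum_mono)
    fix n
    have "ediam d (D n) ^ k \<le> ennreal r ^ k" by (rule power_mono[OF diam]) simp
    then show "?w (D n) \<le> ennreal (r ^ k)" using C(3) by (simp add: ennreal_power)
  qed
  also have "\<dots> = ennreal (real (card I) * r ^ k)"
    using C(3) by (simp add: ennreal_mult ennreal_of_nat_eq_real_of_nat)
  also have "\<dots> < ennreal \<epsilon>" using C(3,6) by (intro ennreal_lessI) (auto intro: order.strict_trans1[rotated])
  finally have "(\<Sum>n. ?w (D n)) < ennreal \<epsilon>" .
  moreover have "A \<subseteq> (\<Union>n. D n)"
  proof
    fix x assume "x \<in> A"
    then obtain i where "i \<in> I" "x \<in> C i" using C(2) by blast
    then have "i \<in> h ` {0..<card I}" using h by (simp add: bij_betw_def)
    then obtain n where "n < card I" "i = h n" by auto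
    then have "x \<in> D n" using \<open>x \<in> C i\<close> by (simp add: D_def)
    then show "x \<in> (\<Union>n. D n)" by blast
  qed
  moreover have "\<forall>n. ediam d (D n) \<le> ennreal \<delta>" using diam C(4) by (meson ennreal_leI order_trans)
  ultimately show "\<exists>C. A \<subseteq> (\<Union>i. C i) \<and> (\<forall>i. ediam d (C i) \<le> ennreal \<delta>) \<and> (\<Sum>i. ?w (C i)) < ennreal \<epsilon>"
    by blast
qed

lemma countably_rectifiable_null:
  assumes "hausdorff_measure d' k E = 0"
  shows "countably_rectifiable N d d' k E"
  unfolding countably_rectifiable_def lipschitz_between_def
  by (rule exI[of _ "\<lambda>_. {}"]) (use assms in auto)

lemma countably_rectifiable_lipschitz_image:
  assumes "U \<subseteq> N" "lipschitz_between d d' U f" "E \<subseteq> f ` U"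
  shows "countably_rectifiable N d d' k E"
proof -
  have "hausdorff_measure d' k {} = 0"
    by (rule hausdorff_measure_eq_0_finite_covers[where 'i = nat]) (intro exI[of _ "{}"] exI[of _ "\<lambda>_. {}"] exI[of _ 0], auto)
  moreover have "E - (\<Union>i::nat. f ` U) = {}" using assms(3) by auto
  ultimately have "hausdorff_measure d' k (E - (\<Union>i::nat. f ` U)) = 0" by (simp only:)
  then show ?thesis
    unfolding countably_rectifiable_def
    using assms(1,2) by (intro exI[of _ "\<lambda>_. U"] exI[of _ "\<lambda>_. f"]) simp
qed

lemma countably_rectifiable_UN:
  assumes "\<And>n::nat. countably_rectifiable N d d' k (E n)"
  shows "countably_rectifiable N d d' k (\<Union>n. E n)"
proof -
  obtain U f where Uf: "\<And>n i. U n i \<subseteq> N \<and> lipschitz_between d d' (U n i) (f n i)"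
      "\<And>n. hausdorff_measure d' k (E n - (\<Union>i::nat. f n i ` U n i)) = 0"
    using assms unfolding countably_rectifiable_def by metis
  define V where "V j = U (fst (prod_decode j)) (snd (prod_decode j))" for j
  define g where "g j = f (fst (prod_decode j)) (snd (prod_decode j))" for j
  have sub: "f n i ` U n i \<subseteq> (\<Union>j. g j ` V j)" for n i
  proof -
    have "f n i ` U n i = g (prod_encode (n, i)) ` V (prod_encode (n, i))" by (simp add: g_def V_def)
    then show ?thesis by blast
  qed
  have "hausdorff_measure d' k (\<Union>n. E n - (\<Union>i. f n i ` U n i)) = 0"
    by (rule hausdorff_measure_eq_0_UN[OF Uf(2)])
  then have "hausdorff_measure d' k ((\<Union>n. E n) - (\<Union>j. g j ` V j)) = 0"
  proof (rule hausdorff_measure_eq_0_mono)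
    show "(\<Union>n. E n) - (\<Union>j. g j ` V j) \<subseteq> (\<Union>n. E n - (\<Union>i. f n i ` U n i))"
    proof
      fix x assume x: "x \<in> (\<Union>n. E n) - (\<Union>j. g j ` V j)"
      then obtain n where "x \<in> E n" by blast
      moreover have "x \<notin> f n i ` U n i" for i using x sub[of n i] by (meson DiffD2 subsetD)
      ultimately show "x \<in> (\<Union>n. E n - (\<Union>i. f n i ` U n i))" by blast
    qed
  qed
  then show ?thesis
    unfolding countably_rectifiable_def using Uf(1)
    by (intro exI[of _ V] exI[of _ g]) (auto simp: V_def g_def)
qed

lemma countably_rectifiable_mono:
  assumes "countably_rectifiable N d d' k F" "E \<subseteq> F"
  shows "countably_rectifiable N d d' k E"
proof -
  obtain U f where Uf: "\<forall>i. U i \<subseteq> N \<and> lipschitz_between d d' (U i) (f i)"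
      "hausdorff_measure d' k (F - (\<Union>i::nat. f i ` U i)) = 0"
    using assms(1) unfolding countably_rectifiable_def by blast
  moreover have "E - (\<Union>i. f i ` U i) \<subseteq> F - (\<Union>i. f i ` U i)" using assms(2) by blast
  ultimately have "hausdorff_measure d' k (E - (\<Union>i. f i ` U i)) = 0"
    using hausdorff_measure_eq_0_mono by metis
  then show ?thesis
    unfolding countably_rectifiable_def using Uf(1) by (intro exI[of _ U] exI[of _ f]) simp
qed

lemma countably_rectifiable_Un:
  assumes "countably_rectifiable N d d' k E" "countably_rectifiable N d d' k F"
  shows "countably_rectifiable N d d' k (E \<union> F)"
proof -
  have "E \<union> F = (\<Union>n::nat. if n = 0 then E else F)" by (auto split: if_splits)
  then show ?thesis using countably_rectifiable_UN[of N d d' k "\<lambda>n. if n = 0 then E else F"] assms by simp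
qed

text \<open>Countably many of the open sets cover \<open>E\<close> by the Lindelof property.\<close>

lemma countably_rectifiable_local:
  fixes E :: "'b::second_countable_topology set"
  assumes "\<And>x. x \<in> E \<Longrightarrow> \<exists>V. open V \<and> x \<in> V \<and> countably_rectifiable N d d' k (E \<inter> V)"
  shows "countably_rectifiable N d d' k E"
proof -
  let ?F = "{V. open V \<and> countably_rectifiable N d d' k (E \<inter> V)}"
  obtain F' where F': "F' \<subseteq> ?F" "countable F'" "\<Union>F' = \<Union>?F"
    using Lindelof[of ?F] by auto
  have "E \<subseteq> \<Union>F'" using assms unfolding F'(3) by blast
  show ?thesis
  proof (cases "F' = {}")
    case True
    then have "E \<subseteq> (\<lambda>_. undefined) ` {}" using \<open>E \<subseteq> \<Union>F'\<close> by simp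
    then show ?thesis
      by (rule countably_rectifiable_lipschitz_image[rotated 2]) (auto simp: lipschitz_between_def)
  next
    case False
    then have "countably_rectifiable N d d' k (\<Union>n. E \<inter> from_nat_into F' n)"
      using F'(1) from_nat_into[OF False] by (intro countably_rectifiable_UN) blast
    moreover have "E \<subseteq> (\<Union>n. E \<inter> from_nat_into F' n)"
      using \<open>E \<subseteq> \<Union>F'\<close> range_from_nat_into[OF False F'(2)] by blast
    ultimately show ?thesis by (rule countably_rectifiable_mono)
  qed
qed

section \<open>Intrinsic Lipschitz graphs and their horizontal curves\<close>

text \<open>McShane's formula \<open>inf (f a + L d(x, a))\<close> is the largest extension with the same Lipschitz constant;
truncating it preserves the constant and restores the bound.\<close>

lemma bounded_lipschitz_extension:
  fixes f :: "'a::metric_space \<Rightarrow> real"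
  assumes f: "L-lipschitz_on A f" and B: "\<And>x. x \<in> A \<Longrightarrow> \<bar>f x\<bar> \<le> B" "0 \<le> B"
  obtains F where "L-lipschitz_on UNIV F" "\<And>x. x \<in> A \<Longrightarrow> F x = f x" "\<And>x. \<bar>F x\<bar> \<le> B"
proof (cases "A = {}")
  case True
  then show ?thesis
    using that[of "\<lambda>_. 0"] B(2) lipschitz_on_nonneg[OF f] by (auto simp: lipschitz_on_def)
next
  case False
  have L: "L \<ge> 0" using f by (rule lipschitz_on_nonneg)
  define G where "G x = (INF a\<in>A. f a + L * dist x a)" for x
  have bdd: "bdd_below ((\<lambda>a. f a + L * dist x a) ` A)" for x
  proof (rule bdd_belowI[of _ "- B"])
    fix y assume "y \<in> (\<lambda>a. f a + L * dist x a) ` A"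
    then obtain a where a: "a \<in> A" "y = f a + L * dist x a" by blast
    have "0 \<le> L * dist x a" using L by simp
    then show "- B \<le> y" using B(1)[OF a(1)] a(2) by linarith
  qed
  have GA: "G x = f x" if "x \<in> A" for x
  proof (rule antisym)
    show "G x \<le> f x" unfolding G_def using cINF_lower[OF bdd that, of x] by simp
    show "f x \<le> G x" unfolding G_def
    proof (rule cINF_greatest[OF False])
      fix a assume "a \<in> A"
      then show "f x \<le> f a + L * dist x a"
        using lipschitz_onD[OF f that \<open>a \<in> A\<close>] by (auto simp: dist_real_def)
    qed
  qed
  have G1: "G x \<le> G y + L * dist x y" for x y
  proof -
    have key: "G x - L * dist x y \<le> f a + L * dist y a" if "a \<in> A" for a
    proof -
      have "G x \<le> f a + L * dist x a" unfolding G_def by (rule cINF_lower[OF bdd that])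
      moreover have "L * dist x a \<le> L * (dist x y + dist y a)" using L by (intro mult_left_mono dist_triangle)
      ultimately show ?thesis by (simp add: distrib_left)
    qed
    have "G x - L * dist x y \<le> G y" unfolding G_def[of y] by (intro cINF_greatest[OF False] key)
    then show ?thesis by simp
  qed
  define F where "F x = max (- B) (min B (G x))" for x
  show ?thesis
  proof (rule that[of F])
    show "L-lipschitz_on UNIV F"
    proof (rule lipschitz_onI)
      fix x y
      have "\<bar>F x - F y\<bar> \<le> \<bar>G x - G y\<bar>" by (auto simp: F_def min_def max_def)
      also have "\<dots> \<le> L * dist x y" using G1[of x y] G1[of y x] by (simp add: abs_le_iff dist_commute)
      finally show "dist (F x) (F y) \<le> L * dist x y" by (simp add: dist_real_def)
    qed (rule L)
    show "F x = f x" if "x \<in> A" for x using GA[OF that] B(1)[OF that] by (auto simp: F_def)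
    show "\<bar>F x\<bar> \<le> B" for x using B(2) by (auto simp: F_def)
  qed
qed

text \<open>Picard iteration.  The initial condition sits at an arbitrary point \<open>x\<close> of the interval, so the
integral from \<open>x\<close> to \<open>s\<close> is written as a difference of integrals from \<open>t0\<close>.  Each of the two has
Lipschitz constant \<open>1 / 4\<close> in the curve, which makes the operator a contraction with factor \<open>1 / 2\<close>.\<close>

lemma ODE_solution_exists:
  fixes F :: "real \<times> real \<Rightarrow> real"
  assumes F: "K-lipschitz_on UNIV F" and t: "t0 \<le> t1" "K * (t1 - t0) \<le> 1 / 4" and x: "x \<in> {t0..t1}"
  obtains c where "c x = w" "\<And>t. t \<in> {t0..t1} \<Longrightarrow> (c has_real_derivative F (t, c t)) (at t within {t0..t1})"
proof -
  have K: "K \<ge> 0" using F by (rule lipschitz_on_nonneg)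
  define \<Phi> where "\<Phi> c s = integral {t0..s} (\<lambda>t. F (t, c t))" for c :: "real \<Rightarrow> real" and s
  \<comment> \<open>Clamping the time lets the operator act on bounded continuous functions on the whole line.\<close>
  define cl where "cl s = max t0 (min t1 s)" for s
  define T where "T c s = w + (\<Phi> (apply_bcontfun c) (cl s) - \<Phi> (apply_bcontfun c) x)" for c s
  have cl: "cl s \<in> {t0..t1}" "s \<in> {t0..t1} \<Longrightarrow> cl s = s" for s using t(1) by (auto simp: cl_def)
  have contF: "continuous_on S (\<lambda>t. F (t, c t))" if "continuous_on S c" for S c
  proof -
    have "continuous_on S (\<lambda>t. (t, c t))" using that by (intro continuous_intros)
    then show ?thesis using continuous_on_compose2[OF lipschitz_on_continuous_on[OF F]] by blast
  qed
  have cc: "continuous_on S (apply_bcontfun c)" for S and c :: "real \<Rightarrow>\<^sub>C real"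
    using continuous_on_apply_bcontfun continuous_on_subset by blast
  have int: "(\<lambda>t. F (t, apply_bcontfun c t)) integrable_on {t0..s}" for c :: "real \<Rightarrow>\<^sub>C real" and s
    by (intro integrable_continuous_interval contF cc)
  have cont\<Phi>: "continuous_on {t0..t1} (\<Phi> (apply_bcontfun c))" for c
    unfolding \<Phi>_def by (rule indefinite_integral_continuous_1[OF int])
  have Tb: "T c \<in> bcontfun" for c
  proof -
    have "bounded (\<Phi> (apply_bcontfun c) ` {t0..t1})"
      by (intro compact_imp_bounded compact_continuous_image cont\<Phi>) auto
    then obtain M where M: "\<And>s. s \<in> {t0..t1} \<Longrightarrow> norm (\<Phi> (apply_bcontfun c) s) \<le> M"
      by (metis bounded_iff image_eqI)
    have "continuous_on UNIV cl" unfolding cl_def by (intro continuous_intros)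
    moreover have "cl ` UNIV \<subseteq> {t0..t1}" using cl(1) by blast
    ultimately have "continuous_on UNIV (\<lambda>s. \<Phi> (apply_bcontfun c) (cl s))"
      using continuous_on_compose2[OF cont\<Phi>[of c]] by blast
    then have "continuous_on UNIV (T c)"
      unfolding T_def by (intro continuous_intros)
    moreover have "norm (T c s) \<le> \<bar>w\<bar> + (M + M)" for s
      using M[OF cl(1)[of s]] M[OF x] unfolding T_def by auto
    ultimately show ?thesis by (rule bcontfun_normI)
  qed
  have close: "\<bar>\<Phi> (apply_bcontfun c) s - \<Phi> (apply_bcontfun c') s\<bar> \<le> dist c c' / 4" if s: "s \<in> {t0..t1}" for c c' s
  proof -
    have "\<Phi> (apply_bcontfun c) s - \<Phi> (apply_bcontfun c') s
        = integral {t0..s} (\<lambda>t. F (t, apply_bcontfun c t) - F (t, apply_bcontfun c' t))"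
      unfolding \<Phi>_def by (rule integral_diff[OF int int, symmetric])
    moreover have "norm (integral {t0..s} (\<lambda>t. F (t, apply_bcontfun c t) - F (t, apply_bcontfun c' t))) \<le> K * dist c c' * (s - t0)"
    proof (rule integral_bound)
      show "t0 \<le> s" using s by simp
      show "continuous_on {t0..s} (\<lambda>t. F (t, apply_bcontfun c t) - F (t, apply_bcontfun c' t))"
        by (intro continuous_on_diff contF cc)
      fix t
      have "norm (F (t, apply_bcontfun c t) - F (t, apply_bcontfun c' t)) \<le> K * dist (t, apply_bcontfun c t) (t, apply_bcontfun c' t)"
        using lipschitz_onD[OF F, of "(t, apply_bcontfun c t)" "(t, apply_bcontfun c' t)"] by (simp add: dist_norm)
      also have "\<dots> \<le> K * dist c c'"
        using K dist_bounded[of c t c'] by (intro mult_left_mono) (auto simp: dist_Pair_Pair)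
      finally show "norm (F (t, apply_bcontfun c t) - F (t, apply_bcontfun c' t)) \<le> K * dist c c'" .
    qed
    moreover have "K * dist c c' * (s - t0) \<le> dist c c' * (1 / 4)"
    proof -
      have "K * (s - t0) \<le> K * (t1 - t0)" using K s by (intro mult_left_mono) auto
      then have "K * (s - t0) \<le> 1 / 4" using t(2) by linarith
      then show ?thesis using mult_left_mono[of "K * (s - t0)" "1/4" "dist c c'"] by (simp add: ac_simps)
    qed
    ultimately show ?thesis by simp
  qed
  have app: "apply_bcontfun (Bcontfun (T c)) = T c" for c by (rule Bcontfun_inverse[OF Tb])
  have contr: "dist (Bcontfun (T c)) (Bcontfun (T c')) \<le> 1 / 2 * dist c c'" for c c'
  proof (rule dist_bound)
    fix s
    show "dist (apply_bcontfun (Bcontfun (T c)) s) (apply_bcontfun (Bcontfun (T c')) s) \<le> 1 / 2 * dist c c'"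
      unfolding app using close[OF cl(1)[of s], of c c'] close[OF x, of c c']
      by (auto simp: T_def dist_real_def abs_if split: if_splits)
  qed
  have "\<exists>!c. c \<in> UNIV \<and> Bcontfun (T c) = c"
    using Banach_fix[of "UNIV :: (real \<Rightarrow>\<^sub>C real) set" "1/2" "\<lambda>c. Bcontfun (T c)"] contr complete_UNIV by auto
  then obtain c where "Bcontfun (T c) = c" by blast
  then have c: "apply_bcontfun c s = T c s" for s using app[of c] by simp
  show ?thesis
  proof (rule that[of "apply_bcontfun c"])
    show "apply_bcontfun c x = w" using c[of x] cl(2)[OF x] by (simp add: T_def)
    fix s assume s: "s \<in> {t0..t1}"
    have "(\<Phi> (apply_bcontfun c) has_vector_derivative F (s, apply_bcontfun c s)) (at s within {t0..t1})"
      unfolding \<Phi>_def using integral_has_vector_derivative[OF contF[OF cc] s] .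
    then have "((\<lambda>r. w + (\<Phi> (apply_bcontfun c) r - \<Phi> (apply_bcontfun c) x)) has_real_derivative F (s, apply_bcontfun c s)) (at s within {t0..t1})"
      unfolding has_real_derivative_iff_has_vector_derivative[symmetric]
      by (auto intro!: derivative_eq_intros)
    then show "(apply_bcontfun c has_real_derivative F (s, apply_bcontfun c s)) (at s within {t0..t1})"
    proof (rule has_field_derivative_transform_within[OF _ zero_less_one s])
      show "w + (\<Phi> (apply_bcontfun c) r - \<Phi> (apply_bcontfun c) x) = apply_bcontfun c r" if "r \<in> {t0..t1}" for r
        using c[of r] cl(2)[OF that] by (simp add: T_def)
    qed
  qed
qed

text \<open>This replaces Gronwall's inequality on a short interval: where the distance of the two solutions is
maximal, it exceeds the distance at \<open>s\<close> by at most a quarter of itself.\<close>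

lemma ODE_solutions_stay_close:
  fixes F :: "real \<times> real \<Rightarrow> real"
  assumes F: "K-lipschitz_on UNIV F" and small: "K * (t1 - t0) \<le> 1 / 4"
    and c: "\<And>t. t \<in> {t0..t1} \<Longrightarrow> (c has_real_derivative F (t, c t)) (at t within {t0..t1})"
    and c': "\<And>t. t \<in> {t0..t1} \<Longrightarrow> (c' has_real_derivative F (t, c' t)) (at t within {t0..t1})"
    and st: "s \<in> {t0..t1}" "t \<in> {t0..t1}"
  shows "\<bar>c t - c' t\<bar> \<le> 2 * \<bar>c s - c' s\<bar>"
proof -
  have K: "K \<ge> 0" using F by (rule lipschitz_on_nonneg)
  define D where "D r = c r - c' r" for r
  have derD: "(D has_real_derivative F (r, c r) - F (r, c' r)) (at r within {t0..t1})" if "r \<in> {t0..t1}" for r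
    unfolding D_def by (intro DERIV_diff c c' that)
  then have "continuous_on {t0..t1} D" by (rule DERIV_continuous_on)
  then have "continuous_on {t0..t1} (\<lambda>r. \<bar>D r\<bar>)" by (intro continuous_intros)
  moreover have "{t0..t1} \<noteq> {}" using st by auto
  ultimately obtain m where m: "m \<in> {t0..t1}" "\<And>r. r \<in> {t0..t1} \<Longrightarrow> \<bar>D r\<bar> \<le> \<bar>D m\<bar>"
    using continuous_attains_sup[of "{t0..t1}"] by (metis compact_Icc)
  have "norm (D m - D s) \<le> K * \<bar>D m\<bar> * norm (m - s)"
  proof (rule field_differentiable_bound[of "{t0..t1}" D "\<lambda>r. F (r, c r) - F (r, c' r)"])
    fix r assume r: "r \<in> {t0..t1}"
    have "norm (F (r, c r) - F (r, c' r)) \<le> K * dist (r, c r) (r, c' r)"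
      using lipschitz_onD[OF F, of "(r, c r)" "(r, c' r)"] by (simp add: dist_norm)
    also have "\<dots> = K * \<bar>D r\<bar>" by (simp add: dist_Pair_Pair D_def dist_real_def)
    also have "\<dots> \<le> K * \<bar>D m\<bar>" using K m(2)[OF r] by (intro mult_left_mono)
    finally show "norm (F (r, c r) - F (r, c' r)) \<le> K * \<bar>D m\<bar>" .
  qed (use derD m(1) st in auto)
  also have "\<dots> \<le> \<bar>D m\<bar> * (1 / 4)"
  proof -
    have "K * norm (m - s) \<le> K * (t1 - t0)" using K m(1) st by (intro mult_left_mono) auto
    then have "K * norm (m - s) \<le> 1 / 4" using small by linarith
    then show ?thesis using mult_left_mono[of "K * norm (m - s)" "1/4" "\<bar>D m\<bar>"] by (simp add: ac_simps)
  qed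
  finally have "\<bar>D m - D s\<bar> \<le> \<bar>D m\<bar> * (1 / 4)" by simp
  then have "\<bar>D m\<bar> \<le> 2 * \<bar>D s\<bar>" using abs_triangle_ineq2[of "D m" "D s"] by linarith
  then show ?thesis using m(2)[OF st(2)] by (simp add: D_def)
qed

text \<open>In the coordinates \<open>x, y, w\<close> with \<open>w\<close> the sheared height, the contact form \<open>dz - (x dy - y dx) / 2\<close>
becomes \<open>dw + y dx\<close>.  It contains no \<open>dy\<close>, so horizontal curves on a graph \<open>y = f(x, w)\<close> solve
an equation for \<open>w\<close> alone that does not involve derivatives of \<open>f\<close>.\<close>

definition sheared_height :: "real^3 \<Rightarrow> real" where
  "sheared_height p = p$3 - p$1 * p$2 / 2"

lemma heis_height_sheared:
  "heis_height p q = sheared_height q - sheared_height p + (q$1 - p$1) * (p$2 + q$2) / 2"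
  by (simp add: heis_height_def sheared_height_def field_simps)

text \<open>The assumption says that \<open>E\<close> is part of a graph \<open>y = Y(x, w)\<close> with \<open>Y\<close> Lipschitz.  The coordinate
\<open>\<sigma> p\<close> is the value at \<open>t0\<close> of the horizontal curve \<open>dw/dx = - Y(x, w)\<close> through \<open>p\<close>.  To estimate the
height of \<open>q\<close> over \<open>p\<close>, follow the curve of \<open>p\<close> to the abscissa of \<open>q\<close> and then jump to the curve of
\<open>q\<close>.  The first step is horizontal and \<open>Y\<close> changes along it at a bounded rate, so it contributes
\<open>O(\<Delta>x\<^sup>2)\<close>; the jump contributes \<open>O(\<bar>\<Delta>\<sigma>\<bar>)\<close> because solutions stay close.  The square
root of the sum is \<open>O(\<bar>\<Delta>x\<bar> + sqrt \<bar>\<Delta>\<sigma>\<bar>)\<close>.\<close>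

lemma intrinsic_graph_coordinates:
  fixes E :: "(real^3) set"
  assumes lip: "\<And>p q. \<lbrakk>p \<in> E; q \<in> E\<rbrakk> \<Longrightarrow> \<bar>p$2 - q$2\<bar> \<le> L * (\<bar>p$1 - q$1\<bar> + \<bar>sheared_height p - sheared_height q\<bar>)"
    and box: "\<And>p. p \<in> E \<Longrightarrow> p$1 \<in> {t0..t1} \<and> \<bar>p$2\<bar> \<le> B \<and> \<bar>sheared_height p\<bar> \<le> B"
    and "0 \<le> L" "0 \<le> B" "t0 \<le> t1" and small: "2 * L * (t1 - t0) \<le> 1 / 4"
  obtains \<sigma> C where "0 \<le> C" "\<And>p q. \<lbrakk>p \<in> E; q \<in> E\<rbrakk> \<Longrightarrow> heis_gauge p q \<le> C * (\<bar>q$1 - p$1\<bar> + sqrt \<bar>\<sigma> q - \<sigma> p\<bar>)"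
proof -
  \<comment> \<open>The factor \<open>2\<close> passes from the sum of the coordinate distances to the Euclidean distance.\<close>
  define K where "K = 2 * L"
  define coords where "coords p = (p$1, sheared_height p)" for p :: "real^3"
  have "K \<ge> 0" using \<open>0 \<le> L\<close> by (simp add: K_def)
  have sum_dist: "\<bar>a - a'\<bar> + \<bar>b - b'\<bar> \<le> 2 * dist (a, b) (a', b')" for a b a' b' :: real
    using dist_fst_le[of "(a, b)" "(a', b')"] dist_snd_le[of "(a, b)" "(a', b')"] by (simp add: dist_real_def)
  have lipK: "\<bar>p$2 - q$2\<bar> \<le> K * dist (coords p) (coords q)" if "p \<in> E" "q \<in> E" for p q
  proof -
    have "L * (\<bar>p$1 - q$1\<bar> + \<bar>sheared_height p - sheared_height q\<bar>) \<le> L * (2 * dist (coords p) (coords q))"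
      unfolding coords_def using \<open>0 \<le> L\<close> by (intro mult_left_mono sum_dist)
    then show ?thesis using lip[OF that] by (simp add: K_def)
  qed
  define f where "f u = inv_into E coords u $ 2" for u
  have inv: "inv_into E coords u \<in> E" "coords (inv_into E coords u) = u" if "u \<in> coords ` E" for u
    using that by (auto intro: inv_into_into f_inv_into_f)
  have f: "f (coords p) = p$2" if "p \<in> E" for p
    using lipK[OF that inv(1), of "coords p"] inv(2)[of "coords p"] that by (simp add: f_def)
  have "K-lipschitz_on (coords ` E) f"
  proof (rule lipschitz_onI)
    fix u v assume "u \<in> coords ` E" "v \<in> coords ` E"
    then show "dist (f u) (f v) \<le> K * dist u v"
      using lipK[OF inv(1) inv(1)] inv(2) by (simp add: f_def dist_real_def)
  qed (rule \<open>K \<ge> 0\<close>)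
  moreover have "\<bar>f u\<bar> \<le> B" if "u \<in> coords ` E" for u using box[OF inv(1)[OF that]] by (simp add: f_def)
  ultimately obtain Y where Y: "K-lipschitz_on UNIV Y" "\<And>u. u \<in> coords ` E \<Longrightarrow> Y u = f u" "\<And>u. \<bar>Y u\<bar> \<le> B"
    using bounded_lipschitz_extension[of K "coords ` E" f B] \<open>0 \<le> B\<close> by metis
  have YE: "Y (coords p) = p$2" if "p \<in> E" for p using Y(2)[of "coords p"] f[OF that] that by simp
  have nY: "K-lipschitz_on UNIV (\<lambda>u. - Y u)" using Y(1) by (simp add: lipschitz_on_def dist_minus)
  have smallK: "K * (t1 - t0) \<le> 1 / 4" using small by (simp add: K_def)
  have "\<forall>p\<in>E. \<exists>c. c (p$1) = sheared_height p \<and>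
      (\<forall>t\<in>{t0..t1}. (c has_real_derivative - Y (t, c t)) (at t within {t0..t1}))"
    using ODE_solution_exists[OF nY \<open>t0 \<le> t1\<close> smallK] box by metis
  from bchoice[OF this] obtain c where c: "\<And>p. p \<in> E \<Longrightarrow> c p (p$1) = sheared_height p"
    "\<And>p t. \<lbrakk>p \<in> E; t \<in> {t0..t1}\<rbrakk> \<Longrightarrow> (c p has_real_derivative - Y (t, c p t)) (at t within {t0..t1})"
    by blast
  define \<sigma> where "\<sigma> p = c p t0" for p
  have t0: "t0 \<in> {t0..t1}" using \<open>t0 \<le> t1\<close> by simp
  have curve: "\<bar>c p t - c p s\<bar> \<le> B * \<bar>t - s\<bar>" if "p \<in> E" "s \<in> {t0..t1}" "t \<in> {t0..t1}" for p s t
    using field_differentiable_bound[of "{t0..t1}" "c p" "\<lambda>t. - Y (t, c p t)" B t s] c(2)[OF \<open>p \<in> E\<close>] Y(3) that by simp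
  \<comment> \<open>A bound for \<open>\<bar>\<Delta>\<sigma>\<bar>\<close>, used to absorb \<open>\<bar>\<Delta>\<sigma>\<bar>\<close> into \<open>sqrt M * sqrt \<bar>\<Delta>\<sigma>\<bar>\<close>.\<close>
  define M where "M = 2 * (B + B * (t1 - t0))"
  have "M \<ge> 0" using \<open>0 \<le> B\<close> \<open>t0 \<le> t1\<close> by (simp add: M_def)
  have \<sigma>_bound: "\<bar>\<sigma> p\<bar> \<le> M / 2" if "p \<in> E" for p
  proof -
    have "B * \<bar>t0 - p$1\<bar> \<le> B * (t1 - t0)" using box[OF that] \<open>0 \<le> B\<close> by (intro mult_left_mono) auto
    then show ?thesis
      using curve[OF that _ t0, of "p$1"] box[OF that] c(1)[OF that] by (auto simp: M_def \<sigma>_def)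
  qed
  define A where "A = K * (1 + B)"
  have "A \<ge> 0" using \<open>K \<ge> 0\<close> \<open>0 \<le> B\<close> by (simp add: A_def)
  define C where "C = (1 + A + sqrt (2 * A)) + (2 * K * sqrt M + 2)"
  have "C \<ge> 0" using \<open>A \<ge> 0\<close> \<open>K \<ge> 0\<close> \<open>M \<ge> 0\<close> by (simp add: C_def)
  have "heis_gauge p q \<le> C * (\<bar>q$1 - p$1\<bar> + sqrt \<bar>\<sigma> q - \<sigma> p\<bar>)" if pq: "p \<in> E" "q \<in> E" for p q
  proof -
    define dx ds where "dx = \<bar>q$1 - p$1\<bar>" and "ds = \<bar>\<sigma> q - \<sigma> p\<bar>"
    have x: "p$1 \<in> {t0..t1}" "q$1 \<in> {t0..t1}" using box pq by auto
    have Kdx: "K * dx \<le> 1 / 4"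
    proof -
      have "K * dx \<le> K * (t1 - t0)" using x \<open>K \<ge> 0\<close> unfolding dx_def by (intro mult_left_mono) auto
      then show ?thesis using smallK by linarith
    qed
    have pos: "dx \<ge> 0" "ds \<ge> 0" by (auto simp: dx_def ds_def)
    have across: "\<bar>c q (q$1) - c p (q$1)\<bar> \<le> 2 * ds"
      using ODE_solutions_stay_close[OF nY smallK c(2)[OF pq(2)] c(2)[OF pq(1)] t0 x(2)] by (simp add: ds_def \<sigma>_def)
    have along: "\<bar>c p (q$1) - c p (p$1) + (q$1 - p$1) * p$2\<bar> \<le> A * dx * dx"
    proof -
      define I where "I = {min (p$1) (q$1)..max (p$1) (q$1)}"
      have I: "I \<subseteq> {t0..t1}" "p$1 \<in> I" "q$1 \<in> I" using x by (auto simp: I_def)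
      have "norm ((c p (q$1) + (q$1 - p$1) * p$2) - (c p (p$1) + (p$1 - p$1) * p$2)) \<le> A * dx * norm (q$1 - p$1)"
      proof (rule field_differentiable_bound[of I "\<lambda>t. c p t + (t - p$1) * p$2" "\<lambda>t. - Y (t, c p t) + p$2"])
        fix t assume t: "t \<in> I"
        have "(c p has_real_derivative - Y (t, c p t)) (at t within I)"
          using c(2)[OF pq(1)] t I(1) by (meson DERIV_subset subsetD)
        then show "((\<lambda>t. c p t + (t - p$1) * p$2) has_real_derivative - Y (t, c p t) + p$2) (at t within I)"
          by (auto intro!: derivative_eq_intros)
        have "\<bar>t - p$1\<bar> \<le> dx" using t by (auto simp: I_def dx_def)
        moreover have "\<bar>c p t - c p (p$1)\<bar> \<le> B * \<bar>t - p$1\<bar>" using curve[OF pq(1) x(1)] t I(1) by blast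
        moreover have "B * \<bar>t - p$1\<bar> \<le> B * dx" using \<open>\<bar>t - p$1\<bar> \<le> dx\<close> \<open>0 \<le> B\<close> by (rule mult_left_mono)
        moreover have "dist (t, c p t) (coords p) \<le> \<bar>t - p$1\<bar> + \<bar>c p t - c p (p$1)\<bar>"
          unfolding coords_def c(1)[OF pq(1)] dist_Pair_Pair dist_real_def
          using sqrt_sum_squares_le_sum[of "\<bar>t - p$1\<bar>" "\<bar>c p t - sheared_height p\<bar>"] by simp
        ultimately have "dist (t, c p t) (coords p) \<le> (1 + B) * dx" by (simp add: distrib_right)
        then have "K * dist (t, c p t) (coords p) \<le> K * ((1 + B) * dx)" using \<open>K \<ge> 0\<close> by (intro mult_left_mono)
        moreover have "\<bar>Y (t, c p t) - p$2\<bar> \<le> K * dist (t, c p t) (coords p)"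
          using lipschitz_onD[OF Y(1), of "(t, c p t)" "coords p"] YE[OF pq(1)] by (simp add: dist_real_def)
        ultimately show "norm (- Y (t, c p t) + p$2) \<le> A * dx" by (simp add: A_def ac_simps abs_minus_commute)
      qed (use I in \<open>auto simp: I_def\<close>)
      then show ?thesis by (simp add: dx_def algebra_simps)
    qed
    have dw: "\<bar>sheared_height q - sheared_height p\<bar> \<le> 2 * ds + B * dx"
      using across curve[OF pq(1) x(1) x(2)] c(1)[OF pq(1)] c(1)[OF pq(2)] by (simp add: dx_def)
    have dy: "\<bar>q$2 - p$2\<bar> \<le> A * dx + 2 * K * ds"
    proof -
      have "\<bar>q$2 - p$2\<bar> \<le> L * (\<bar>q$1 - p$1\<bar> + \<bar>sheared_height q - sheared_height p\<bar>)" by (rule lip[OF pq(2,1)])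
      also have "\<dots> \<le> K * (dx + (2 * ds + B * dx))"
        using dw \<open>0 \<le> L\<close> pos \<open>0 \<le> B\<close> unfolding dx_def[symmetric] by (intro mult_mono) (auto simp: K_def)
      finally show ?thesis by (simp add: A_def algebra_simps)
    qed
    have height: "\<bar>heis_height p q\<bar> \<le> 2 * A * dx\<^sup>2 + 3 * ds"
    proof -
      have "heis_height p q = (c q (q$1) - c p (q$1)) + (c p (q$1) - c p (p$1) + (q$1 - p$1) * p$2)
          + (q$1 - p$1) * (q$2 - p$2) / 2"
        unfolding heis_height_sheared c(1)[OF pq(1)] c(1)[OF pq(2)] by (simp add: field_simps)
      moreover have "\<bar>(q$1 - p$1) * (q$2 - p$2) / 2\<bar> \<le> dx * (A * dx + 2 * K * ds) / 2"
        using mult_left_mono[OF dy pos(1)] by (simp add: abs_mult dx_def)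
      moreover have "dx * (A * dx + 2 * K * ds) / 2 = A * dx * dx / 2 + (K * dx) * ds" by (simp add: field_simps)
      moreover have "(K * dx) * ds \<le> 1 / 4 * ds" using Kdx pos by (intro mult_right_mono)
      moreover have "0 \<le> A * dx * dx" using pos \<open>A \<ge> 0\<close> by simp
      ultimately have "\<bar>heis_height p q\<bar> \<le> 2 * (A * dx * dx) + 3 * ds" using across along pos by linarith
      then show ?thesis by (simp add: power2_eq_square)
    qed
    have "sqrt \<bar>heis_height p q\<bar> \<le> sqrt (2 * A * dx\<^sup>2 + 3 * ds)" using height by simp
    also have "\<dots> \<le> sqrt (2 * A * dx\<^sup>2) + sqrt (3 * ds)"
      using \<open>A \<ge> 0\<close> pos by (intro sqrt_add_le_add_sqrt) auto
    also have "\<dots> \<le> sqrt (2 * A) * dx + 2 * sqrt ds"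
    proof -
      have "sqrt 3 \<le> 2" by (rule real_le_lsqrt) auto
      then have "sqrt 3 * sqrt ds \<le> 2 * sqrt ds" using pos by (intro mult_right_mono) auto
      then show ?thesis using pos by (simp add: real_sqrt_mult)
    qed
    finally have s1: "sqrt \<bar>heis_height p q\<bar> \<le> sqrt (2 * A) * dx + 2 * sqrt ds" .
    have "ds \<le> M" using \<sigma>_bound[OF pq(1)] \<sigma>_bound[OF pq(2)] by (simp add: ds_def)
    then have "sqrt ds * sqrt ds \<le> sqrt M * sqrt ds" using pos by (intro mult_right_mono) auto
    then have "ds \<le> sqrt M * sqrt ds" using pos by simp
    then have "2 * K * ds \<le> 2 * K * (sqrt M * sqrt ds)" using \<open>K \<ge> 0\<close> by (intro mult_left_mono) auto
    then have "heis_gauge p q \<le> (1 + A + sqrt (2 * A)) * dx + (2 * K * sqrt M + 2) * sqrt ds"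
      unfolding heis_gauge_def using dy s1 by (simp add: dx_def[symmetric] algebra_simps)
    also have "\<dots> \<le> C * dx + C * sqrt ds"
      using \<open>A \<ge> 0\<close> \<open>K \<ge> 0\<close> \<open>M \<ge> 0\<close> pos by (intro add_mono mult_right_mono) (auto simp: C_def)
    finally show ?thesis by (simp add: dx_def ds_def distrib_left)
  qed
  with \<open>C \<ge> 0\<close> show ?thesis by (rule that)
qed

section \<open>Surface pieces transverse to a horizontal field\<close>

lemma heis_gauge_nonneg: "0 \<le> heis_gauge p q"
  by (simp add: heis_gauge_def)

lemma heis_gauge_eq_0_iff: "heis_gauge p q = 0 \<longleftrightarrow> p = q"
proof
  assume "heis_gauge p q = 0"
  then have "\<bar>q$1 - p$1\<bar> = 0 \<and> \<bar>q$2 - p$2\<bar> = 0 \<and> sqrt \<bar>heis_height p q\<bar> = 0"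
    unfolding heis_gauge_def by (simp add: add_nonneg_eq_0_iff)
  then show "p = q" by (auto simp: heis_height_def vec_eq_iff forall_3 mult.commute)
qed (simp add: heis_gauge_def heis_height_def)

text \<open>The right hand side is \<open>C\<close> times the gauge distance of \<open>(0, \<tau> p, \<sigma> p)\<close> and \<open>(0, \<tau> q, \<sigma> q)\<close>: the set
embeds into the vertical subgroup with a Lipschitz inverse.\<close>

definition straightenable :: "(real^3) set \<Rightarrow> bool" where
  "straightenable E \<longleftrightarrow> (\<exists>\<tau> \<sigma> C. 0 \<le> C \<and>
     (\<forall>p\<in>E. \<forall>q\<in>E. heis_gauge p q \<le> C * (\<bar>\<tau> q - \<tau> p\<bar> + sqrt \<bar>\<sigma> q - \<sigma> p\<bar>)))"

lemma straightenable_subset: "straightenable E \<Longrightarrow> D \<subseteq> E \<Longrightarrow> straightenable D"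
  unfolding straightenable_def by (meson subsetD)

lemma countably_rectifiable_straightenable:
  assumes "straightenable E"
  shows "countably_rectifiable vertical_subgroup d_cc d_cc k E"
proof -
  obtain \<tau> \<sigma> C where "0 \<le> C"
    and C: "\<And>p q. \<lbrakk>p \<in> E; q \<in> E\<rbrakk> \<Longrightarrow> heis_gauge p q \<le> C * (\<bar>\<tau> q - \<tau> p\<bar> + sqrt \<bar>\<sigma> q - \<sigma> p\<bar>)"
    using assms unfolding straightenable_def by blast
  define \<phi> where "\<phi> p = (vector [0, \<tau> p, \<sigma> p] :: real^3)" for p
  have gauge: "heis_gauge (\<phi> p) (\<phi> q) = \<bar>\<tau> q - \<tau> p\<bar> + sqrt \<bar>\<sigma> q - \<sigma> p\<bar>" for p q
    by (simp add: heis_gauge_def heis_height_def \<phi>_def)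
  have "inj_on \<phi> E"
  proof (rule inj_onI)
    fix p q assume "p \<in> E" "q \<in> E" "\<phi> p = \<phi> q"
    then have "heis_gauge p q \<le> 0"
      using C[of p q] gauge[of p q] heis_gauge_eq_0_iff[of "\<phi> p" "\<phi> q"] by simp
    then show "p = q" using heis_gauge_nonneg[of p q] heis_gauge_eq_0_iff by simp
  qed
  define f where "f = inv_into E \<phi>"
  have f: "f (\<phi> p) = p" if "p \<in> E" for p
    unfolding f_def by (rule inv_into_f_f[OF \<open>inj_on \<phi> E\<close> that])
  show ?thesis
  proof (rule countably_rectifiable_lipschitz_image)
    show "\<phi> ` E \<subseteq> vertical_subgroup" by (auto simp: \<phi>_def vertical_subgroup_def)
    show "E \<subseteq> f ` \<phi> ` E" using f by force
    show "lipschitz_between d_cc d_cc (\<phi> ` E) f"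
      unfolding lipschitz_between_def
    proof (intro exI ballI)
      fix u v assume "u \<in> \<phi> ` E" "v \<in> \<phi> ` E"
      then obtain p q where pq: "p \<in> E" "q \<in> E" "u = \<phi> p" "v = \<phi> q" by blast
      have "d_cc p q \<le> 700 * heis_gauge p q" by (rule d_cc_le_heis_gauge)
      also have "\<dots> \<le> 700 * (C * heis_gauge u v)" using C[OF pq(1,2)] gauge pq(3,4) by simp
      also have "\<dots> \<le> 700 * (C * (3 * d_cc u v))"
        using heis_gauge_le_d_cc[of u v] \<open>0 \<le> C\<close> by (intro mult_left_mono) auto
      finally show "d_cc (f u) (f v) \<le> 2100 * C * d_cc u v" using f pq by simp
    qed
  qed
qed

lemma gradient_mean_value:
  fixes F :: "'a::euclidean_space \<Rightarrow> real"
  assumes F: "\<And>x. x \<in> V \<Longrightarrow> (F has_derivative (\<lambda>h. G x \<bullet> h)) (at x)"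
    and V: "convex V" "p \<in> V" "q \<in> V"
  obtains \<xi> where "\<xi> \<in> closed_segment p q" "\<xi> \<in> V" "F q - F p = G \<xi> \<bullet> (q - p)"
proof -
  have seg: "p + t *\<^sub>R (q - p) \<in> closed_segment p q" "p + t *\<^sub>R (q - p) \<in> V" if "t \<in> {0..1}" for t
  proof -
    have "p + t *\<^sub>R (q - p) = (1 - t) *\<^sub>R p + t *\<^sub>R q" by (simp add: algebra_simps)
    then show "p + t *\<^sub>R (q - p) \<in> closed_segment p q" using that by (auto simp: in_segment)
    then show "p + t *\<^sub>R (q - p) \<in> V" using closed_segment_subset[OF V(2,3,1)] by blast
  qed
  have "\<exists>t\<in>{0<..<1}. F (p + 1 *\<^sub>R (q - p)) - F (p + 0 *\<^sub>R (q - p)) = (\<lambda>s. G (p + t *\<^sub>R (q - p)) \<bullet> (s *\<^sub>R (q - p))) (1 - 0)"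
  proof (rule mvt_simple)
    fix t :: real assume t: "0 \<le> t" "t \<le> 1"
    have d: "((\<lambda>t. p + t *\<^sub>R (q - p)) has_derivative (\<lambda>s. s *\<^sub>R (q - p))) (at t within {0..1})"
      by (auto intro!: derivative_eq_intros)
    then show "((\<lambda>t. F (p + t *\<^sub>R (q - p))) has_derivative (\<lambda>s. G (p + t *\<^sub>R (q - p)) \<bullet> (s *\<^sub>R (q - p)))) (at t within {0..1})"
      using has_derivative_compose[where f = "\<lambda>t. p + t *\<^sub>R (q - p)" and g = F, OF d F[OF seg(2)]] t by simp
  qed simp
  then obtain t where "t \<in> {0<..<1}" "F q - F p = G (p + t *\<^sub>R (q - p)) \<bullet> (q - p)" by auto
  then show ?thesis using that seg[of t] by auto
qed

lemma inner_3: "(u::real^3) \<bullet> v = u$1 * v$1 + u$2 * v$2 + u$3 * v$3"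
  by (simp add: inner_vec_def sum_3)

text \<open>The number \<open>G p0 $ 2 + p0$1 / 2 * G p0 $ 3\<close> is the derivative of \<open>F\<close> along \<open>Y\<close>.  For two zeros \<open>p\<close> and
\<open>q\<close> of \<open>F\<close> the mean value theorem expresses \<open>0 = F q - F p\<close> as a combination of \<open>\<Delta>x\<close>, \<open>\<Delta>y\<close> and
\<open>\<Delta>w\<close> in which the coefficient of \<open>\<Delta>y\<close> is close to this number.  Hence \<open>\<Delta>y\<close> is bounded by
\<open>\<Delta>x\<close> and \<open>\<Delta>w\<close>, which is the graph property.\<close>

lemma straightenable_Y_transverse:
  fixes F :: "real^3 \<Rightarrow> real" and G :: "real^3 \<Rightarrow> real^3"
  assumes W: "open W" "p0 \<in> W" and F: "\<And>x. x \<in> W \<Longrightarrow> (F has_derivative (\<lambda>h. G x \<bullet> h)) (at x)"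
    and G: "continuous_on W G" and transverse: "G p0 $ 2 + p0$1 / 2 * G p0 $ 3 \<noteq> 0"
  shows "\<exists>V. open V \<and> p0 \<in> V \<and> straightenable ({x\<in>W. F x = 0} \<inter> V)"
proof -
  \<comment> \<open>The mean value theorem evaluates the gradient at \<open>\<xi>\<close> but the coefficient \<open>x / 2\<close> at \<open>p\<close>.\<close>
  define H where "H \<xi> p = G \<xi> $ 2 + p$1 / 2 * G \<xi> $ 3" for \<xi> p :: "real^3"
  define c where "c = \<bar>H p0 p0\<bar> / 2"
  have "c > 0" "c < \<bar>H p0 p0\<bar>" using transverse by (auto simp: c_def H_def)
  have contG: "continuous_on (W \<times> W) (\<lambda>u. G (fst u))"
    by (rule continuous_on_compose2[OF G]) (auto intro: continuous_intros)
  have "continuous_on (W \<times> W) (\<lambda>u. \<bar>H (fst u) (snd u)\<bar>)"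
    unfolding H_def by (intro continuous_intros contG) auto
  then have "open ((W \<times> W) \<inter> (\<lambda>u. \<bar>H (fst u) (snd u)\<bar>) -` {c<..})"
    by (rule continuous_open_preimage) (use W(1) in \<open>auto intro: open_Times\<close>)
  moreover have "(p0, p0) \<in> (W \<times> W) \<inter> (\<lambda>u. \<bar>H (fst u) (snd u)\<bar>) -` {c<..}"
    using W(2) \<open>c < _\<close> by simp
  ultimately obtain A B where AB: "open A" "open B" "(p0, p0) \<in> A \<times> B"
      "A \<times> B \<subseteq> (W \<times> W) \<inter> (\<lambda>u. \<bar>H (fst u) (snd u)\<bar>) -` {c<..}"
    by (rule open_prod_elim) (rule that)
  define M where "M = norm (G p0) + norm p0 + 1"
  define D where "D = A \<inter> B \<inter> (W \<inter> (\<lambda>x. norm (G x)) -` {..<M})"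
  have "open (W \<inter> (\<lambda>x. norm (G x)) -` {..<M})"
    using W(1) G by (intro continuous_open_preimage continuous_intros) auto
  then have "open D" using AB(1,2) by (auto simp: D_def)
  moreover have "p0 \<in> D"
    using W(2) AB(3) by (simp add: D_def M_def add_nonneg_pos)
  ultimately obtain r where r: "r > 0" "ball p0 r \<subseteq> D"
    using openE by blast
  have "M \<ge> 1" by (simp add: M_def)
  define L where "L = 2 * M\<^sup>2 / c"
  have "L > 0" using \<open>c > 0\<close> \<open>M \<ge> 1\<close> by (simp add: L_def)
  \<comment> \<open>The last bound makes the range \<open>2 \<rho>\<close> of \<open>x\<close> short enough for \<open>2 * L * (2 * \<rho>) \<le> 1 / 4\<close>.\<close>
  define \<rho> where "\<rho> = min (min r 1) (1 / (16 * L))"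
  have \<rho>: "\<rho> > 0" "\<rho> \<le> r" "\<rho> \<le> 1" "\<rho> \<le> 1 / (16 * L)" using r(1) \<open>L > 0\<close> by (auto simp: \<rho>_def)
  have coord: "\<bar>p$i\<bar> \<le> M" "\<bar>p$i - p0$i\<bar> \<le> \<rho>" if "p \<in> ball p0 \<rho>" for p i
  proof -
    have "norm (p - p0) < \<rho>" using that by (simp add: dist_norm norm_minus_commute)
    moreover have "norm p \<le> norm p0 + norm (p - p0)" by (metis norm_triangle_sub)
    moreover have "\<bar>(p - p0)$i\<bar> \<le> norm (p - p0)" "\<bar>p$i\<bar> \<le> norm p" by (rule component_le_norm_cart)+
    moreover have "0 \<le> norm (G p0)" by simp
    ultimately have "\<bar>p$i\<bar> \<le> M \<and> \<bar>(p - p0)$i\<bar> \<le> \<rho>" using \<rho>(3) unfolding M_def by linarith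
    then show "\<bar>p$i\<bar> \<le> M" "\<bar>p$i - p0$i\<bar> \<le> \<rho>" by auto
  qed
  define E where "E = {x\<in>W. F x = 0} \<inter> ball p0 \<rho>"
  have sub: "ball p0 \<rho> \<subseteq> ball p0 r" using \<rho>(2) by (rule subset_ball)
  have lip: "\<bar>p$2 - q$2\<bar> \<le> L * (\<bar>p$1 - q$1\<bar> + \<bar>sheared_height p - sheared_height q\<bar>)"
    if pq: "p \<in> E" "q \<in> E" for p q
  proof -
    have b: "p \<in> ball p0 \<rho>" "q \<in> ball p0 \<rho>" using pq by (auto simp: E_def)
    obtain \<xi> where \<xi>: "\<xi> \<in> ball p0 \<rho>" "F q - F p = G \<xi> \<bullet> (q - p)"
    proof (rule gradient_mean_value[of "ball p0 \<rho>" F G p q])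
      show "(F has_derivative (\<lambda>h. G x \<bullet> h)) (at x)" if "x \<in> ball p0 \<rho>" for x
        using F that sub r(2) unfolding D_def by blast
    qed (use b that in auto)
    define dx dy dw where "dx = q$1 - p$1" and "dy = q$2 - p$2" and "dw = sheared_height q - sheared_height p"
    have "G \<xi> \<bullet> (q - p) = 0" using \<xi>(2) pq by (simp add: E_def)
    moreover have "G \<xi> \<bullet> (q - p) = H \<xi> p * dy + ((G \<xi> $ 1 + q$2 / 2 * G \<xi> $ 3) * dx + G \<xi> $ 3 * dw)"
      by (simp add: inner_3 H_def dx_def dy_def dw_def sheared_height_def field_simps)
    ultimately have eq: "H \<xi> p * dy = - ((G \<xi> $ 1 + q$2 / 2 * G \<xi> $ 3) * dx + G \<xi> $ 3 * dw)" by linarith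
    have "\<xi> \<in> ball p0 r" "p \<in> ball p0 r" using \<xi>(1) b sub by auto
    then have "(\<xi>, p) \<in> A \<times> B" and "norm (G \<xi>) < M" using r(2) unfolding D_def by auto
    then have "c < \<bar>H \<xi> p\<bar>" using AB(4) by auto
    have Gb: "\<bar>G \<xi> $ i\<bar> \<le> M" for i using component_le_norm_cart[of "G \<xi>" i] \<open>norm (G \<xi>) < M\<close> by linarith
    have "\<bar>q$2\<bar> * \<bar>G \<xi> $ 3\<bar> \<le> M * M"
      using coord(1)[OF b(2), of 2] Gb[of 3] \<open>M \<ge> 1\<close> by (intro mult_mono) auto
    moreover have "\<bar>q$2 / 2 * G \<xi> $ 3\<bar> = \<bar>q$2\<bar> * \<bar>G \<xi> $ 3\<bar> / 2" by (simp add: abs_mult)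
    moreover have "0 \<le> M * M" by simp
    ultimately have "\<bar>q$2 / 2 * G \<xi> $ 3\<bar> \<le> M * M" by linarith
    moreover have "M \<le> M * M" using \<open>M \<ge> 1\<close> by simp
    ultimately have b13: "\<bar>G \<xi> $ 1 + q$2 / 2 * G \<xi> $ 3\<bar> \<le> 2 * M\<^sup>2 \<and> \<bar>G \<xi> $ 3\<bar> \<le> 2 * M\<^sup>2"
      using Gb[of 1] Gb[of 3] abs_triangle_ineq[of "G \<xi> $ 1" "q$2 / 2 * G \<xi> $ 3"] \<open>0 \<le> M * M\<close>
      unfolding power2_eq_square by linarith
    have "c * \<bar>dy\<bar> \<le> \<bar>H \<xi> p * dy\<bar>" using \<open>c < \<bar>H \<xi> p\<bar>\<close> by (simp add: abs_mult mult_right_mono)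
    also have "\<dots> \<le> \<bar>(G \<xi> $ 1 + q$2 / 2 * G \<xi> $ 3) * dx\<bar> + \<bar>G \<xi> $ 3 * dw\<bar>" unfolding eq by linarith
    also have "\<dots> \<le> 2 * M\<^sup>2 * \<bar>dx\<bar> + 2 * M\<^sup>2 * \<bar>dw\<bar>"
      unfolding abs_mult using b13 by (intro add_mono mult_right_mono) auto
    finally have "\<bar>dy\<bar> \<le> L * (\<bar>dx\<bar> + \<bar>dw\<bar>)" using \<open>c > 0\<close> by (simp add: L_def field_simps)
    then show ?thesis by (simp add: dx_def dy_def dw_def abs_minus_commute)
  qed
  have box: "p$1 \<in> {p0$1 - \<rho>..p0$1 + \<rho>} \<and> \<bar>p$2\<bar> \<le> 2 * M\<^sup>2 \<and> \<bar>sheared_height p\<bar> \<le> 2 * M\<^sup>2" if "p \<in> E" for p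
  proof -
    have b: "p \<in> ball p0 \<rho>" using that by (simp add: E_def)
    have "M \<le> M\<^sup>2" using \<open>M \<ge> 1\<close> by (simp add: power2_eq_square)
    moreover have "\<bar>p$1 * p$2\<bar> \<le> M\<^sup>2"
      using mult_mono[OF coord(1)[OF b, of 1] coord(1)[OF b, of 2]] \<open>M \<ge> 1\<close> by (simp add: abs_mult power2_eq_square)
    ultimately show ?thesis
      using coord(1)[OF b, of 2] coord(1)[OF b, of 3] coord(2)[OF b, of 1] \<open>M \<ge> 1\<close>
      by (auto simp: sheared_height_def abs_le_iff)
  qed
  have "2 * L * ((p0$1 + \<rho>) - (p0$1 - \<rho>)) \<le> 1 / 4" using \<rho>(4) \<open>L > 0\<close> by (simp add: field_simps)
  note small = this
  obtain \<sigma> C where "0 \<le> C" "\<And>p q. \<lbrakk>p \<in> E; q \<in> E\<rbrakk> \<Longrightarrow> heis_gauge p q \<le> C * (\<bar>q$1 - p$1\<bar> + sqrt \<bar>\<sigma> q - \<sigma> p\<bar>)"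
  proof (rule intrinsic_graph_coordinates[of E L "p0$1 - \<rho>" "p0$1 + \<rho>" "2 * M\<^sup>2"])
    show "\<bar>p$2 - q$2\<bar> \<le> L * (\<bar>p$1 - q$1\<bar> + \<bar>sheared_height p - sheared_height q\<bar>)" if "p \<in> E" "q \<in> E" for p q
      using lip that .
    show "p$1 \<in> {p0$1 - \<rho>..p0$1 + \<rho>} \<and> \<bar>p$2\<bar> \<le> 2 * M\<^sup>2 \<and> \<bar>sheared_height p\<bar> \<le> 2 * M\<^sup>2" if "p \<in> E" for p
      using box that .
  qed (use small \<open>L > 0\<close> \<rho>(1) that in auto)
  then have "straightenable E" unfolding straightenable_def by (intro exI[of _ "\<lambda>p. p$1"] exI[of _ \<sigma>] exI[of _ C]) auto
  then show ?thesis using \<rho>(1) by (intro exI[of _ "ball p0 \<rho>"]) (simp add: E_def)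
qed

text \<open>The rotation by a right angle about the vertical axis.  It is an automorphism of the Heisenberg group
that takes \<open>X\<close> to \<open>- Y\<close> and \<open>Y\<close> to \<open>X\<close>.\<close>

definition quarter_turn :: "real^3 \<Rightarrow> real^3" where
  "quarter_turn p = vector [p$2, - (p$1), p$3]"

lemma quarter_turn_nth [simp]:
  "quarter_turn p $ 1 = p$2" "quarter_turn p $ 2 = - (p$1)" "quarter_turn p $ 3 = p$3"
  by (simp_all add: quarter_turn_def)

lemma heis_gauge_quarter_turn: "heis_gauge (quarter_turn p) (quarter_turn q) = heis_gauge p q"
  by (simp add: heis_gauge_def heis_height_def algebra_simps)

text \<open>The rotated surface is the zero set of \<open>F\<close> composed with the inverse rotation \<open>R\<close>, whose derivative
along \<open>Y\<close> is, up to sign, that of \<open>F\<close> along \<open>X\<close>; the rotation preserves the gauge.\<close>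

lemma straightenable_X_transverse:
  fixes F :: "real^3 \<Rightarrow> real" and G :: "real^3 \<Rightarrow> real^3"
  assumes W: "open W" "p0 \<in> W" and F: "\<And>x. x \<in> W \<Longrightarrow> (F has_derivative (\<lambda>h. G x \<bullet> h)) (at x)"
    and G: "continuous_on W G" and transverse: "G p0 $ 1 - p0$2 / 2 * G p0 $ 3 \<noteq> 0"
  shows "\<exists>V. open V \<and> p0 \<in> V \<and> straightenable ({x\<in>W. F x = 0} \<inter> V)"
proof -
  define R where "R p = (vector [- (p$2), p$1, p$3] :: real^3)" for p :: "real^3"
  have R_nth [simp]: "R p $ 1 = - (p$2)" "R p $ 2 = p$1" "R p $ 3 = p$3" for p by (simp_all add: R_def)
  have RQ [simp]: "R (quarter_turn p) = p" "quarter_turn (R p) = p" for p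
    by (simp_all add: vec_eq_iff forall_3)
  have linR: "bounded_linear R"
    unfolding linear_conv_bounded_linear[symmetric] by (rule linearI) (simp_all add: vec_eq_iff forall_3)
  have linQ: "bounded_linear quarter_turn"
    unfolding linear_conv_bounded_linear[symmetric] by (rule linearI) (simp_all add: vec_eq_iff forall_3)
  have contR: "continuous_on S R" and contQ: "continuous_on S quarter_turn" for S
    using linR linQ by (auto intro: linear_continuous_on)
  have "\<exists>V'. open V' \<and> quarter_turn p0 \<in> V' \<and> straightenable ({x\<in>R -` W. F (R x) = 0} \<inter> V')"
  proof (rule straightenable_Y_transverse[of "R -` W" "quarter_turn p0" "\<lambda>u. F (R u)" "\<lambda>u. quarter_turn (G (R u))"])
    show "open (R -` W)" using W(1) contR open_vimage by blast
    show "quarter_turn p0 \<in> R -` W" using W(2) by simp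
    fix x assume x: "x \<in> R -` W"
    have "((\<lambda>u. F (R u)) has_derivative (\<lambda>h. G (R x) \<bullet> R h)) (at x)"
      using has_derivative_compose[OF bounded_linear_imp_has_derivative[OF linR] F] x by auto
    moreover have "G (R x) \<bullet> R h = quarter_turn (G (R x)) \<bullet> h" for h by (simp add: inner_3)
    ultimately show "((\<lambda>u. F (R u)) has_derivative (\<lambda>h. quarter_turn (G (R x)) \<bullet> h)) (at x)" by simp
  next
    have "continuous_on (R -` W) (\<lambda>u. G (R u))"
      by (rule continuous_on_compose2[OF G contR]) auto
    then show "continuous_on (R -` W) (\<lambda>u. quarter_turn (G (R u)))"
      by (rule continuous_on_compose2[OF contQ]) auto
    show "quarter_turn (G (R (quarter_turn p0))) $ 2 + quarter_turn p0 $ 1 / 2 * quarter_turn (G (R (quarter_turn p0))) $ 3 \<noteq> 0"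
      using transverse by simp
  qed
  then obtain V' where V': "open V'" "quarter_turn p0 \<in> V'" "straightenable ({x\<in>R -` W. F (R x) = 0} \<inter> V')"
    by blast
  obtain \<tau> \<sigma> C where C: "0 \<le> C" "\<And>p q. \<lbrakk>p \<in> {x\<in>R -` W. F (R x) = 0} \<inter> V'; q \<in> {x\<in>R -` W. F (R x) = 0} \<inter> V'\<rbrakk> \<Longrightarrow>
      heis_gauge p q \<le> C * (\<bar>\<tau> q - \<tau> p\<bar> + sqrt \<bar>\<sigma> q - \<sigma> p\<bar>)"
    using V'(3) unfolding straightenable_def by blast
  have "straightenable ({x\<in>W. F x = 0} \<inter> quarter_turn -` V')"
    unfolding straightenable_def
  proof (intro exI conjI ballI)
    fix p q assume "p \<in> {x\<in>W. F x = 0} \<inter> quarter_turn -` V'" "q \<in> {x\<in>W. F x = 0} \<inter> quarter_turn -` V'"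
    then show "heis_gauge p q \<le> C * (\<bar>\<tau> (quarter_turn q) - \<tau> (quarter_turn p)\<bar> + sqrt \<bar>\<sigma> (quarter_turn q) - \<sigma> (quarter_turn p)\<bar>)"
      using C(2)[of "quarter_turn p" "quarter_turn q"] by (simp add: heis_gauge_quarter_turn)
  qed (rule C(1))
  moreover have "open (quarter_turn -` V')" using V'(1) contQ open_vimage by blast
  ultimately show ?thesis using V'(2) by blast
qed

section \<open>Characteristic points\<close>

text \<open>The heights over \<open>b\<close> are third coordinates after a left translation; the correction term is the area of
the triangle spanned by the horizontal displacements.\<close>

lemma heis_height_change_base:
  "heis_height q q' = heis_height b q' - heis_height b q
     - ((q$1 - b$1) * (q'$2 - b$2) - (q$2 - b$2) * (q'$1 - b$1)) / 2"
  by (simp add: heis_height_def field_simps)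

lemma floor_eq_imp_close:
  fixes a b \<rho> :: real
  assumes "\<lfloor>a / \<rho>\<rfloor> = \<lfloor>b / \<rho>\<rfloor>" "\<rho> > 0"
  shows "\<bar>a - b\<bar> \<le> \<rho>"
proof -
  have "\<bar>a / \<rho> - b / \<rho>\<bar> < 1" using assms(1) by linarith
  then show ?thesis using assms(2) by (simp add: diff_divide_distrib[symmetric] divide_less_eq)
qed

lemma floor_in_range:
  fixes a R \<rho> :: real
  assumes "\<bar>a\<bar> \<le> R" "\<rho> > 0"
  shows "\<lfloor>a / \<rho>\<rfloor> \<in> {- \<lceil>R / \<rho>\<rceil>..\<lceil>R / \<rho>\<rceil>}"
proof -
  have "- (R / \<rho>) \<le> a / \<rho>" "a / \<rho> \<le> R / \<rho>"
    using assms by (auto simp: abs_le_iff divide_right_mono minus_divide_left[symmetric] pos_le_divide_eq)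
  then show ?thesis by (simp add: le_floor_iff floor_le_iff) linarith
qed

lemma card_symmetric_range:
  assumes "0 \<le> R"
  shows "real (card {- \<lceil>R\<rceil>..\<lceil>R\<rceil>}) \<le> 2 * R + 3"
  using assms by simp linarith

text \<open>Divide the \<open>x, y\<close> plane into squares of side \<open>\<rho>\<close>.  Over one square the set rises above the horizontal
plane of any of its points by at most \<open>2 e \<rho>\<close>, so \<open>4 e / \<rho> + 3\<close> slices of height \<open>\<rho>\<^sup>2\<close> suffice.  Each
slice has diameter of order \<open>\<rho>\<close>, and there are at most \<open>((2 R + 3) / \<rho>)\<^sup>2\<close> squares.  The sum of the
cubes of the diameters is of order \<open>e + \<rho>\<close>.\<close>

lemma hausdorff_measure_first_order_horizontal:
  fixes A :: "(real^3) set"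
  assumes bounded: "\<And>p. p \<in> A \<Longrightarrow> \<bar>p$1\<bar> \<le> R \<and> \<bar>p$2\<bar> \<le> R" "0 \<le> R"
    and flat: "\<And>\<epsilon>. \<epsilon> > 0 \<Longrightarrow> \<exists>\<rho>>0. \<forall>p\<in>A. \<forall>q\<in>A. \<bar>q$1 - p$1\<bar> \<le> \<rho> \<and> \<bar>q$2 - p$2\<bar> \<le> \<rho> \<longrightarrow>
      \<bar>heis_height p q\<bar> \<le> \<epsilon> * (\<bar>q$1 - p$1\<bar> + \<bar>q$2 - p$2\<bar>)"
  shows "hausdorff_measure d_cc 3 A = 0"
proof (rule hausdorff_measure_eq_0_finite_covers[where 'i = "int \<times> int \<times> int"])
  fix \<delta> \<epsilon> :: real assume "\<delta> > 0" "\<epsilon> > 0"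
  define K where "K = (2 * R + 3)\<^sup>2 * 2800 ^ 3"
  have "K > 0" using \<open>0 \<le> R\<close> by (simp add: K_def)
  define e where "e = \<epsilon> / (16 * K)"
  have "e > 0" using \<open>\<epsilon> > 0\<close> \<open>K > 0\<close> by (simp add: e_def)
  obtain \<rho>0 where "\<rho>0 > 0" and \<rho>0: "\<And>p q. \<lbrakk>p \<in> A; q \<in> A; \<bar>q$1 - p$1\<bar> \<le> \<rho>0; \<bar>q$2 - p$2\<bar> \<le> \<rho>0\<rbrakk> \<Longrightarrow>
      \<bar>heis_height p q\<bar> \<le> e * (\<bar>q$1 - p$1\<bar> + \<bar>q$2 - p$2\<bar>)"
    using flat[OF \<open>e > 0\<close>] by blast
  define \<rho> where "\<rho> = min (min \<rho>0 1) (min (\<delta> / 2800) (\<epsilon> / (16 * K)))"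
  have \<rho>: "\<rho> > 0" "\<rho> \<le> \<rho>0" "\<rho> \<le> 1" "\<rho> \<le> \<delta> / 2800" "\<rho> \<le> \<epsilon> / (16 * K)"
    using \<open>\<rho>0 > 0\<close> \<open>\<delta> > 0\<close> \<open>\<epsilon> > 0\<close> \<open>K > 0\<close> by (auto simp: \<rho>_def)
  define cell where "cell i j = {p\<in>A. \<lfloor>p$1 / \<rho>\<rfloor> = i \<and> \<lfloor>p$2 / \<rho>\<rfloor> = j}" for i j
  \<comment> \<open>The slices over a square are taken parallel to the horizontal plane at one of its points.\<close>
  define base where "base i j = (SOME p. p \<in> cell i j)" for i j
  have base: "base i j \<in> cell i j" if "p \<in> cell i j" for i j p
    unfolding base_def using that by (rule someI)
  have in_cell: "\<bar>q$1 - p$1\<bar> \<le> \<rho>" "\<bar>q$2 - p$2\<bar> \<le> \<rho>" if "p \<in> cell i j" "q \<in> cell i j" for p q i j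
    using that \<rho>(1) by (auto simp: cell_def intro!: floor_eq_imp_close)
  define C where "C = (\<lambda>(i, j, k). {p\<in>cell i j. \<lfloor>heis_height (base i j) p / \<rho>\<^sup>2\<rfloor> = k})"
  define N where "N = {- \<lceil>R / \<rho>\<rceil>..\<lceil>R / \<rho>\<rceil>}"
  define J where "J = {- \<lceil>2 * e / \<rho>\<rceil>..\<lceil>2 * e / \<rho>\<rceil>}"
  show "\<exists>(I :: (int \<times> int \<times> int) set) C r. finite I \<and> A \<subseteq> (\<Union>i\<in>I. C i) \<and> 0 \<le> r \<and> r \<le> \<delta> \<and>
      (\<forall>i\<in>I. \<forall>x\<in>C i. \<forall>y\<in>C i. d_cc x y \<le> r) \<and> real (card I) * r ^ 3 < \<epsilon>"
  proof (intro exI conjI ballI)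
    show "finite (N \<times> N \<times> J)" by (simp add: N_def J_def)
    show "0 \<le> 2800 * \<rho>" "2800 * \<rho> \<le> \<delta>" using \<rho> by auto
    show "A \<subseteq> (\<Union>u\<in>N \<times> N \<times> J. C u)"
    proof
      fix p assume p: "p \<in> A"
      define i j where "i = \<lfloor>p$1 / \<rho>\<rfloor>" and "j = \<lfloor>p$2 / \<rho>\<rfloor>"
      have pc: "p \<in> cell i j" using p by (simp add: cell_def i_def j_def)
      note b = base[OF pc]
      have "\<bar>heis_height (base i j) p\<bar> \<le> e * (\<bar>p$1 - base i j $ 1\<bar> + \<bar>p$2 - base i j $ 2\<bar>)"
        using in_cell[OF b pc] \<rho>(2) b p by (intro \<rho>0) (auto simp: cell_def)
      also have "\<dots> \<le> e * (\<rho> + \<rho>)"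
        using in_cell[OF b pc] \<open>e > 0\<close> by (intro mult_left_mono add_mono) auto
      finally have "\<bar>heis_height (base i j) p\<bar> \<le> 2 * e * \<rho>" by simp
      from floor_in_range[OF this, of "\<rho>\<^sup>2"] have "\<lfloor>heis_height (base i j) p / \<rho>\<^sup>2\<rfloor> \<in> J"
        using \<rho>(1) by (simp add: J_def power2_eq_square)
      moreover have "i \<in> N" "j \<in> N"
        using floor_in_range[OF conjunct1[OF bounded(1)[OF p]] \<rho>(1)] floor_in_range[OF conjunct2[OF bounded(1)[OF p]] \<rho>(1)]
        unfolding i_def j_def N_def by auto
      moreover have "p \<in> C (i, j, \<lfloor>heis_height (base i j) p / \<rho>\<^sup>2\<rfloor>)" using pc by (simp add: C_def)
      ultimately show "p \<in> (\<Union>u\<in>N \<times> N \<times> J. C u)" by blast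
    qed
    fix u q q' assume "u \<in> N \<times> N \<times> J" "q \<in> C u" "q' \<in> C u"
    then obtain i j k where q: "q \<in> cell i j" "q' \<in> cell i j"
      "\<lfloor>heis_height (base i j) q' / \<rho>\<^sup>2\<rfloor> = \<lfloor>heis_height (base i j) q / \<rho>\<^sup>2\<rfloor>"
      by (auto simp: C_def)
    define b where "b = base i j"
    note bq = in_cell[OF base[OF q(1)] q(1), folded b_def] and bq' = in_cell[OF base[OF q(1)] q(2), folded b_def]
    have tri: "\<bar>h - (P - Q) / 2\<bar> \<le> 2 * s" if hPQ: "\<bar>h\<bar> \<le> s" "\<bar>P\<bar> \<le> s" "\<bar>Q\<bar> \<le> s" for h P Q s :: real
      using hPQ unfolding diff_divide_distrib by linarith
    have prods: "\<bar>(q$1 - b$1) * (q'$2 - b$2)\<bar> \<le> \<rho>\<^sup>2" "\<bar>(q$2 - b$2) * (q'$1 - b$1)\<bar> \<le> \<rho>\<^sup>2"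
      unfolding abs_mult power2_eq_square using bq bq' \<rho>(1) by (auto intro!: mult_mono)
    moreover have "\<bar>heis_height b q' - heis_height b q\<bar> \<le> \<rho>\<^sup>2"
      using floor_eq_imp_close[OF q(3)] \<rho>(1) by (simp add: b_def)
    ultimately have "\<bar>heis_height q q'\<bar> \<le> 2 * \<rho>\<^sup>2"
      unfolding heis_height_change_base[of q q' b] using prods by (intro tri)
    then have "\<bar>heis_height q q'\<bar> \<le> (2 * \<rho>)\<^sup>2" by (simp add: power_mult_distrib)
    then have "sqrt \<bar>heis_height q q'\<bar> \<le> 2 * \<rho>" using \<rho>(1) by (intro real_le_lsqrt) auto
    then have "heis_gauge q q' \<le> 4 * \<rho>" using in_cell[OF q(1,2)] by (simp add: heis_gauge_def)
    then show "d_cc q q' \<le> 2800 * \<rho>" using d_cc_le_heis_gauge[of q q'] by linarith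
  next
    have N: "real (card N) \<le> (2 * R + 3) / \<rho>"
    proof -
      have "real (card N) \<le> 2 * (R / \<rho>) + 3"
        unfolding N_def using \<open>0 \<le> R\<close> \<rho>(1) by (intro card_symmetric_range) simp
      also have "\<dots> \<le> (2 * R + 3) / \<rho>" using \<rho>(1,3) by (simp add: add_divide_distrib pos_le_divide_eq)
      finally show ?thesis .
    qed
    have J: "real (card J) \<le> (4 * e + 3 * \<rho>) / \<rho>"
    proof -
      have "real (card J) \<le> 2 * (2 * e / \<rho>) + 3"
        unfolding J_def using \<open>e > 0\<close> \<rho>(1) by (intro card_symmetric_range) simp
      then show ?thesis using \<rho>(1) by (simp add: add_divide_distrib)
    qed
    have "real (card (N \<times> N \<times> J)) = real (card N) * (real (card N) * real (card J))"
      by (simp add: card_cartesian_product)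
    also have "\<dots> \<le> (2 * R + 3) / \<rho> * ((2 * R + 3) / \<rho> * ((4 * e + 3 * \<rho>) / \<rho>))"
      using N J \<open>0 \<le> R\<close> \<open>e > 0\<close> \<rho>(1) by (intro mult_mono) auto
    finally have "real (card (N \<times> N \<times> J)) * (2800 * \<rho>) ^ 3
        \<le> (2 * R + 3) / \<rho> * ((2 * R + 3) / \<rho> * ((4 * e + 3 * \<rho>) / \<rho>)) * (2800 * \<rho>) ^ 3"
      using \<rho>(1) by (intro mult_right_mono) auto
    also have "\<dots> = K * (4 * e + 3 * \<rho>)"
      using \<rho>(1) by (simp add: K_def power2_eq_square power3_eq_cube field_simps)
    also have "\<dots> \<le> K * (7 * (\<epsilon> / (16 * K)))"
      using \<rho>(5) \<open>K > 0\<close> by (intro mult_left_mono) (auto simp: e_def)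
    also have "\<dots> < \<epsilon>" using \<open>K > 0\<close> \<open>\<epsilon> > 0\<close> by simp
    finally show "real (card (N \<times> N \<times> J)) * (2800 * \<rho>) ^ 3 < \<epsilon>" .
  qed
qed

text \<open>At a characteristic point \<open>p\<close> the slopes \<open>- a p\<close> and \<open>- b p\<close> of the tangent plane are those of the
horizontal plane.  The mean value theorem writes the height of \<open>q\<close> over \<open>p\<close> as
\<open>- (a \<xi> - a p) \<Delta>x - (b \<xi> - b p) \<Delta>y\<close>, and uniform continuity of \<open>a\<close> and \<open>b\<close> makes this \<open>o(\<rho>)\<close> uniformly
in \<open>p\<close>.\<close>

lemma hausdorff_measure_characteristic_points:
  fixes F :: "real^3 \<Rightarrow> real" and G :: "real^3 \<Rightarrow> real^3"
  assumes W: "open W" "p0 \<in> W" and F: "\<And>x. x \<in> W \<Longrightarrow> (F has_derivative (\<lambda>h. G x \<bullet> h)) (at x)"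
    and G: "continuous_on W G" and G3: "G p0 $ 3 \<noteq> 0"
  shows "\<exists>V. open V \<and> p0 \<in> V \<and>
    hausdorff_measure d_cc 3 ({x\<in>W. F x = 0 \<and> G x $ 1 = x$2 / 2 * G x $ 3 \<and> G x $ 2 = - (x$1 / 2 * G x $ 3)} \<inter> V) = 0"
proof -
  have "open (W \<inter> (\<lambda>x. G x $ 3) -` (- {0}))"
    using W(1) G by (intro continuous_open_preimage continuous_intros) auto
  moreover have "p0 \<in> W \<inter> (\<lambda>x. G x $ 3) -` (- {0})" using W(2) G3 by simp
  ultimately obtain r where r: "r > 0" "cball p0 r \<subseteq> W \<inter> (\<lambda>x. G x $ 3) -` (- {0})"
    using open_contains_cball by blast
  define a b where "a x = G x $ 1 / G x $ 3" and "b x = G x $ 2 / G x $ 3" for x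
  have contG: "continuous_on (cball p0 r) G" using G r(2) continuous_on_subset by blast
  have ne: "G x $ 3 \<noteq> 0" if "x \<in> cball p0 r" for x using that r(2) by blast
  have "continuous_on (cball p0 r) a" "continuous_on (cball p0 r) b"
    unfolding a_def b_def using contG ne by (auto intro!: continuous_intros)
  then have uc: "uniformly_continuous_on (cball p0 r) a" "uniformly_continuous_on (cball p0 r) b"
    and "bounded (a ` cball p0 r)" "bounded (b ` cball p0 r)"
    by (auto intro!: compact_uniformly_continuous compact_imp_bounded compact_continuous_image)
  then obtain Ma Mb where "\<forall>x\<in>cball p0 r. \<bar>a x\<bar> \<le> Ma" "\<forall>x\<in>cball p0 r. \<bar>b x\<bar> \<le> Mb"
    unfolding bounded_iff by auto
  then obtain M where M: "M \<ge> 0" "\<And>x. x \<in> cball p0 r \<Longrightarrow> \<bar>a x\<bar> \<le> M \<and> \<bar>b x\<bar> \<le> M"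
    by (meson abs_ge_zero le_max_iff_disj max.cobounded1 order_trans)
  define A where "A = {x\<in>W. F x = 0 \<and> G x $ 1 = x$2 / 2 * G x $ 3 \<and> G x $ 2 = - (x$1 / 2 * G x $ 3)} \<inter> ball p0 r"
  have Ar: "p \<in> cball p0 r" if "p \<in> A" for p using that by (auto simp: A_def)
  have chord: "\<exists>\<xi>\<in>closed_segment p q. \<xi> \<in> cball p0 r \<and> q$3 - p$3 = - (a \<xi> * (q$1 - p$1)) - b \<xi> * (q$2 - p$2)"
    if pq: "p \<in> A" "q \<in> A" for p q
  proof -
    obtain \<xi> where \<xi>: "\<xi> \<in> closed_segment p q" "\<xi> \<in> cball p0 r" "F q - F p = G \<xi> \<bullet> (q - p)"
    proof (rule gradient_mean_value[of "cball p0 r" F G p q])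
      show "(F has_derivative (\<lambda>h. G x \<bullet> h)) (at x)" if "x \<in> cball p0 r" for x using F that r(2) by blast
    qed (use Ar pq that in auto)
    have "G \<xi> $ 3 * (q$3 - p$3) = - (G \<xi> $ 1 * (q$1 - p$1)) - G \<xi> $ 2 * (q$2 - p$2)"
      using \<xi>(3) pq by (simp add: A_def inner_3)
    then have "q$3 - p$3 = (- (G \<xi> $ 1 * (q$1 - p$1)) - G \<xi> $ 2 * (q$2 - p$2)) / G \<xi> $ 3"
      unfolding nonzero_eq_divide_eq[OF ne[OF \<xi>(2)]] by (simp only: mult.commute)
    then have "q$3 - p$3 = - (a \<xi> * (q$1 - p$1)) - b \<xi> * (q$2 - p$2)"
      by (simp add: a_def b_def diff_divide_distrib)
    then show ?thesis using \<xi> by blast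
  qed
  have tangent: "a p = p$2 / 2" "b p = - (p$1 / 2)" if "p \<in> A" for p
    using that ne[OF Ar[OF that]] by (auto simp: A_def a_def b_def)
  have "hausdorff_measure d_cc 3 A = 0"
  proof (rule hausdorff_measure_first_order_horizontal)
    show "\<bar>p$1\<bar> \<le> norm p0 + r \<and> \<bar>p$2\<bar> \<le> norm p0 + r" if "p \<in> A" for p
    proof -
      have "norm p \<le> norm p0 + r"
        using Ar[OF that] norm_triangle_sub[of p p0] by (simp add: dist_norm norm_minus_commute)
      then show ?thesis using component_le_norm_cart[of p 1] component_le_norm_cart[of p 2] by linarith
    qed
    show "0 \<le> norm p0 + r" using r(1) by (simp add: add_nonneg_nonneg)
    fix \<epsilon> :: real assume "\<epsilon> > 0"
    obtain d1 where d1: "d1 > 0" "\<And>x y. \<lbrakk>x \<in> cball p0 r; y \<in> cball p0 r; dist y x < d1\<rbrakk> \<Longrightarrow> \<bar>a y - a x\<bar> < \<epsilon>"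
      using uc(1) \<open>\<epsilon> > 0\<close> unfolding uniformly_continuous_on_def dist_real_def by meson
    obtain d2 where d2: "d2 > 0" "\<And>x y. \<lbrakk>x \<in> cball p0 r; y \<in> cball p0 r; dist y x < d2\<rbrakk> \<Longrightarrow> \<bar>b y - b x\<bar> < \<epsilon>"
      using uc(2) \<open>\<epsilon> > 0\<close> unfolding uniformly_continuous_on_def dist_real_def by meson
    \<comment> \<open>On the surface \<open>\<bar>\<Delta>x\<bar>, \<bar>\<Delta>y\<bar> \<le> \<rho>\<close> force \<open>\<bar>\<Delta>z\<bar> \<le> 2 M \<rho>\<close>, hence a distance of at most \<open>(2 + 2 M) \<rho>\<close>.\<close>
    define \<rho> where "\<rho> = min d1 d2 / (2 * (2 + 2 * M))"
    have "\<rho> > 0" using d1(1) d2(1) M(1) by (simp add: \<rho>_def)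
    have \<rho>d: "(2 + 2 * M) * \<rho> < min d1 d2"
    proof -
      have "(2 + 2 * M) * \<rho> = min d1 d2 / 2" using M(1) by (simp add: \<rho>_def field_simps)
      then show ?thesis using d1(1) d2(1) by linarith
    qed
    have "\<bar>heis_height p q\<bar> \<le> \<epsilon> * (\<bar>q$1 - p$1\<bar> + \<bar>q$2 - p$2\<bar>)"
      if pq: "p \<in> A" "q \<in> A" "\<bar>q$1 - p$1\<bar> \<le> \<rho>" "\<bar>q$2 - p$2\<bar> \<le> \<rho>" for p q
    proof -
      obtain \<xi> where \<xi>: "\<xi> \<in> closed_segment p q" "\<xi> \<in> cball p0 r"
          "q$3 - p$3 = - (a \<xi> * (q$1 - p$1)) - b \<xi> * (q$2 - p$2)"
        using chord[OF pq(1,2)] by blast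
      have "\<bar>a \<xi> * (q$1 - p$1)\<bar> \<le> M * \<rho>" "\<bar>b \<xi> * (q$2 - p$2)\<bar> \<le> M * \<rho>"
        unfolding abs_mult using M(2)[OF \<xi>(2)] pq(3,4) M(1) by (auto intro!: mult_mono)
      then have "\<bar>q$3 - p$3\<bar> \<le> 2 * M * \<rho>" unfolding \<xi>(3) by linarith
      moreover have "norm (q - p) \<le> \<bar>(q - p)$1\<bar> + \<bar>(q - p)$2\<bar> + \<bar>(q - p)$3\<bar>"
        using norm_le_l1_cart[of "q - p"] by (simp add: sum_3)
      ultimately have "norm (q - p) \<le> (2 + 2 * M) * \<rho>" using pq(3,4) by (simp add: algebra_simps)
      moreover have "dist \<xi> p \<le> norm (q - p)"
        using \<xi>(1) by (metis dist_commute dist_in_closed_segment(1) dist_norm norm_minus_commute)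
      ultimately have close: "dist \<xi> p < d1" "dist \<xi> p < d2" using \<rho>d by auto
      have "heis_height p q = - ((a \<xi> - a p) * (q$1 - p$1)) - (b \<xi> - b p) * (q$2 - p$2)"
        using \<xi>(3) unfolding heis_height_def tangent[OF pq(1)] by (simp add: field_simps)
      moreover have "\<bar>(a \<xi> - a p) * (q$1 - p$1)\<bar> \<le> \<epsilon> * \<bar>q$1 - p$1\<bar>"
        unfolding abs_mult using d1(2)[OF Ar[OF pq(1)] \<xi>(2) close(1)] by (intro mult_right_mono) auto
      moreover have "\<bar>(b \<xi> - b p) * (q$2 - p$2)\<bar> \<le> \<epsilon> * \<bar>q$2 - p$2\<bar>"
        unfolding abs_mult using d2(2)[OF Ar[OF pq(1)] \<xi>(2) close(2)] by (intro mult_right_mono) auto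
      ultimately show ?thesis unfolding distrib_left by linarith
    qed
    then show "\<exists>\<rho>>0. \<forall>p\<in>A. \<forall>q\<in>A. \<bar>q$1 - p$1\<bar> \<le> \<rho> \<and> \<bar>q$2 - p$2\<bar> \<le> \<rho> \<longrightarrow>
        \<bar>heis_height p q\<bar> \<le> \<epsilon> * (\<bar>q$1 - p$1\<bar> + \<bar>q$2 - p$2\<bar>)"
      using \<open>\<rho> > 0\<close> by blast
  qed
  then show ?thesis using r(1) by (intro exI[of _ "ball p0 r"]) (simp add: A_def)
qed

section \<open>Rectifiability of hypersurfaces\<close>

theorem theorem1:
  fixes S :: "(real^3) set"
  assumes "C1_hypersurface S"
  shows "countably_rectifiable vertical_subgroup d_cc d_cc 3 S"
proof (rule countably_rectifiable_local)
  fix p assume "p \<in> S"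
  from assms[unfolded C1_hypersurface_def, rule_format, OF this]
  obtain W F G where WFG: "open W \<and> p \<in> W \<and> (\<forall>x\<in>W. (F has_derivative (\<lambda>h. G x \<bullet> h)) (at x)) \<and>
      continuous_on W G \<and> (\<forall>x\<in>W. G x \<noteq> 0) \<and> S \<inter> W = {x\<in>W. F x = 0}"
    by blast
  have W: "open W" "p \<in> W" and F: "\<And>x. x \<in> W \<Longrightarrow> (F has_derivative (\<lambda>h. G x \<bullet> h)) (at x)"
    and G: "continuous_on W G" "\<And>x. x \<in> W \<Longrightarrow> G x \<noteq> 0" and S: "S \<inter> W = {x\<in>W. F x = 0}"
    using WFG by auto
  \<comment> \<open>The characteristic points: both horizontal derivatives of \<open>F\<close> vanish.\<close>
  define Z where "Z = {x\<in>W. F x = 0 \<and> G x $ 1 = x$2 / 2 * G x $ 3 \<and> G x $ 2 = - (x$1 / 2 * G x $ 3)}"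
  have "countably_rectifiable vertical_subgroup d_cc d_cc 3 ({x\<in>W. F x = 0} - Z)"
  proof (rule countably_rectifiable_local)
    fix x assume x: "x \<in> {x\<in>W. F x = 0} - Z"
    then have "x \<in> W" by blast
    have "\<exists>V. open V \<and> x \<in> V \<and> straightenable ({x\<in>W. F x = 0} \<inter> V)"
    proof (cases "G x $ 1 - x$2 / 2 * G x $ 3 = 0")
      case True
      then have "G x $ 2 + x$1 / 2 * G x $ 3 \<noteq> 0" using x by (auto simp: Z_def)
      then show ?thesis
        by (intro straightenable_Y_transverse[OF W(1) \<open>x \<in> W\<close> F G(1)])
    next
      case False
      then show ?thesis
        by (intro straightenable_X_transverse[OF W(1) \<open>x \<in> W\<close> F G(1)])
    qed
    then obtain V where V: "open V" "x \<in> V" "straightenable ({x\<in>W. F x = 0} \<inter> V)" by blast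
    then have "straightenable (({x\<in>W. F x = 0} - Z) \<inter> V)" by (rule_tac straightenable_subset) auto
    then show "\<exists>V. open V \<and> x \<in> V \<and>
        countably_rectifiable vertical_subgroup d_cc d_cc 3 (({x\<in>W. F x = 0} - Z) \<inter> V)"
      using V(1,2) countably_rectifiable_straightenable by blast
  qed
  moreover have "countably_rectifiable vertical_subgroup d_cc d_cc 3 Z"
  proof (rule countably_rectifiable_local)
    fix x assume x: "x \<in> Z"
    then have "x \<in> W" by (simp add: Z_def)
    have "G x $ 3 \<noteq> 0"
    proof
      assume "G x $ 3 = 0"
      then have "G x = 0" using x by (simp add: Z_def vec_eq_iff forall_3)
      then show False using G(2) \<open>x \<in> W\<close> by blast
    qed
    then obtain V where "open V" "x \<in> V" "hausdorff_measure d_cc 3 (Z \<inter> V) = 0"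
      using hausdorff_measure_characteristic_points[OF W(1) \<open>x \<in> W\<close> F G(1)] unfolding Z_def by blast
    then show "\<exists>V. open V \<and> x \<in> V \<and> countably_rectifiable vertical_subgroup d_cc d_cc 3 (Z \<inter> V)"
      using countably_rectifiable_null by blast
  qed
  ultimately have "countably_rectifiable vertical_subgroup d_cc d_cc 3 (({x\<in>W. F x = 0} - Z) \<union> Z)"
    by (rule countably_rectifiable_Un)
  moreover have "({x\<in>W. F x = 0} - Z) \<union> Z = S \<inter> W" unfolding S by (auto simp: Z_def)
  ultimately show "\<exists>V. open V \<and> p \<in> V \<and> countably_rectifiable vertical_subgroup d_cc d_cc 3 (S \<inter> V)"
    using W by auto
qed

end
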